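(* Let $\alpha,\beta$ be positive integers with $\beta > \alpha$, and let $\mathcal{P}$ be an atomic chiral polyhedron of type $\{2^{\alpha}, 2^{\beta}\}$ with rotation group $\Gamma^+(\mathcal P)=\langle\sigma_1,\sigma_2\rangle$. Then either $\mathcal{P}$ is of type $\{8, 2^{\beta}\}$ with $\beta \geq 5$ and \[ \Gamma^+(\mathcal{P}) = \Gamma^{8, 2^{\beta}}(3,\ 1 \pm 2^{\beta-2},\ -3,\ -1 \pm 2^{\beta-2}) \] (same choice of sign in both places), or $\mathcal{P}$ is of type $\{2^{\alpha}, 2^{\alpha+1}\}$ with $\alpha \geq 4$ and \[ \Gamma^+(\mathcal{P}) = \Gamma^{2^{\alpha}, 2^{\alpha+1}}(-1 + 2^{\alpha-1},\ -3 \pm 2^{\alpha-1},\ 1 + 2^{\alpha-1},\ 3 \pm 2^{\alpha-1}) \] (same choice of sign in both places).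
   Context: For integers $p,q,i_1,j_1,i_2,j_2$, $\Gamma^{p,q}(i_1,j_1,i_2,j_2)$ denotes the group with presentation $\langle \sigma_1,\sigma_2 \mid \sigma_1^p=\sigma_2^q=(\sigma_1\sigma_2)^2=1,\ \sigma_2^{-1}\sigma_1=\sigma_1^{i_1}\sigma_2^{j_1},\ \sigma_2\sigma_1^{-1}=\sigma_1^{i_2}\sigma_2^{j_2}\rangle$; an equality $\Gamma^+(\mathcal P)=\Gamma^{p,q}(\dots)$ means the map sending the generators $\sigma_1,\sigma_2$ of the presented group to the distinguished generators of $\Gamma^+(\mathcal P)$ is an isomorphism. An (abstract) polyhedron is a partially ordered set whose elements have rank $0$, $1$, $2$ (vertices, edges, faces), incidence meaning comparability, such that every edge is incident to exactly two vertices and two faces, whenever a vertex is incident to a face exactly two edges are incident to both, the incidence graph is connected, and for each vertex or face the subgraph of the incidence graph induced on its neighbours is connected. A flag is a mutually incident (vertex, edge, face) triple; $\Phi^i$ is the flag differing from $\Phi$ exactly in its rank-$i$ element. Type $\{p,q\}$: faces are incident to $p$ edges and vertices to $q$ edges. A polyhedron is regular if its automorphism group is flag-transitive, and chiral if its flags split into two classes with $\Phi,\Phi^i$ always in different classes and the automorphism group transitive on each class but not on all flags. For a regular or chiral polyhedron with base flag $\Phi$, $\sigma_1:\Phi\mapsto(\Phi^1)^0$ and $\sigma_2:\Phi\mapsto(\Phi^2)^1$ generate the rotation group $\Gamma^+(\mathcal P)$. Tight: exactly $2pq$ flags. $\mathcal P$ covers $\mathcal Q$ if there is a homomorphism $\Gamma^+(\mathcal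 P)\to\Gamma^+(\mathcal Q)$ sending distinguished generators to distinguished generators. A chiral polyhedron of type $\{p,q\}$ is atomic if it is tight and covers no tight chiral polyhedron of type $\{p',q\}$ with $p'<p$ or $\{p,q'\}$ with $q'<q$. *)

theory Defs
  imports "HOL-Algebra.Bij" "HOL-Algebra.Generated_Groups"
begin

section \<open>Group presentations\<close>

text \<open>A word over the generators \<open>'g\<close> and their formal inverses: the letter \<open>(g, True)\<close>
  stands for $g$ and \<open>(g, False)\<close> for $g^{-1}$. A relation $u = v$ is a pair of words.\<close>

type_synonym 'g word = "('g \<times> bool) list"

inductive pres_eq :: "('g word \<times> 'g word) set \<Rightarrow> 'g word \<Rightarrow> 'g word \<Rightarrow> bool"
  for R :: "('g word \<times> 'g word) set" where
  rel: "(u, v) \<in> R \<Longrightarrow> pres_eq R u v"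
| cancel: "pres_eq R [(g, b), (g, \<not> b)] []"
| ctxt: "pres_eq R u v \<Longrightarrow> pres_eq R (x @ u @ y) (x @ v @ y)"
| refl: "pres_eq R u u"
| sym: "pres_eq R u v \<Longrightarrow> pres_eq R v u"
| trans: "pres_eq R u v \<Longrightarrow> pres_eq R v w \<Longrightarrow> pres_eq R u w"

definition pres_class :: "('g word \<times> 'g word) set \<Rightarrow> 'g word \<Rightarrow> 'g word set" where
  "pres_class R u = {v. pres_eq R u v}"

definition presented_group :: "('g word \<times> 'g word) set \<Rightarrow> 'g word set monoid" where
  "presented_group R =
    \<lparr>carrier = range (pres_class R),
     mult = (\<lambda>A B. \<Union>u\<in>A. \<Union>v\<in>B. pres_class R (u @ v)),
     one = pres_class R []\<rparr>"

datatype gen = S1 | S2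

definition gen_pow :: "'g \<Rightarrow> int \<Rightarrow> 'g word" where
  "gen_pow g k = replicate (nat \<bar>k\<bar>) (g, 0 \<le> k)"

definition Gamma_rels :: "int \<Rightarrow> int \<Rightarrow> int \<Rightarrow> int \<Rightarrow> int \<Rightarrow> int \<Rightarrow> (gen word \<times> gen word) set" where
  "Gamma_rels p q i1 j1 i2 j2 =
    {(gen_pow S1 p, []),
     (gen_pow S2 q, []),
     ((gen_pow S1 1 @ gen_pow S2 1) @ (gen_pow S1 1 @ gen_pow S2 1), []),
     (gen_pow S2 (-1) @ gen_pow S1 1, gen_pow S1 i1 @ gen_pow S2 j1),
     (gen_pow S2 1 @ gen_pow S1 (-1), gen_pow S1 i2 @ gen_pow S2 j2)}"

section \<open>Polyhedra\<close>

record 'a ranked_poset =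
  elems :: "'a set"
  ple :: "'a rel"
  rank_of :: "'a \<Rightarrow> nat"

definition of_rank :: "'a ranked_poset \<Rightarrow> nat \<Rightarrow> 'a set" where
  "of_rank P i = {x \<in> elems P. rank_of P x = i}"

abbreviation "vertices P \<equiv> of_rank P 0"
abbreviation "edges P \<equiv> of_rank P 1"
abbreviation "faces P \<equiv> of_rank P 2"

text \<open>Incidence is reflexive here; in the incidence graph, loops are irrelevant for
  connectedness, and \<open>nbrs\<close> excludes them.\<close>

definition incident :: "'a ranked_poset \<Rightarrow> 'a \<Rightarrow> 'a \<Rightarrow> bool" where
  "incident P x y \<longleftrightarrow> x \<in> elems P \<and> y \<in> elems P \<and> ((x, y) \<in> ple P \<or> (y, x) \<in> ple P)"

definition nbrs :: "'a ranked_poset \<Rightarrow> 'a \<Rightarrow> 'a set" where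
  "nbrs P x = {y. incident P x y \<and> y \<noteq> x}"

definition inc_connected :: "'a ranked_poset \<Rightarrow> 'a set \<Rightarrow> bool" where
  "inc_connected P S \<longleftrightarrow>
     S \<noteq> {} \<and> (\<forall>x\<in>S. \<forall>y\<in>S. (x, y) \<in> {(a, b). a \<in> S \<and> b \<in> S \<and> incident P a b}\<^sup>*)"

definition polyhedron :: "'a ranked_poset \<Rightarrow> bool" where
  "polyhedron P \<longleftrightarrow>
     partial_order_on (elems P) (ple P) \<and>
     (\<forall>x\<in>elems P. rank_of P x \<in> {0, 1, 2}) \<and>
     (\<forall>x y. (x, y) \<in> ple P \<and> x \<noteq> y \<longrightarrow> rank_of P x < rank_of P y) \<and>
     (\<forall>e\<in>edges P. card {v \<in> vertices P. incident P v e} = 2 \<and>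
                   card {f \<in> faces P. incident P e f} = 2) \<and>
     (\<forall>v\<in>vertices P. \<forall>f\<in>faces P. incident P v f \<longrightarrow>
        card {e \<in> edges P. incident P v e \<and> incident P e f} = 2) \<and>
     inc_connected P (elems P) \<and>
     (\<forall>x \<in> vertices P \<union> faces P. inc_connected P (nbrs P x))"

text \<open>Finiteness is explicit because \<^const>\<open>card\<close> is 0 on infinite sets.\<close>

definition has_type :: "'a ranked_poset \<Rightarrow> nat \<Rightarrow> nat \<Rightarrow> bool" where
  "has_type P p q \<longleftrightarrow>
     (\<forall>f\<in>faces P. finite {e \<in> edges P. incident P e f} \<and>
                   card {e \<in> edges P. incident P e f} = p) \<and>
     (\<forall>v\<in>vertices P. finite {e \<in> edges P. incident P v e} \<and>
                      card {e \<in> edges P. incident P v e} = q)"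

type_synonym 'a flag = "'a \<times> 'a \<times> 'a"

definition flags :: "'a ranked_poset \<Rightarrow> 'a flag set" where
  "flags P = {(v, e, f). v \<in> vertices P \<and> e \<in> edges P \<and> f \<in> faces P \<and>
                         incident P v e \<and> incident P e f \<and> incident P v f}"

definition flag_elem :: "'a flag \<Rightarrow> nat \<Rightarrow> 'a" where
  "flag_elem \<Phi> j = (case \<Phi> of (v, e, f) \<Rightarrow> if j = 0 then v else if j = 1 then e else f)"

definition flag_adj :: "'a ranked_poset \<Rightarrow> nat \<Rightarrow> 'a flag \<Rightarrow> 'a flag" where
  "flag_adj P i \<Phi> =
     (THE \<Psi>. \<Psi> \<in> flags P \<and> (\<forall>j\<in>{0, 1, 2}. flag_elem \<Psi> j \<noteq> flag_elem \<Phi> j \<longleftrightarrow> j = i))"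

definition tight :: "'a ranked_poset \<Rightarrow> bool" where
  "tight P \<longleftrightarrow> (\<exists>p q. has_type P p q \<and> finite (flags P) \<and> card (flags P) = 2 * p * q)"

section \<open>Automorphisms and rotations\<close>

definition automorphisms :: "'a ranked_poset \<Rightarrow> ('a \<Rightarrow> 'a) set" where
  "automorphisms P =
     {\<gamma> \<in> Bij (elems P).
        (\<forall>x\<in>elems P. \<forall>y\<in>elems P. (\<gamma> x, \<gamma> y) \<in> ple P \<longleftrightarrow> (x, y) \<in> ple P) \<and>
        (\<forall>x\<in>elems P. rank_of P (\<gamma> x) = rank_of P x)}"

text \<open>Automorphisms act on the right: in the product $\gamma\delta$, first $\gamma$ is applied,
  then $\delta$. (The group \<^const>\<open>BijGroup\<close> has the opposite product.) With this convention
  $\sigma_1 = \rho_0\rho_1$ and $\sigma_2 = \rho_1\rho_2$ when there are automorphisms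
  $\rho_i$ mapping the base flag $\Phi$ to $\Phi^i$.\<close>

definition aut_group :: "'a ranked_poset \<Rightarrow> ('a \<Rightarrow> 'a) monoid" where
  "aut_group P =
     \<lparr>carrier = automorphisms P,
      mult = (\<lambda>\<gamma> \<delta>. compose (elems P) \<delta> \<gamma>),
      one = (\<lambda>x \<in> elems P. x)\<rparr>"

definition flag_map :: "('a \<Rightarrow> 'a) \<Rightarrow> 'a flag \<Rightarrow> 'a flag" where
  "flag_map \<gamma> = (\<lambda>(v, e, f). (\<gamma> v, \<gamma> e, \<gamma> f))"

definition aut_transitive_on :: "'a ranked_poset \<Rightarrow> 'a flag set \<Rightarrow> bool" where
  "aut_transitive_on P A \<longleftrightarrow> (\<forall>\<Phi>\<in>A. \<forall>\<Psi>\<in>A. \<exists>\<gamma>\<in>automorphisms P. flag_map \<gamma> \<Phi> = \<Psi>)"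

definition chiral :: "'a ranked_poset \<Rightarrow> bool" where
  "chiral P \<longleftrightarrow>
     polyhedron P \<and>
     (\<exists>A B. A \<union> B = flags P \<and> A \<inter> B = {} \<and>
        (\<forall>\<Phi>\<in>flags P. \<forall>i\<in>{0, 1, 2}. \<Phi> \<in> A \<longleftrightarrow> flag_adj P i \<Phi> \<in> B) \<and>
        aut_transitive_on P A \<and> aut_transitive_on P B) \<and>
     \<not> aut_transitive_on P (flags P)"

definition sigma1 :: "'a ranked_poset \<Rightarrow> 'a flag \<Rightarrow> 'a \<Rightarrow> 'a" where
  "sigma1 P \<Phi> = (THE \<gamma>. \<gamma> \<in> automorphisms P \<and> flag_map \<gamma> \<Phi> = flag_adj P 0 (flag_adj P 1 \<Phi>))"

definition sigma2 :: "'a ranked_poset \<Rightarrow> 'a flag \<Rightarrow> 'a \<Rightarrow> 'a" where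
  "sigma2 P \<Phi> = (THE \<gamma>. \<gamma> \<in> automorphisms P \<and> flag_map \<gamma> \<Phi> = flag_adj P 1 (flag_adj P 2 \<Phi>))"

definition rotation_group :: "'a ranked_poset \<Rightarrow> 'a flag \<Rightarrow> ('a \<Rightarrow> 'a) monoid" where
  "rotation_group P \<Phi> = subgroup_generated (aut_group P) {sigma1 P \<Phi>, sigma2 P \<Phi>}"

definition covers :: "'a ranked_poset \<Rightarrow> 'a flag \<Rightarrow> 'b ranked_poset \<Rightarrow> 'b flag \<Rightarrow> bool" where
  "covers P \<Phi> Q \<Psi> \<longleftrightarrow>
     (\<exists>h \<in> hom (rotation_group P \<Phi>) (rotation_group Q \<Psi>).
        h (sigma1 P \<Phi>) = sigma1 Q \<Psi> \<and> h (sigma2 P \<Phi>) = sigma2 Q \<Psi>)"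

text \<open>A tight polyhedron is finite, so up to isomorphism the covered polyhedra may be taken
  on natural numbers. Every choice of base flag of \<open>Q\<close> is considered: the two flag classes
  of a chiral polyhedron give its two enantiomorphic forms.\<close>

definition atomic_chiral :: "'a ranked_poset \<Rightarrow> 'a flag \<Rightarrow> nat \<Rightarrow> nat \<Rightarrow> bool" where
  "atomic_chiral P \<Phi> p q \<longleftrightarrow>
     chiral P \<and> \<Phi> \<in> flags P \<and> has_type P p q \<and> tight P \<and>
     \<not> (\<exists>(Q :: nat ranked_poset) \<Psi> p' q'.
          (p' < p \<and> q' = q \<or> p' = p \<and> q' < q) \<and>
          chiral Q \<and> \<Psi> \<in> flags Q \<and> has_type Q p' q' \<and> tight Q \<and> covers P \<Phi> Q \<Psi>)"

definition rotation_group_is_Gamma ::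
    "'a ranked_poset \<Rightarrow> 'a flag \<Rightarrow> int \<Rightarrow> int \<Rightarrow> int \<Rightarrow> int \<Rightarrow> int \<Rightarrow> int \<Rightarrow> bool" where
  "rotation_group_is_Gamma P \<Phi> p q i1 j1 i2 j2 \<longleftrightarrow>
     (let R = Gamma_rels p q i1 j1 i2 j2 in
      \<exists>h \<in> iso (presented_group R) (rotation_group P \<Phi>).
        h (pres_class R (gen_pow S1 1)) = sigma1 P \<Phi> \<and>
        h (pres_class R (gen_pow S2 1)) = sigma2 P \<Phi>)"

section \<open>The presented group and the automorphism structure are groups\<close>

lemma pres_eq_append:
  assumes "pres_eq R u u'" "pres_eq R v v'"
  shows "pres_eq R (u @ v) (u' @ v')"
  using pres_eq.ctxt[OF assms(1), of "[]" v] pres_eq.ctxt[OF assms(2), of u' "[]"]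
  by (auto intro: pres_eq.trans)

lemma pres_class_eq_iff: "pres_class R u = pres_class R v \<longleftrightarrow> pres_eq R u v"
  unfolding pres_class_def by (auto intro: pres_eq.refl pres_eq.sym pres_eq.trans)

lemma presented_group_mult:
  "pres_class R u \<otimes>\<^bsub>presented_group R\<^esub> pres_class R v = pres_class R (u @ v)"
  unfolding presented_group_def pres_class_def
  by (auto intro: pres_eq.refl pres_eq.sym pres_eq.trans pres_eq_append)

definition inv_word :: "'g word \<Rightarrow> 'g word" where
  "inv_word u = rev (map (\<lambda>(g, b). (g, \<not> b)) u)"

lemma inv_word_cancel: "pres_eq R (inv_word u @ u) []"
proof (induction u)
  case Nil
  show ?case by (simp add: inv_word_def pres_eq.refl)
next
  case (Cons l u)
  obtain g b where l: "l = (g, b)" by (cases l)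
  have "pres_eq R (inv_word u @ [(g, \<not> b), (g, \<not> \<not> b)] @ u) (inv_word u @ [] @ u)"
    by (intro pres_eq.ctxt pres_eq.cancel)
  moreover have "inv_word (l # u) @ l # u = inv_word u @ [(g, \<not> b), (g, \<not> \<not> b)] @ u"
    by (simp add: inv_word_def l)
  ultimately have "pres_eq R (inv_word (l # u) @ l # u) (inv_word u @ u)" by (simp only: append_Nil)
  then show ?case using Cons by (rule pres_eq.trans)
qed

lemma group_presented_group: "group (presented_group R)"
proof (rule groupI)
  have car: "carrier (presented_group R) = range (pres_class R)"
    and one: "\<one>\<^bsub>presented_group R\<^esub> = pres_class R []"
    by (simp_all add: presented_group_def)
  show "\<one>\<^bsub>presented_group R\<^esub> \<in> carrier (presented_group R)"
    by (simp add: car one)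
  show "x \<otimes>\<^bsub>presented_group R\<^esub> y \<in> carrier (presented_group R)"
    if "x \<in> carrier (presented_group R)" "y \<in> carrier (presented_group R)" for x y
    using that by (auto simp: car presented_group_mult)
  show "x \<otimes>\<^bsub>presented_group R\<^esub> y \<otimes>\<^bsub>presented_group R\<^esub> z =
        x \<otimes>\<^bsub>presented_group R\<^esub> (y \<otimes>\<^bsub>presented_group R\<^esub> z)"
    if "x \<in> carrier (presented_group R)" "y \<in> carrier (presented_group R)"
       "z \<in> carrier (presented_group R)" for x y z
    using that by (auto simp: car presented_group_mult)
  show "\<one>\<^bsub>presented_group R\<^esub> \<otimes>\<^bsub>presented_group R\<^esub> x = x"
    if "x \<in> carrier (presented_group R)" for x
    using that by (auto simp: car one presented_group_mult)
  show "\<exists>y\<in>carrier (presented_group R). y \<otimes>\<^bsub>presented_group R\<^esub> x = \<one>\<^bsub>presented_group R\<^esub>"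
    if "x \<in> carrier (presented_group R)" for x
  proof -
    from that obtain u where u: "x = pres_class R u" by (auto simp: car)
    have "pres_class R (inv_word u) \<otimes>\<^bsub>presented_group R\<^esub> x = \<one>\<^bsub>presented_group R\<^esub>"
      by (simp add: u one presented_group_mult pres_class_eq_iff inv_word_cancel)
    then show ?thesis by (auto simp: car)
  qed
qed

lemma group_aut_group: "group (aut_group P)"
proof (rule groupI)
  show "\<one>\<^bsub>aut_group P\<^esub> \<in> carrier (aut_group P)"
    by (auto simp: aut_group_def automorphisms_def id_Bij)
  show "x \<otimes>\<^bsub>aut_group P\<^esub> y \<in> carrier (aut_group P)"
    if "x \<in> carrier (aut_group P)" "y \<in> carrier (aut_group P)" for x y
  proof -
    have "x a \<in> elems P" if "a \<in> elems P" for a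
      using \<open>x \<in> carrier (aut_group P)\<close> that Bij_imp_funcset[of x "elems P"]
      by (auto simp: aut_group_def automorphisms_def)
    then show ?thesis
      using that by (simp add: aut_group_def automorphisms_def compose_Bij compose_eq)
  qed
  show "x \<otimes>\<^bsub>aut_group P\<^esub> y \<otimes>\<^bsub>aut_group P\<^esub> z =
        x \<otimes>\<^bsub>aut_group P\<^esub> (y \<otimes>\<^bsub>aut_group P\<^esub> z)"
    if "x \<in> carrier (aut_group P)" "y \<in> carrier (aut_group P)" "z \<in> carrier (aut_group P)"
    for x y z
    using that
    by (auto simp: aut_group_def automorphisms_def Bij_imp_funcset compose_assoc)
  show "\<one>\<^bsub>aut_group P\<^esub> \<otimes>\<^bsub>aut_group P\<^esub> x = x" if "x \<in> carrier (aut_group P)" for x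
    using that Bij_imp_extensional[of x "elems P"]
    by (auto simp: aut_group_def automorphisms_def compose_def extensional_def fun_eq_iff)
  show "\<exists>y\<in>carrier (aut_group P). y \<otimes>\<^bsub>aut_group P\<^esub> x = \<one>\<^bsub>aut_group P\<^esub>"
    if x: "x \<in> carrier (aut_group P)" for x
  proof -
    let ?E = "elems P"
    let ?y = "restrict (inv_into ?E x) ?E"
    have xB: "x \<in> Bij ?E" using x by (simp add: aut_group_def automorphisms_def)
    then have img: "x ` ?E = ?E" and inj: "inj_on x ?E"
      by (auto simp: Bij_def bij_betw_def)
    have yE: "inv_into ?E x a \<in> ?E" and xy: "x (inv_into ?E x a) = a" if "a \<in> ?E" for a
      using that img by (auto simp: inv_into_into f_inv_into_f)
    have "(inv_into ?E x a, inv_into ?E x b) \<in> ple P \<longleftrightarrow> (a, b) \<in> ple P"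
      if "a \<in> ?E" "b \<in> ?E" for a b
      using x yE[OF that(1)] yE[OF that(2)] xy[OF that(1)] xy[OF that(2)]
      unfolding aut_group_def automorphisms_def by fastforce
    moreover have "rank_of P (inv_into ?E x a) = rank_of P a" if "a \<in> ?E" for a
      using x yE[OF that] xy[OF that] unfolding aut_group_def automorphisms_def by fastforce
    ultimately have "?y \<in> carrier (aut_group P)"
      using restrict_inv_into_Bij[OF xB] by (simp add: aut_group_def automorphisms_def)
    moreover have "?y \<otimes>\<^bsub>aut_group P\<^esub> x = \<one>\<^bsub>aut_group P\<^esub>"
      by (auto simp: aut_group_def compose_def xy fun_eq_iff)
    ultimately show ?thesis by blast
  qed
qed

end

theory Submission
  imports Defs "HOL-Algebra.Multiplicative_Group"
begin

text \<open>
  For a tight polyhedron of type \<open>{p, q}\<close> the rotation group is an exact product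
  \<open>\<langle>x\<rangle>\<langle>y\<rangle>\<close> of cyclic groups of orders \<open>p\<close> and \<open>q\<close> with \<open>(x y)\<^sup>2 = 1\<close>; conversely the cosets of
  \<open>\<langle>x\<rangle>\<close>, \<open>\<langle>y\<rangle>\<close>, \<open>\<langle>x y\<rangle>\<close> in such a product form a tight polyhedron, regular if and only if
  inverting both generators extends to an automorphism. Let \<open>p < q\<close> be powers of 2. Counting
  products in \<open>\<langle>y\<rangle> x \<langle>y\<rangle>\<close> shows that \<open>y\<^bsup>q/2\<^esup>\<close> is central. If also \<open>x\<^bsup>p/2\<^esup>\<close> were central, atomicity would
  make both quotients regular, and then the group itself, since the two kernels meet trivially.
  So \<open>\<langle>x\<rangle>\<close> has trivial core, while \<open>\<langle>y\<rangle>\<close> has core \<open>\<langle>y\<^sup>k\<rangle>\<close> with \<open>4 \<le> k < q\<close>. An induction exchanging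
  the roles of \<open>x\<close> and \<open>y\<close> shows that in a regular group in which \<open>\<langle>y\<rangle>\<close> is core-free \<open>\<langle>x\<^sup>2\<rangle>\<close> is
  normal; applied to the quotient by \<open>\<langle>y\<^sup>k\<rangle>\<close> it makes \<open>\<langle>x\<^sup>2, y\<^sup>k\<rangle>\<close> an abelian normal subgroup. Writing
  \<open>x y\<^sup>k x\<^sup>-\<^sup>1 = y\<^bsup>c k\<^esup>\<close> and \<open>y\<^sup>-\<^sup>1 x\<^sup>2 y = x\<^bsup>2 d\<^esup> y\<^bsup>k e\<^esup>\<close>, the group is determined by \<open>c, d, e, k\<close>, and congruences
  modulo powers of 2 leave only the listed possibilities.
\<close>

section \<open>Conjugation and powers\<close>

text \<open>The involution x y is what keeps the number of constants small: x y acts on a normal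
  subgroup <y^k> exactly as x does, so this action has order at most 2 and x^2 centralizes <y^k>.
  The element y^(k e (1 - c)) measures the failure of reflexibility, since it is the quotient of two
  computations of the mirror image of y^-1 x^2 y. In a reflexible group it must be trivial, while
  the valuations show that it is not; this contradiction drives the induction. In the minimal chiral
  group it must have order 2, and the same valuations force the core <y^4>. The sign in the result
  is the residue modulo 4 of an odd cofactor of e or of 1 + e.

  Reflexibility is phrased by a relation on G instead of an automorphism of a quotient, so that G
  and all its quotients are treated with one notion. The converse difficulty lies in the
  presentation: the presented group has no known order at the start. Facts that rest on (x y)^2 = 1
  alone are therefore kept apart in \<open>invol_pair\<close>, apply to the presented group as well,
  and finally bound its order by p q.\<close>

definition (in group) conjg :: "'a \<Rightarrow> 'a \<Rightarrow> 'a" where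
  "conjg g h = g \<otimes> h \<otimes> inv g"

context group
begin

lemma mult_inv_cancel_left [simp]:
  assumes "a \<in> carrier G" "b \<in> carrier G"
  shows "a \<otimes> (inv a \<otimes> b) = b" "inv a \<otimes> (a \<otimes> b) = b"
  using assms by (simp_all add: m_assoc [symmetric])

lemmas group_norm = m_assoc inv_mult_group

lemma conjg_closed [simp]: "g \<in> carrier G \<Longrightarrow> h \<in> carrier G \<Longrightarrow> conjg g h \<in> carrier G"
  by (simp add: conjg_def)

lemma conjg_mult:
  "g \<in> carrier G \<Longrightarrow> h \<in> carrier G \<Longrightarrow> k \<in> carrier G \<Longrightarrow> conjg g (h \<otimes> k) = conjg g h \<otimes> conjg g k"
  by (simp add: conjg_def m_assoc)

lemma conjg_hom: "g \<in> carrier G \<Longrightarrow> group_hom G G (conjg g)"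
  by unfold_locales (auto simp: hom_def conjg_mult)

lemma conjg_int_pow:
  fixes n :: int
  shows "g \<in> carrier G \<Longrightarrow> h \<in> carrier G \<Longrightarrow> conjg g (h [^] n) = conjg g h [^] n"
  using group_hom.hom_int_pow[OF conjg_hom] by blast

lemma conjg_inv: "g \<in> carrier G \<Longrightarrow> h \<in> carrier G \<Longrightarrow> conjg g (inv h) = inv (conjg g h)"
  using group_hom.hom_inv[OF conjg_hom] by blast

lemma conjg_conjg:
  "g \<in> carrier G \<Longrightarrow> h \<in> carrier G \<Longrightarrow> k \<in> carrier G \<Longrightarrow> conjg g (conjg h k) = conjg (g \<otimes> h) k"
  by (simp add: conjg_def group_norm)

lemma conjg_one_left [simp]: "h \<in> carrier G \<Longrightarrow> conjg \<one> h = h"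
  by (simp add: conjg_def)

lemma conjg_inv_cancel [simp]:
  assumes "g \<in> carrier G" "h \<in> carrier G"
  shows "conjg g (conjg (inv g) h) = h" "conjg (inv g) (conjg g h) = h"
  using assms by (simp_all add: conjg_conjg)

lemma conjg_eq_iff:
  "g \<in> carrier G \<Longrightarrow> h \<in> carrier G \<Longrightarrow> k \<in> carrier G \<Longrightarrow> conjg g h = k \<longleftrightarrow> g \<otimes> h = k \<otimes> g"
  unfolding conjg_def by (simp add: inv_solve_right')

lemma conjg_inv_eq_iff:
  "g \<in> carrier G \<Longrightarrow> h \<in> carrier G \<Longrightarrow> k \<in> carrier G \<Longrightarrow> conjg (inv g) h = k \<longleftrightarrow> conjg g k = h"
  by (metis conjg_inv_cancel inv_closed)

lemma int_pow_commute:
  fixes n :: int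
  assumes "a \<in> carrier G" "b \<in> carrier G" "a \<otimes> b = b \<otimes> a"
  shows "a \<otimes> b [^] n = b [^] n \<otimes> a"
  using assms conjg_eq_iff[of a b b] conjg_eq_iff[of a "b [^] n" "b [^] n"] conjg_int_pow[of a b n]
  by auto

lemma int_pow_commute2:
  fixes m n :: int
  assumes "a \<in> carrier G" "b \<in> carrier G" "a \<otimes> b = b \<otimes> a"
  shows "a [^] m \<otimes> b [^] n = b [^] n \<otimes> a [^] m"
proof -
  have "b [^] n \<otimes> a = a \<otimes> b [^] n" using int_pow_commute[OF assms] by simp
  then have "b [^] n \<otimes> a [^] m = a [^] m \<otimes> b [^] n" using assms(1,2) by (intro int_pow_commute) auto
  then show ?thesis by simp
qed

lemma int_pow_self_commute:
  fixes m n :: int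
  shows "a \<in> carrier G \<Longrightarrow> a [^] m \<otimes> a [^] n = a [^] n \<otimes> a [^] m"
  by (simp add: int_pow_mult [symmetric] add.commute)

lemma int_pow_mult_left:
  fixes m n :: int
  shows "a \<in> carrier G \<Longrightarrow> b \<in> carrier G \<Longrightarrow> a [^] m \<otimes> (a [^] n \<otimes> b) = a [^] (m + n) \<otimes> b"
  by (simp add: m_assoc [symmetric] int_pow_mult)

lemma conjg_nat_pow:
  fixes c :: int
  assumes "a \<in> carrier G" "b \<in> carrier G" "conjg a b = b [^] c"
  shows "conjg (a [^] (n::nat)) b = b [^] (c ^ n)"
proof (induction n)
  case (Suc n)
  have "conjg (a [^] Suc n) b = conjg (a [^] n) (conjg a b)"
    using assms(1,2) by (simp add: conjg_conjg)
  also have "\<dots> = conjg (a [^] n) b [^] c" using assms by (simp add: conjg_int_pow)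
  also have "\<dots> = b [^] (c ^ Suc n)" using assms Suc by (simp add: int_pow_pow mult.commute)
  finally show ?case .
qed (use assms in simp)

end

section \<open>Tight pairs of generators\<close>

locale invol_pair = group G for G (structure) +
  fixes x y :: 'a
  assumes x_in [simp, intro]: "x \<in> carrier G"
    and y_in [simp, intro]: "y \<in> carrier G"
    and invol: "x \<otimes> y \<otimes> (x \<otimes> y) = \<one>"
begin

lemma yx_eq: "y \<otimes> x = inv x \<otimes> inv y"
  using invol by (metis inv_solve_left m_assoc r_one x_in y_in inv_closed m_closed r_inv inv_mult_group inv_equality inv_inv)

lemma xy_eq: "x \<otimes> y = inv y \<otimes> inv x"
  using invol by (metis inv_equality inv_mult_group m_closed x_in y_in)

text \<open>y x is a conjugate of x y, hence again an involution; every statement about the pair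
  thus has a twin with x and y exchanged.\<close>

lemma swap_invol: "invol_pair G y x"
  by unfold_locales (simp, simp, subst (1) yx_eq, simp add: m_assoc)

lemma conjg_x_y: "conjg x y = inv y \<otimes> x [^] (-2::int)"
proof -
  have "conjg x y = inv y \<otimes> (inv x \<otimes> inv x)" by (simp add: conjg_def xy_eq m_assoc)
  also have "inv x \<otimes> inv x = x [^] (-2::int)"
    using int_pow_mult[of x "-1" "-1"] by (simp add: int_pow_neg)
  finally show ?thesis .
qed

lemma conjg_y_y_pow: "conjg y (y [^] (n::int)) = y [^] n" "conjg (inv y) (y [^] (n::int)) = y [^] n"
proof -
  have "y \<otimes> y [^] n = y [^] n \<otimes> y"
    using int_pow_mult[of y 1 n] int_pow_mult[of y n 1] by (simp add: add.commute)
  then show "conjg y (y [^] n) = y [^] n" by (simp add: conjg_eq_iff)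
  then show "conjg (inv y) (y [^] n) = y [^] n" by (simp add: conjg_inv_eq_iff)
qed

lemma conjg_x_x_pow: "conjg x (x [^] (n::int)) = x [^] n"
  by (rule invol_pair.conjg_y_y_pow(1)[OF swap_invol])

text \<open>y centralizes y^k, so x y acts on y^k as x does; since x y squares to 1, so does this
  action.\<close>

lemma square_normal_exponent:
  fixes c k :: int
  assumes "conjg x (y [^] k) = y [^] (c * k)"
  shows "y [^] (c * c * k) = y [^] k"
proof -
  have xy: "conjg (x \<otimes> y) (y [^] k) = y [^] (c * k)"
    using assms by (simp add: conjg_conjg [symmetric] conjg_y_y_pow)
  have "conjg (x \<otimes> y) (y [^] (c * k)) = conjg (x \<otimes> y) (y [^] k) [^] c"
    by (simp add: conjg_int_pow [symmetric] int_pow_pow mult.commute)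
  then have "conjg (x \<otimes> y) (conjg (x \<otimes> y) (y [^] k)) = y [^] (c * c * k)"
    using xy by (simp add: int_pow_pow ac_simps)
  then show ?thesis using invol by (simp add: conjg_conjg)
qed

lemma conjg_x_pow_mult:
  fixes c k n :: int
  assumes "conjg x (y [^] k) = y [^] (c * k)"
  shows "conjg x (y [^] (k * n)) = y [^] (k * (c * n))"
  using conjg_int_pow[of x "y [^] k" n] assms by (simp add: int_pow_pow ac_simps)

text \<open>Conjugation by x is an involution on <y^k>, so x^2 acts trivially there. All later
  coordinates on <x^2, y^k> rest on this commutation.\<close>

lemma x_square_commute:
  fixes c k i j :: int
  assumes "conjg x (y [^] k) = y [^] (c * k)"
  shows "x [^] (2 * i) \<otimes> y [^] (k * j) = y [^] (k * j) \<otimes> x [^] (2 * i)"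
proof -
  have "conjg x (conjg x (y [^] k)) = y [^] k"
    using conjg_x_pow_mult[OF assms, of c] square_normal_exponent[OF assms] assms by (simp add: ac_simps)
  then have "conjg (x [^] (2::int)) (y [^] k) = y [^] k"
    using int_pow_mult[of x 1 1] by (simp add: conjg_conjg)
  then have "x [^] (2::int) \<otimes> y [^] k = y [^] k \<otimes> x [^] (2::int)" by (simp add: conjg_eq_iff)
  then have "(x [^] (2::int)) [^] i \<otimes> (y [^] k) [^] j = (y [^] k) [^] j \<otimes> (x [^] (2::int)) [^] i"
    by (rule int_pow_commute2[rotated 2]) auto
  then show ?thesis by (simp add: int_pow_pow)
qed

end

text \<open>The exact orders of x and y and the uniqueness of the factorization are consequences of
  \<open>card_carrier\<close> and \<open>factor\<close>, so a new instance only has to verify x^p =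
  1 and y^q = 1.\<close>

locale tight_pair = invol_pair G x y for G (structure) and x y +
  fixes p q :: nat
  assumes x_pow: "x [^] p = \<one>"
    and y_pow: "y [^] q = \<one>"
    and card_carrier: "card (carrier G) = p * q"
    and p_pos: "0 < p" and q_pos: "0 < q"
    and factor: "\<And>g. g \<in> carrier G \<Longrightarrow> \<exists>(i::int) (j::int). g = x [^] i \<otimes> y [^] j"
begin

lemma finite_carrier: "finite (carrier G)"
  using card_carrier p_pos q_pos by (metis card_ge_0_finite nat_0_less_mult_iff)

lemma x_int_pow: "x [^] (int p * i) = \<one>"
  using x_pow by (simp add: int_pow_pow [symmetric] int_pow_int)

lemma y_int_pow: "y [^] (int q * i) = \<one>"
  using y_pow by (simp add: int_pow_pow [symmetric] int_pow_int)

lemma x_pow_cong: "int p dvd i - j \<Longrightarrow> x [^] i = x [^] j"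
  by (metis add_diff_cancel_left' diff_add_cancel dvdE int_pow_mult l_one int_pow_closed x_in x_int_pow)

lemma y_pow_cong: "int q dvd i - j \<Longrightarrow> y [^] i = y [^] j"
  by (metis add_diff_cancel_left' diff_add_cancel dvdE int_pow_mult l_one int_pow_closed y_in y_int_pow)

lemma x_pow_mod: "x [^] (i mod int p) = x [^] i"
  by (rule x_pow_cong) (metis dvd_minus_mod dvd_diff_commute)

lemma y_pow_mod: "y [^] (i mod int q) = y [^] i"
  by (rule y_pow_cong) (metis dvd_minus_mod dvd_diff_commute)

text \<open>The p q pairs of residues cover a group with p q elements, so no two of them can give
  the same product.\<close>

lemma xy_pow_eq_one_iff: "x [^] i \<otimes> y [^] j = \<one> \<longleftrightarrow> int p dvd i \<and> int q dvd j"
proof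
  assume eq: "x [^] i \<otimes> y [^] j = \<one>"
  let ?A = "{0..<int p} \<times> {0..<int q}"
  let ?f = "\<lambda>(i::int, j::int). x [^] i \<otimes> y [^] j"
  have "?f ` ?A = carrier G"
  proof
    show "carrier G \<subseteq> ?f ` ?A"
    proof
      fix g assume "g \<in> carrier G"
      then obtain i :: int and j :: int where "g = x [^] i \<otimes> y [^] j" using factor by blast
      then have "g = ?f (i mod int p, j mod int q)" by (simp add: x_pow_mod y_pow_mod)
      moreover have "(i mod int p, j mod int q) \<in> ?A" using p_pos q_pos by simp
      ultimately show "g \<in> ?f ` ?A" by (rule image_eqI)
    qed
  qed auto
  then have "inj_on ?f ?A"
    by (intro eq_card_imp_inj_on) (auto simp: card_carrier)
  moreover have "?f (i mod int p, j mod int q) = ?f (0, 0)"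
    using eq by (simp add: x_pow_mod y_pow_mod)
  moreover have "(i mod int p, j mod int q) \<in> ?A" "(0, 0) \<in> ?A" using p_pos q_pos by simp_all
  ultimately have "(i mod int p, j mod int q) = (0, 0)" by (metis inj_onD)
  then show "int p dvd i \<and> int q dvd j" by (simp add: dvd_eq_mod_eq_0)
next
  assume "int p dvd i \<and> int q dvd j"
  then show "x [^] i \<otimes> y [^] j = \<one>" using x_int_pow y_int_pow by (auto elim!: dvdE)
qed

lemma x_pow_eq_one_iff: "x [^] (i::int) = \<one> \<longleftrightarrow> int p dvd i"
  using xy_pow_eq_one_iff[of i 0] by simp

lemma y_pow_eq_one_iff: "y [^] (j::int) = \<one> \<longleftrightarrow> int q dvd j"
  using xy_pow_eq_one_iff[of 0 j] by simp

lemma xy_pow_eq_iff: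
  "x [^] i \<otimes> y [^] j = x [^] k \<otimes> y [^] l \<longleftrightarrow> int p dvd i - k \<and> int q dvd j - l"
proof -
  have "x [^] i \<otimes> y [^] j = x [^] k \<otimes> y [^] l \<longleftrightarrow>
      inv (x [^] k) \<otimes> (x [^] i \<otimes> y [^] j) \<otimes> inv (y [^] l) = \<one>"
    by (simp add: inv_solve_left' inv_solve_right')
  also have "inv (x [^] k) \<otimes> (x [^] i \<otimes> y [^] j) \<otimes> inv (y [^] l) = x [^] (i - k) \<otimes> y [^] (j - l)"
    using int_pow_mult[of y j "-l"]
    by (simp add: int_pow_neg [symmetric] m_assoc int_pow_mult_left)
  finally show ?thesis by (simp add: xy_pow_eq_one_iff)
qed

lemma x_pow_eq_iff: "x [^] (i::int) = x [^] k \<longleftrightarrow> int p dvd i - k"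
  using xy_pow_eq_iff[of i 0 k 0] by simp

lemma y_pow_eq_iff: "y [^] (j::int) = y [^] l \<longleftrightarrow> int q dvd j - l"
  using xy_pow_eq_iff[of 0 j 0 l] by simp

lemma swap: "tight_pair G y x q p"
proof unfold_locales
  show "y \<otimes> x \<otimes> (y \<otimes> x) = \<one>" by (subst (1) yx_eq) (simp add: m_assoc)
  show "card (carrier G) = q * p" by (simp add: card_carrier)
  show "\<exists>(i::int) (j::int). g = y [^] i \<otimes> x [^] j" if "g \<in> carrier G" for g
  proof -
    \<comment> \<open>Inversion reverses the order of the factors, so \<open>inv g\<close> is
      factored instead of g.\<close>
    obtain i :: int and j :: int where "inv g = x [^] i \<otimes> y [^] j" using factor \<open>g \<in> carrier G\<close> by blast
    then have "inv (inv g) = y [^] (-j) \<otimes> x [^] (-i)" by (simp only: inv_mult_group int_pow_neg int_pow_closed x_in y_in)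
    then show ?thesis using that by auto
  qed
qed (simp_all add: x_pow y_pow p_pos q_pos)

text \<open>A subgroup \<open>\<langle>y\<^sup>n\<rangle>\<close> with \<open>n\<close> dividing \<open>q\<close> is the only one of its order in the cyclic group \<open>\<langle>y\<rangle>\<close>.\<close>

lemma conjg_y_pow_dvd:
  fixes n l :: int
  assumes g: "g \<in> carrier G" and eq: "conjg g (y [^] n) = y [^] l" and n: "n dvd int q"
  shows "n dvd l"
proof -
  obtain r where r: "int q = n * r" using n by blast
  have "conjg g (y [^] (n * r)) = y [^] (l * r)"
    using g eq conjg_int_pow[of g "y [^] n" r] by (simp add: int_pow_pow)
  moreover have "y [^] (n * r) = \<one>" using y_int_pow[of 1] r by simp
  ultimately have "y [^] (l * r) = \<one>" using g by (simp add: conjg_def)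
  then have "n * r dvd l * r" by (simp add: y_pow_eq_one_iff r)
  moreover have "r \<noteq> 0" using r q_pos by auto
  ultimately show ?thesis by simp
qed

text \<open>A cyclic group of even order has only one element of order 2, so a conjugation that
  keeps this element inside <y> must fix it.\<close>

lemma central_y_half:
  fixes h l :: int
  assumes q2: "int q = 2 * h" and eq: "conjg x (y [^] h) = y [^] l"
  shows "conjg x (y [^] h) = y [^] h"
proof -
  have "h dvd l" using conjg_y_pow_dvd[OF x_in eq] q2 by simp
  then obtain r where r: "l = h * r" by blast
  have "odd r"
  proof
    assume "even r"
    then have "y [^] l = \<one>" by (auto simp: y_pow_eq_one_iff q2 r)
    then have "conjg x (y [^] h) = \<one>" using eq by simp
    then have "y [^] h = \<one>" by (simp add: conjg_eq_iff)
    then have "2 * h dvd h" by (simp add: y_pow_eq_one_iff q2)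
    moreover have "h > 0" using q2 q_pos by simp
    ultimately show False using zdvd_imp_le by fastforce
  qed
  then have "int q dvd l - h" by (auto simp: q2 r algebra_simps elim!: oddE)
  then show ?thesis using eq by (simp add: y_pow_cong)
qed

end

section \<open>The arithmetic of the exponents\<close>

lemma two_power_dvd_odd_mult_iff:
  fixes w :: int
  assumes "odd w"
  shows "2 ^ m dvd 2 ^ n * w \<longleftrightarrow> m \<le> n"
proof
  assume "2 ^ m dvd 2 ^ n * w"
  moreover have "coprime ((2::int) ^ m) w" using assms by simp
  ultimately have "(2::int) ^ m dvd 2 ^ n" by (simp add: coprime_dvd_mult_left_iff)
  then show "m \<le> n" by (simp add: dvd_power_iff)
next
  assume "m \<le> n"
  then show "2 ^ m dvd 2 ^ n * w" by (intro dvd_mult2 le_imp_power_dvd)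
qed

lemma two_power_odd_decomp:
  fixes n :: int
  assumes "n \<noteq> 0"
  shows "\<exists>v w. n = 2 ^ v * w \<and> odd w"
  using assms
proof (induction "nat \<bar>n\<bar>" arbitrary: n rule: less_induct)
  case less
  show ?case
  proof (cases "even n")
    case True
    then obtain m where m: "n = 2 * m" by blast
    then have "\<bar>m\<bar> < \<bar>n\<bar>" using less.prems by linarith
    then obtain v w where "m = 2 ^ v * w" "odd w" using less.hyps[of m] less.prems m by auto
    then have "n = 2 ^ Suc v * w \<and> odd w" using m by simp
    then show ?thesis by blast
  next
    case False
    then have "n = 2 ^ 0 * n \<and> odd n" by simp
    then show ?thesis by blast
  qed
qed

text \<open>Here p = 2^a, q = 2^b and the core is <y^(2^k)>. The pair \<open>e1\<close>,
  \<open>e2\<close> fixes the 2-adic valuation of e, the pair \<open>d1\<close>, \<open>d2\<close>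
  that of d + 1, and \<open>c1\<close> expresses c by e. The hypothesis \<open>ec\<close> is
  reflexibility modulo <y^(q/2)>, whereas the second conclusion says that reflexibility of the group
  itself fails; so one statement serves the classification and also yields the contradiction in the
  induction.\<close>

lemma exponent_arithmetic:
  fixes c d e :: int and a b k :: nat
  assumes k2: "2 \<le> k" and kb: "k < b" and a2: "2 \<le> a"
    and dd: "2 ^ a dvd 2 * (d\<^sup>2 - 1)"
    and edc: "2 ^ b dvd 2 ^ k * e * (d + c)"
    and e1: "2 ^ b dvd 2 ^ k * e * 2 ^ (a - 1)"
    and e2: "\<not> 2 ^ b dvd 2 ^ k * e * 2 ^ (a - 2)"
    and ec: "2 ^ (b - 1) dvd 2 ^ k * e * (c - 1)"
    and d1: "2 ^ a dvd (d + 1) * 2 ^ k"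
    and d2: "\<not> 2 ^ a dvd (d + 1) * 2 ^ (k - 1)"
    and c1: "2 ^ b dvd 2 ^ k * (c + 1 + 2 ^ (k - 1) * e)"
  shows "k = 2" and "\<not> 2 ^ b dvd 2 ^ k * e * (c - 1)"
    and "(a = 3 \<and> 5 \<le> b \<and> (\<exists>w. odd w \<and> e = 2 ^ (b - 4) * w) \<and> 4 dvd d - 1) \<or>
      (4 \<le> a \<and> b = a + 1 \<and> (\<exists>w. odd w \<and> e = - 1 + 2 ^ (a - 3) * w) \<and>
        (\<exists>u. odd u \<and> d = - 1 + 2 ^ (a - 2) * u))"
proof -
  have cancel: "2 ^ m dvd 2 ^ n * r \<longleftrightarrow> 2 ^ (m - n) dvd r" if "n \<le> m" for m n and r :: int
  proof -
    have "(2::int) ^ m = 2 ^ n * 2 ^ (m - n)" using that by (simp add: power_add [symmetric])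
    then show ?thesis by simp
  qed
  have split: "(2::int) ^ m = 2 ^ n * 2 ^ l" if "m = n + l" for m n l
    using that by (simp add: power_add)
  have "e \<noteq> 0" using e2 by auto
  then obtain v w where e: "e = 2 ^ v * w" and w: "odd w" using two_power_odd_decomp by blast
  have "d + 1 \<noteq> 0" using d2 by auto
  then obtain s u where d: "d + 1 = 2 ^ s * u" and u: "odd u" using two_power_odd_decomp by blast
  \<comment> \<open>\<open>e1\<close> and \<open>e2\<close> differ by a single factor 2, so together
    they are an equation for the valuation v of e.\<close>
  have v: "k + v + a = b + 1"
  proof -
    have "2 ^ k * e * 2 ^ (a - 1) = 2 ^ (k + v + (a - 1)) * w" by (simp add: e power_add)
    then have "b \<le> k + v + (a - 1)" using e1 two_power_dvd_odd_mult_iff[OF w] by metis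
    moreover have "2 ^ k * e * 2 ^ (a - 2) = 2 ^ (k + v + (a - 2)) * w" by (simp add: e power_add)
    then have "\<not> b \<le> k + v + (a - 2)" using e2 two_power_dvd_odd_mult_iff[OF w] by metis
    ultimately show ?thesis using a2 by linarith
  qed
  have s: "s + k = a"
  proof -
    have "(d + 1) * 2 ^ k = 2 ^ (s + k) * u" by (simp add: d power_add)
    then have "a \<le> s + k" using d1 two_power_dvd_odd_mult_iff[OF u] by metis
    moreover have "(d + 1) * 2 ^ (k - 1) = 2 ^ (s + (k - 1)) * u" by (simp add: d power_add)
    then have "\<not> a \<le> s + (k - 1)" using d2 two_power_dvd_odd_mult_iff[OF u] by metis
    ultimately show ?thesis using k2 by linarith
  qed
  obtain t where c: "c + 1 + 2 ^ (k - 1) * e = 2 ^ (b - k) * t"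
    using c1 kb cancel[of k b "c + 1 + 2 ^ (k - 1) * e"] by (auto elim: dvdE)
  have dd': "2 ^ a dvd 2 * ((d - 1) * (2 ^ s * u))"
  proof -
    have "2 * (d\<^sup>2 - 1) = 2 * ((d - 1) * (d + 1))" by (simp add: power2_eq_square algebra_simps)
    then show ?thesis using dd by (simp only: d)
  qed
  have s0: "s \<noteq> 0"
  proof
    assume "s = 0"
    then have "odd (d + 1)" using d u by simp
    then have "odd (d\<^sup>2 - 1)" by simp
    then have "a \<le> 1" using dd two_power_dvd_odd_mult_iff[of "d\<^sup>2 - 1" a 1] by simp
    then show False using a2 by simp
  qed
  have "k = 2 \<and> 3 \<le> a"
  proof (cases "s = 1")
    case True
    then have k: "k = a - 1" using s by simp
    have "a \<le> 3"
    proof (rule ccontr)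
      assume "\<not> a \<le> 3"
      then have a4: "4 \<le> a" by simp
      \<comment> \<open>c - 1 is twice the odd number r, so \<open>ec\<close> becomes an inequality
        between known valuations, which fails for 4 \<le> a.\<close>
      define r where "r = 2 ^ (b - k - 1) * t - 1 - 2 ^ (k - 2) * e"
      have "2 ^ (b - k) = 2 * (2::int) ^ (b - k - 1)" using kb split[of "b - k" "b - k - 1" 1] by (simp add: Suc_diff_Suc)
      moreover have "k - 1 = k - 2 + 1" using k2 by linarith
      from split[OF this] have "2 ^ (k - 1) = 2 * (2::int) ^ (k - 2)" by simp
      ultimately have cr: "c - 1 = 2 * r" using c by (simp add: r_def algebra_simps)
      have "b - k - 1 \<noteq> 0" "k - 2 \<noteq> 0" using v k a4 by linarith+
      then have "odd r" by (simp add: r_def)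
      have "2 ^ k * e * (c - 1) = 2 ^ (k + v + 1) * (w * r)" by (simp add: cr e power_add)
      then have "2 ^ (b - 1) dvd 2 ^ (k + v + 1) * (w * r)" using ec by metis
      moreover have "odd (w * r)" using \<open>odd r\<close> w by simp
      ultimately have "b - 1 \<le> k + v + 1" using two_power_dvd_odd_mult_iff by blast
      then show False using v k a4 by linarith
    qed
    then show ?thesis using k k2 by linarith
  next
    case False
    then have s2: "2 \<le> s" using s0 by simp
    \<comment> \<open>As 4 divides d + 1, the number d - 1 is 2 modulo 4. Hence 2 (d^2 - 1) has
      valuation s + 2, and \<open>dd\<close> together with s + k = a gives k \<le> 2.\<close>
    then have "(2::int) ^ s = 2 * (2 * 2 ^ (s - 2))" using split[of s "s - 2" 2] by simp
    then have "d - 1 = 2 * (2 * 2 ^ (s - 2) * u - 1)" using d by (simp add: algebra_simps)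
    then have "2 * ((d - 1) * (2 ^ s * u)) = 2 ^ (s + 2) * ((2 * 2 ^ (s - 2) * u - 1) * u)"
      by (simp add: power_add)
    then have "2 ^ a dvd 2 ^ (s + 2) * ((2 * 2 ^ (s - 2) * u - 1) * u)" using dd' by metis
    then have "a \<le> s + 2" using u two_power_dvd_odd_mult_iff[of "(2 * 2 ^ (s - 2) * u - 1) * u" a "s + 2"] by simp
    then show ?thesis using s s2 k2 by linarith
  qed
  then have k: "k = 2" and a3: "3 \<le> a" by simp_all
  have sa: "s = a - 2" and vb: "v + a = b - 1" using s v k a3 by linarith+
  have b: "b - 2 = v + (a - 1)" using vb a3 by linarith
  have c': "c + 1 + 2 * e = 2 ^ (b - 2) * t" using c k by simp
  then have c'': "c = 2 ^ (b - 2) * t - 1 - 2 * e" by simp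
  \<comment> \<open>Replacing c by -1 - 2 e modulo 2^(b - 2) eliminates c; cancelling the power 2^v
    from e then leaves a congruence between d and e alone.\<close>
  have "2 ^ (b - 2) dvd e * (d + c)" using edc kb k cancel[of 2 b "e * (d + c)"] by (simp add: mult.assoc)
  moreover have "e * (d + c) = e * (d - 1 - 2 * e) + 2 ^ (b - 2) * (e * t)"
    by (simp add: c'' algebra_simps)
  ultimately have "2 ^ (b - 2) dvd e * (d - 1 - 2 * e)" by (metis dvd_add_left_iff dvd_triv_left)
  then have "2 ^ (b - 2) dvd 2 ^ v * (w * (d - 1 - 2 * e))" by (simp add: e mult.assoc)
  then have "2 ^ (a - 1) dvd w * (d - 1 - 2 * e)" using cancel[of v "b - 2"] b by simp
  moreover have "coprime ((2::int) ^ (a - 1)) w" using w by simp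
  ultimately have "2 ^ (a - 1) dvd d - 1 - 2 * e" by (simp add: coprime_dvd_mult_right_iff)
  then obtain r where r: "d - 1 - 2 * e = 2 ^ (a - 1) * r" by blast
  \<comment> \<open>Substituting d + 1 = 2^(a - 2) u into the congruence gives 2 (1 + e) = 2^(a - 2)
    (u - 2 r), so f is the odd part of 1 + e.\<close>
  define f where "f = u - 2 * r"
  have f: "odd f" using u by (simp add: f_def)
  have "(2::int) ^ (a - 1) = 2 * 2 * 2 ^ (a - 3)" "(2::int) ^ (a - 2) = 2 * 2 ^ (a - 3)"
  proof -
    have "a - 1 = a - 3 + 2" "a - 2 = a - 3 + 1" using a3 by linarith+
    from split[OF this(1)] split[OF this(2)]
    show "(2::int) ^ (a - 1) = 2 * 2 * 2 ^ (a - 3)" "(2::int) ^ (a - 2) = 2 * 2 ^ (a - 3)" by simp_all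
  qed
  then have ef: "1 + e = 2 ^ (a - 3) * f" using r d sa by (simp add: f_def algebra_simps)
  show "k = 2" by (fact k)
  \<comment> \<open>Modulo 2^(b - 2) the number e (c - 1) is -2 e (1 + e), of valuation v + a - 2 =
    b - 3: exactly one factor 2 is missing.\<close>
  show "\<not> 2 ^ b dvd 2 ^ k * e * (c - 1)"
  proof
    assume "2 ^ b dvd 2 ^ k * e * (c - 1)"
    then have "2 ^ (b - 2) dvd e * (c - 1)" using kb k cancel[of 2 b "e * (c - 1)"] by (simp add: mult.assoc)
    moreover have "e * (c - 1) = 2 ^ (b - 2) * (e * t) - e * (2 * (1 + e))"
      by (simp add: c'' algebra_simps)
    ultimately have "2 ^ (b - 2) dvd e * (2 * (1 + e))" by (metis dvd_diff_right_iff dvd_triv_left)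
    also have "e * (2 * (1 + e)) = 2 ^ (v + 1 + (a - 3)) * (w * f)"
      by (simp only: ef) (simp add: e power_add)
    finally have "2 ^ (b - 2) dvd 2 ^ (v + 1 + (a - 3)) * (w * f)" .
    moreover have "odd (w * f)" using w f by simp
    ultimately have "b - 2 \<le> v + 1 + (a - 3)" using two_power_dvd_odd_mult_iff by blast
    then show False using b a3 by linarith
  qed
  show "(a = 3 \<and> 5 \<le> b \<and> (\<exists>w. odd w \<and> e = 2 ^ (b - 4) * w) \<and> 4 dvd d - 1) \<or>
      (4 \<le> a \<and> b = a + 1 \<and> (\<exists>w. odd w \<and> e = - 1 + 2 ^ (a - 3) * w) \<and>
        (\<exists>u. odd u \<and> d = - 1 + 2 ^ (a - 2) * u))"
  \<comment> \<open>The two families are separated by the parity of 1 + e = 2^(a - 3) f. For a = 3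
    it is odd, so e is even and b = v + 4 \<ge> 5; otherwise e is odd and v = 0.\<close>
  proof (cases "a = 3")
    case True
    then have "even e" using ef f by (metis diff_self_eq_0 even_add odd_one power_0 mult_1)
    then have "v \<noteq> 0" using e w by auto
    moreover have "v = b - 4" using vb True by simp
    moreover obtain n where "u = 2 * n + 1" using u by (rule oddE)
    then have "d - 1 = 4 * n" using d sa True by simp
    ultimately show ?thesis using True e w by auto
  next
    case False
    then have a4: "4 \<le> a" using a3 by simp
    then have "even (1 + e)" using ef by simp
    then have "v = 0" using e by (cases v) auto
    then have "b = a + 1" using vb a4 by linarith
    moreover have "e = - 1 + 2 ^ (a - 3) * f" using ef by simp
    moreover have "d = - 1 + 2 ^ (a - 2) * u" using d sa by simp
    ultimately show ?thesis using a4 f u by blast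
  qed
qed

section \<open>Constraints on the structure constants\<close>

locale metabelian_pair = tight_pair +
  fixes c d e k :: int
  assumes conjg_x: "conjg x (y [^] k) = y [^] (c * k)"
    and conjg_inv_y: "conjg (inv y) (x [^] (2::int)) = x [^] (2 * d) \<otimes> y [^] (k * e)"
begin

text \<open>Additive coordinates on the abelian subgroup generated by x^2 and y^k: products add
  them, and conjugation by x or y acts on them by an integer matrix.\<close>

definition t :: "int \<Rightarrow> int \<Rightarrow> 'a" where
  "t i j = x [^] (2 * i) \<otimes> y [^] (k * j)"

lemma t_closed [simp]: "t i j \<in> carrier G" by (simp add: t_def)

lemma t_mult: "t i j \<otimes> t i' j' = t (i + i') (j + j')"
proof -
  have "t i j \<otimes> t i' j' = x [^] (2 * i) \<otimes> (y [^] (k * j) \<otimes> x [^] (2 * i')) \<otimes> y [^] (k * j')"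
    by (simp add: t_def m_assoc)
  also have "\<dots> = x [^] (2 * i) \<otimes> (x [^] (2 * i') \<otimes> y [^] (k * j)) \<otimes> y [^] (k * j')"
    by (simp add: x_square_commute[OF conjg_x])
  also have "\<dots> = x [^] (2 * i + 2 * i') \<otimes> y [^] (k * j + k * j')"
    by (simp add: int_pow_mult m_assoc)
  finally show ?thesis by (simp add: t_def algebra_simps)
qed

lemma t_int_pow: "t i j [^] (n::int) = t (i * n) (j * n)"
  using int_pow_mult_distrib[OF x_square_commute[OF conjg_x, of i j], of n]
  by (simp add: t_def int_pow_pow ac_simps)

lemma t_eq_iff: "t i j = t i' j' \<longleftrightarrow> int p dvd 2 * (i - i') \<and> int q dvd k * (j - j')"
  by (simp add: t_def xy_pow_eq_iff right_diff_distrib)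

lemma t_split: "t i j = t 1 0 [^] i \<otimes> t 0 1 [^] j"
  by (simp add: t_int_pow t_mult)

lemma conjg_t:
  assumes "g \<in> carrier G" "conjg g (t 1 0) = t i j" "conjg g (t 0 1) = t i' j'"
  shows "conjg g (t m n) = t (i * m + i' * n) (j * m + j' * n)"
  using assms by (simp add: t_split[of m n] conjg_mult conjg_int_pow) (simp add: t_int_pow t_mult)

lemma conjg_x_t: "conjg x (t i j) = t i (c * j)"
  using conjg_t[of x 1 0 0 c i j] conjg_x conjg_x_x_pow[of 2] by (simp add: t_def mult.commute)

lemma conjg_inv_y_t: "conjg (inv y) (t i j) = t (d * i) (e * i + j)"
  using conjg_t[of "inv y" d e 0 1 i j] conjg_inv_y conjg_y_y_pow(2)[of k] by (simp add: t_def)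

lemma conjg_x2_t: "conjg (x [^] (2 * n :: int)) (t i j) = t i j"
  using t_mult[of n 0 i j] t_mult[of i j n 0]
  by (subst conjg_eq_iff) (simp_all add: t_def add.commute)

text \<open>The identity x y^-1 = x^2 y x expresses conjugation by y through conjugation by y^-1, up
  to x and x^2. Both fix x^2, and x^2 acts trivially on the coordinates.\<close>

lemma conjg_y_x2: "conjg y (t 1 0) = t d (c * e)"
proof -
  have "inv (conjg x y) \<otimes> x = t 1 0 \<otimes> y \<otimes> x"
    unfolding conjg_x_y by (simp add: t_def inv_mult_group int_pow_neg)
  also have "inv (conjg x y) \<otimes> x = x \<otimes> inv y" by (simp add: conjg_def group_norm)
  finally have "conjg x (conjg (inv y) (t 1 0)) = conjg (t 1 0) (conjg y (conjg x (t 1 0)))"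
    by (simp add: conjg_conjg m_assoc)
  then have "t d (c * e) = conjg (t 1 0) (conjg y (t 1 0))"
    by (simp add: conjg_inv_y_t conjg_x_t)
  then have "conjg (inv (t 1 0)) (t d (c * e)) = conjg y (t 1 0)" by simp
  moreover have "inv (t 1 0) = x [^] (2 * (-1::int))" by (simp add: t_def int_pow_neg)
  ultimately show ?thesis using conjg_x2_t[of "-1"] by simp
qed

lemma conjg_y_t: "conjg y (t i j) = t (d * i) (c * e * i + j)"
  using conjg_t[of y d "c * e" 0 1 i j] conjg_y_x2 conjg_y_y_pow(1)[of k] by (simp add: t_def)

text \<open>Conjugations by y and by y^-1 cancel on x^2; the two congruences are the two coordinates
  of this cancellation.\<close>

lemma d_square: "int p dvd 2 * (d\<^sup>2 - 1)" and e_d_c: "int q dvd k * e * (d + c)"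
proof -
  have "t 1 0 = conjg (inv y) (conjg y (t 1 0))" by simp
  also have "\<dots> = t (d * d) (e * d + c * e)" by (simp add: conjg_y_x2 conjg_inv_y_t)
  finally have "t (d * d) (e * d + c * e) = t 1 0" ..
  then have "int p dvd 2 * (d * d - 1) \<and> int q dvd k * (e * d + c * e)" by (simp add: t_eq_iff)
  then show "int p dvd 2 * (d\<^sup>2 - 1)" "int q dvd k * e * (d + c)"
    by (simp_all add: power2_eq_square algebra_simps)
qed

text \<open>In the square of x y x^-1 = y^-1 x^-2 both factors y^-1 are moved to the right; this
  conjugates one x^-2 by y^-1 and the other by y^-2.\<close>

lemma conjg_x_y2: "conjg x (y [^] (2::int)) = t (- (d + 1)) (- (e * (d + 2))) \<otimes> y [^] (-2::int)"
proof -
  have r: "conjg x y = inv y \<otimes> t (-1) 0" by (simp add: conjg_x_y t_def)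
  \<comment> \<open>The first coordinate is -d^2, which may be replaced by -1 because d^2 acts as 1
    in the exponent of x^2.\<close>
  have "t (d * (d * -1)) (e * (d * -1) + e * -1) = t (-1) (- (e * (d + 1)))"
  proof (subst t_eq_iff, intro conjI)
    show "int p dvd 2 * (d * (d * -1) - (-1))"
      using d_square dvd_minus_iff[of "int p" "2 * (d\<^sup>2 - 1)"]
      by (simp add: power2_eq_square algebra_simps)
  qed (simp add: algebra_simps)
  then have yy: "conjg (inv y) (conjg (inv y) (t (-1) 0)) = t (-1) (- (e * (d + 1)))"
    by (simp add: conjg_inv_y_t)
  have "conjg x (y [^] (2::int)) = conjg x y \<otimes> conjg x y"
    using int_pow_mult[of "conjg x y" 1 1] by (simp add: conjg_int_pow)
  also have "\<dots> = conjg (inv y) (t (-1) 0) \<otimes> conjg (inv y) (conjg (inv y) (t (-1) 0)) \<otimes> (inv y \<otimes> inv y)"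
    by (simp add: r) (simp add: conjg_def group_norm)
  also have "\<dots> = t (- d) (- e) \<otimes> t (-1) (- (e * (d + 1))) \<otimes> (inv y \<otimes> inv y)"
    unfolding yy by (simp add: conjg_inv_y_t)
  also have "t (- d) (- e) \<otimes> t (-1) (- (e * (d + 1))) = t (- (d + 1)) (- (e * (d + 2)))"
    unfolding t_mult by (rule arg_cong2[where f = t]) (simp_all add: algebra_simps)
  also have "inv y \<otimes> inv y = y [^] (-2::int)"
    using int_pow_mult[of y "-1" "-1"] by (simp add: int_pow_neg)
  finally show ?thesis .
qed

end

text \<open>Minimality of the core says that conjugation by x keeps y^(2^m) inside <y> but not
  y^(2^(m - 1)). Powers of the formula for x y^2 x^-1 turn this into the two conditions on d + 1. In
  the same way the two conditions on e say that y centralizes x^p = 1 but not x^(p/2).\<close>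

lemma (in metabelian_pair) structure_constraints:
  fixes a b m :: nat
  assumes p: "p = 2 ^ a" and q: "q = 2 ^ b" and a1: "1 \<le> a"
    and k: "k = 2 ^ m" and m2: "2 \<le> m" and mb: "m < b"
    and min: "\<And>l::int. conjg x (y [^] (2 ^ (m - 1) :: int)) \<noteq> y [^] l"
    and core: "conjg y (x [^] (2 ^ (a - 1) :: int)) \<noteq> x [^] (2 ^ (a - 1) :: int)"
    and ec: "2 ^ (b - 1) dvd 2 ^ m * e * (c - 1)"
  shows "2 \<le> a" and "2 ^ a dvd 2 * (d\<^sup>2 - 1)" and "2 ^ b dvd 2 ^ m * e * (d + c)"
    and "2 ^ b dvd 2 ^ m * e * 2 ^ (a - 1)" and "\<not> 2 ^ b dvd 2 ^ m * e * 2 ^ (a - 2)"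
    and "2 ^ a dvd (d + 1) * 2 ^ m" and "\<not> 2 ^ a dvd (d + 1) * 2 ^ (m - 1)"
    and "2 ^ b dvd 2 ^ m * (c + 1 + 2 ^ (m - 1) * e)"
proof -
  have p': "int p = 2 ^ a" and q': "int q = 2 ^ b" by (simp_all add: p q)
  show dd: "2 ^ a dvd 2 * (d\<^sup>2 - 1)" using d_square p' by simp
  show edc: "2 ^ b dvd 2 ^ m * e * (d + c)" using e_d_c q' k by simp
  have split: "(2::int) ^ n = 2 ^ i * 2 ^ l" if "n = i + l" for n i l
    using that by (simp add: power_add)
  obtain n where m: "m = Suc (Suc n)" using m2 by (metis add_2_eq_Suc le_Suc_ex)
  \<comment> \<open>For p = 2 the relation x y x^-1 = y^-1 x^-2 says that x inverts y. Then every
    <y^n> is normalized by x, against minimality of m.\<close>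
  show a2: "2 \<le> a"
  proof (rule ccontr)
    assume "\<not> 2 \<le> a"
    then have "a = 1" using a1 by simp
    then have "x [^] (-2::int) = \<one>" using p' by (simp add: x_pow_eq_one_iff)
    then have "conjg x y = y [^] (-1::int)" by (simp add: conjg_x_y int_pow_neg)
    then have "conjg x (y [^] (2 ^ (m - 1) :: int)) = y [^] (- 1 * 2 ^ (m - 1) :: int)"
      by (simp only: conjg_int_pow x_in y_in int_pow_pow)
    then show False using min by blast
  qed
  then obtain s where a: "a = Suc (Suc s)" by (metis add_2_eq_Suc le_Suc_ex)
  have d_odd: "odd d"
  proof -
    have "(2::int) * 2 dvd 2 ^ a" by (simp add: a)
    then have "2 * 2 dvd 2 * (d\<^sup>2 - 1)" using dd by (rule dvd_trans)
    then have "even (d\<^sup>2 - 1)" by (simp only: dvd_times_left_cancel_iff)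
    then show ?thesis by simp
  qed
  have half: "t (2 ^ s) 0 = x [^] (2 ^ (a - 1) :: int)" by (simp add: t_def a)
  have "conjg (inv y) (t (2 ^ Suc s) 0) = t (2 ^ Suc s) 0"
  proof -
    have "t (2 ^ Suc s) 0 = \<one>" using a p' by (simp add: t_def x_pow_eq_one_iff)
    then show ?thesis by (simp add: conjg_eq_iff)
  qed
  then show "2 ^ b dvd 2 ^ m * e * 2 ^ (a - 1)"
    by (simp only: conjg_inv_y_t t_eq_iff) (simp add: q' k a mult.assoc)
  \<comment> \<open>Since d is odd, conjugation by y^-1 preserves the first coordinate of x^(p/2).
    If the second coordinate were preserved too, y would centralize x^(p/2).\<close>
  show "\<not> 2 ^ b dvd 2 ^ m * e * 2 ^ (a - 2)"
  proof
    assume "2 ^ b dvd 2 ^ m * e * 2 ^ (a - 2)"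
    then have "int q dvd k * (e * 2 ^ s)" by (simp add: q' k a mult.assoc)
    moreover obtain r where "d = 2 * r + 1" using d_odd by (rule oddE)
    then have "int p dvd 2 * (d * 2 ^ s - 2 ^ s)" by (simp add: p' a algebra_simps)
    ultimately have "conjg (inv y) (t (2 ^ s) 0) = t (2 ^ s) 0"
      by (simp add: conjg_inv_y_t t_eq_iff)
    then show False using core half by (simp add: conjg_inv_eq_iff)
  qed
  have ed1: "2 ^ (b - 1) dvd 2 ^ m * e * (d + 1)"
  proof -
    have "(2::int) ^ (b - 1) dvd 2 ^ b" by (simp add: le_imp_power_dvd)
    then have "2 ^ (b - 1) dvd 2 ^ m * e * (d + c) - 2 ^ m * e * (c - 1)"
      using edc ec by (metis dvd_trans dvd_diff)
    also have "2 ^ m * e * (d + c) - 2 ^ m * e * (c - 1) = 2 ^ m * e * (d + 1)"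
      by (simp add: algebra_simps)
    finally show ?thesis .
  qed
  have ed2: "2 ^ b dvd 2 ^ m * e * (d + 1) * r" if "even r" for r
  proof -
    have "(2::int) ^ b = 2 ^ (b - 1) * 2" using mb split[of b "b - 1" 1] by simp
    then show ?thesis using ed1 that by (simp only: mult_dvd_mono)
  qed
  \<comment> \<open>The y-part of x y^2 x^-1 has exponent -k e (d + 2) - 2, which is 2 f because k =
    2^m.\<close>
  define f where "f = - (2 ^ Suc n * e * (d + 2)) - 1"
  \<comment> \<open>The x-part of x y^2 x^-1 commutes with y^2, so powers of the whole product can
    be taken factor by factor.\<close>
  have yy: "x [^] (- (2 * (d + 1))) \<otimes> y [^] (2::int) = y [^] (2::int) \<otimes> x [^] (- (2 * (d + 1)))"
  proof -
    have "conjg y (conjg y (t (- (d + 1)) 0)) = t (- (d + 1)) 0"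
    proof (simp only: conjg_y_t t_eq_iff, intro conjI)
      have "d * (d * - (d + 1)) - (- (d + 1)) = (d\<^sup>2 - 1) * - (d + 1)"
        by (simp add: power2_eq_square algebra_simps)
      then have "2 * (d * (d * - (d + 1)) - (- (d + 1))) = 2 * (d\<^sup>2 - 1) * - (d + 1)" by simp
      then show "int p dvd 2 * (d * (d * - (d + 1)) - - (d + 1))" using dd p' by (metis dvd_mult2)
      have "k * (c * e * (d * - (d + 1)) + (c * e * - (d + 1) + 0) - 0) =
          2 ^ m * e * (d + 1) * (- c * (d + 1))"
        by (simp add: k algebra_simps)
      then show "int q dvd k * (c * e * (d * - (d + 1)) + (c * e * - (d + 1) + 0) - 0)"
        using ed2[of "- c * (d + 1)"] d_odd q' by simp
    qed
    then have "conjg (y [^] (2::int)) (t (- (d + 1)) 0) = t (- (d + 1)) 0"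
      using int_pow_mult[of y 1 1] by (simp add: conjg_conjg)
    then show ?thesis by (simp add: conjg_eq_iff t_def)
  qed
  have base: "conjg x (y [^] (2::int)) = x [^] (- (2 * (d + 1))) \<otimes> (y [^] (2::int)) [^] f"
  proof -
    have "k * - (e * (d + 2)) + - 2 = 2 * f" by (simp add: f_def k m algebra_simps)
    then have "y [^] (k * - (e * (d + 2))) \<otimes> y [^] (-2::int) = (y [^] (2::int)) [^] f"
      by (simp only: int_pow_mult [symmetric] int_pow_pow y_in)
    then show ?thesis by (simp add: conjg_x_y2 t_def m_assoc)
  qed
  have pow: "conjg x (y [^] (2 * r)) = x [^] (- (2 * (d + 1)) * r) \<otimes> y [^] (2 * f * r)" for r :: int
  proof -
    have "conjg x (y [^] (2 * r)) = conjg x (y [^] (2::int)) [^] r"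
      by (simp add: conjg_int_pow [symmetric] int_pow_pow)
    also have "\<dots> = (x [^] (- (2 * (d + 1)))) [^] r \<otimes> ((y [^] (2::int)) [^] f) [^] r"
      unfolding base using int_pow_commute[OF _ _ yy, of f] by (intro int_pow_mult_distrib) auto
    finally show ?thesis by (simp add: int_pow_pow)
  qed
  show "\<not> 2 ^ a dvd (d + 1) * 2 ^ (m - 1)"
  proof
    assume "2 ^ a dvd (d + 1) * 2 ^ (m - 1)"
    moreover have "- (2 * (d + 1)) * 2 ^ n = - ((d + 1) * 2 ^ (m - 1))" by (simp add: m algebra_simps)
    ultimately have "int p dvd - (2 * (d + 1)) * 2 ^ n" by (simp only: p' dvd_minus_iff)
    then have "x [^] (- (2 * (d + 1)) * 2 ^ n) = \<one>" by (simp only: x_pow_eq_one_iff)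
    then have "conjg x (y [^] (2 ^ (m - 1) :: int)) = y [^] (2 * f * 2 ^ n)"
      using pow[of "2 ^ n"] by (simp add: m)
    then show False using min by blast
  qed
  have "x [^] (- (2 * (d + 1)) * 2 ^ Suc n) \<otimes> y [^] (2 * f * 2 ^ Suc n) = x [^] (0::int) \<otimes> y [^] (c * k)"
    using pow[of "2 ^ Suc n"] conjg_x by (simp add: k m)
  then have pd: "int p dvd - (2 * (d + 1)) * 2 ^ Suc n" and qd: "int q dvd 2 * f * 2 ^ Suc n - c * k"
    by (simp_all only: xy_pow_eq_iff) simp_all
  have "- (2 * (d + 1)) * 2 ^ Suc n = - ((d + 1) * 2 ^ m)" by (simp add: m algebra_simps)
  then show "2 ^ a dvd (d + 1) * 2 ^ m" using pd by (simp only: p' dvd_minus_iff)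
  \<comment> \<open>The added term is a multiple of 2^b. It replaces d + 2 by 1 inside f and so
    removes d from the congruence.\<close>
  have "2 ^ b dvd (2 * f * 2 ^ Suc n - c * k) + 2 ^ m * e * (d + 1) * 2 ^ (m - 1)"
    using qd q' m ed2[of "2 ^ (m - 1)"] by (intro dvd_add) auto
  also have "(2 * f * 2 ^ Suc n - c * k) + 2 ^ m * e * (d + 1) * 2 ^ (m - 1) =
      - (2 ^ m * (c + 1 + 2 ^ (m - 1) * e))"
    by (simp add: f_def k m algebra_simps)
  finally show "2 ^ b dvd 2 ^ m * (c + 1 + 2 ^ (m - 1) * e)" by (simp only: dvd_minus_iff)
qed

section \<open>The mirror correspondence\<close>

context tight_pair
begin

text \<open>The submonoid of G x G generated by (x, x^-1) and (y, y^-1), a subgroup because the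
  orders are finite. It makes sense for every pair and is the graph of an automorphism exactly when
  its only element over \<one> is (\<one>, \<one>).\<close>

inductive mirror :: "'a \<Rightarrow> 'a \<Rightarrow> bool" where
  mirror_one: "mirror \<one> \<one>"
| mirror_x: "mirror g h \<Longrightarrow> mirror (x \<otimes> g) (inv x \<otimes> h)"
| mirror_y: "mirror g h \<Longrightarrow> mirror (y \<otimes> g) (inv y \<otimes> h)"

text \<open>The words in \<open>x\<close> and \<open>y\<close> that vanish stay in \<open>N\<close> when \<open>x\<close> and \<open>y\<close> are replaced by their
  inverses. For a normal subgroup \<open>N\<close> inverted by this substitution, the quotient by \<open>N\<close> then
  has an automorphism inverting both generators; this is regularity of the corresponding
  polyhedron.\<close>

definition reflexible_mod :: "'a set \<Rightarrow> bool" where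
  "reflexible_mod N \<longleftrightarrow> (\<forall>h. mirror \<one> h \<longrightarrow> h \<in> N)"

lemma mirror_closed: "mirror g h \<Longrightarrow> g \<in> carrier G \<and> h \<in> carrier G"
  by (induction rule: mirror.induct) auto

lemma mirror_mult: "mirror g h \<Longrightarrow> mirror g' h' \<Longrightarrow> mirror (g \<otimes> g') (h \<otimes> h')"
proof (induction rule: mirror.induct)
  case mirror_one
  then show ?case using mirror_closed by simp
next
  case (mirror_x g h)
  then show ?case using mirror_closed mirror.mirror_x[of "g \<otimes> g'" "h \<otimes> h'"] by (simp add: m_assoc)
next
  case (mirror_y g h)
  then show ?case using mirror_closed mirror.mirror_y[of "g \<otimes> g'" "h \<otimes> h'"] by (simp add: m_assoc)
qed

lemma mirror_nat_pow: "mirror g h \<Longrightarrow> mirror (g [^] (n::nat)) (h [^] n)"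
  by (induction n) (auto intro: mirror_one mirror_mult)

text \<open>The rules build positive words only, but x^p = 1 turns every integer power of x into a
  natural one.\<close>

lemma mirror_x_pow: "mirror (x [^] (i::int)) (x [^] (- i))"
proof -
  have "mirror x (inv x)" using mirror_x[OF mirror_one] by simp
  then have "mirror (x [^] nat (i mod int p)) (inv x [^] nat (i mod int p))" by (rule mirror_nat_pow)
  moreover have pow: "x [^] nat (i mod int p) = x [^] i"
    using p_pos by (simp add: int_pow_int [symmetric] x_pow_mod)
  moreover have "inv x [^] nat (i mod int p) = x [^] (- i)"
    using pow by (simp add: nat_pow_inv int_pow_neg)
  ultimately show ?thesis by simp
qed

lemma mirror_y_pow: "mirror (y [^] (i::int)) (y [^] (- i))"
proof -
  have "mirror y (inv y)" using mirror_y[OF mirror_one] by simp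
  then have "mirror (y [^] nat (i mod int q)) (inv y [^] nat (i mod int q))" by (rule mirror_nat_pow)
  moreover have pow: "y [^] nat (i mod int q) = y [^] i"
    using q_pos by (simp add: int_pow_int [symmetric] y_pow_mod)
  moreover have "inv y [^] nat (i mod int q) = y [^] (- i)"
    using pow by (simp add: nat_pow_inv int_pow_neg)
  ultimately show ?thesis by simp
qed

lemma mirror_inv: "mirror g h \<Longrightarrow> mirror (inv g) (inv h)"
proof (induction rule: mirror.induct)
  case mirror_one
  then show ?case by (simp add: mirror.mirror_one)
next
  case (mirror_x g h)
  have "mirror (inv x) x" using mirror_x_pow[of "-1"] by (simp add: int_pow_neg)
  then show ?case using mirror_mult[OF mirror_x.IH] mirror_closed[OF mirror_x.hyps]
    by (simp add: inv_mult_group)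
next
  case (mirror_y g h)
  have "mirror (inv y) y" using mirror_y_pow[of "-1"] by (simp add: int_pow_neg)
  then show ?case using mirror_mult[OF mirror_y.IH] mirror_closed[OF mirror_y.hyps]
    by (simp add: inv_mult_group)
qed

lemma mirror_sym: "mirror g h \<Longrightarrow> mirror h g"
proof (induction rule: mirror.induct)
  case (mirror_x g h)
  have "mirror (inv x) x" using mirror_x_pow[of "-1"] by (simp add: int_pow_neg)
  then show ?case using mirror_mult mirror_x.IH by blast
next
  case (mirror_y g h)
  have "mirror (inv y) y" using mirror_y_pow[of "-1"] by (simp add: int_pow_neg)
  then show ?case using mirror_mult mirror_y.IH by blast
qed (rule mirror_one)

lemma mirror_total: "g \<in> carrier G \<Longrightarrow> \<exists>h. mirror g h"
  using factor mirror_mult mirror_x_pow mirror_y_pow by blast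

lemma mirror_unique_mod:
  assumes "reflexible_mod N" "mirror g h" "mirror g h'"
  shows "inv h \<otimes> h' \<in> N"
proof -
  have "mirror (inv g \<otimes> g) (inv h \<otimes> h')" using assms mirror_mult mirror_inv by blast
  then show ?thesis using assms mirror_closed by (auto simp: reflexible_mod_def)
qed

lemma mirror_swap: "tight_pair.mirror G y x = mirror"
proof -
  interpret S: tight_pair G y x q p by (rule swap)
  have "S.mirror g h \<Longrightarrow> mirror g h" for g h
    by (induction rule: S.mirror.induct) (auto intro: mirror.intros)
  moreover have "mirror g h \<Longrightarrow> S.mirror g h" for g h
    by (induction rule: mirror.induct) (auto intro: S.mirror.intros)
  ultimately show ?thesis by blast
qed

lemma reflexible_mod_swap: "tight_pair.reflexible_mod G y x N \<longleftrightarrow> reflexible_mod N"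
  using tight_pair.reflexible_mod_def[OF swap] mirror_swap by (simp add: reflexible_mod_def)

end

text \<open>The mirror image of y^-1 x^2 y = x^(2 d) y^(k e) is computed twice: from the left side
  as y x^-2 y^-1, and from the right side by negating the exponents. The two images differ by this
  power of y.\<close>

lemma (in metabelian_pair) reflexible_mod_exponent:
  assumes "reflexible_mod N"
  shows "y [^] (k * e * (1 - c)) \<in> N"
proof -
  have "mirror (inv y) y" "mirror y (inv y)"
    using mirror_y_pow[of "-1"] mirror_y_pow[of 1] by (simp_all add: int_pow_neg)
  then have "mirror (conjg (inv y) (t 1 0)) (conjg y (t (-1) 0))"
    using mirror_x_pow[of 2] mirror_mult by (simp add: conjg_def t_def)
  then have "mirror (t d e) (t (- d) (- (c * e)))" by (simp add: conjg_inv_y_t conjg_y_t)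
  moreover have "mirror (t d e) (t (- d) (- e))"
    using mirror_mult[OF mirror_x_pow[of "2 * d"] mirror_y_pow[of "k * e"]] by (simp add: t_def)
  ultimately have "inv (t (- d) (- e)) \<otimes> t (- d) (- (c * e)) \<in> N"
    using mirror_unique_mod[OF assms] by blast
  moreover have "inv (t (- d) (- e)) = t d e"
    using t_int_pow[of "- d" "- e" "-1"] by (simp add: int_pow_neg)
  ultimately have "t 0 (e - c * e) \<in> N" by (simp add: t_mult)
  then show ?thesis by (simp add: t_def algebra_simps)
qed

section \<open>Quotients by subgroups of the factors\<close>

context tight_pair
begin

text \<open>Powers of y commute with each other and x has finite order, so it suffices to look at
  conjugation by natural powers of x.\<close>

lemma y_pow_normal:
  fixes n :: nat and l :: int
  assumes n: "n dvd q" and eq: "conjg x (y [^] int n) = y [^] l"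
  shows "range (\<lambda>j::int. y [^] (int n * j)) \<lhd> G"
proof -
  let ?N = "range (\<lambda>j::int. y [^] (int n * j))"
  obtain c where "l = int n * c" using conjg_y_pow_dvd[OF x_in eq] n by auto
  then have c: "conjg x (y [^] int n) = y [^] (c * int n)" using eq by (simp add: mult.commute)
  have x: "conjg (x [^] (i::nat)) (y [^] int n) = (y [^] int n) [^] (c ^ i)" for i
    using c by (intro conjg_nat_pow) (simp_all add: int_pow_pow mult.commute)
  have "subgroup ?N G"
  proof (rule subgroupI)
    fix a assume "a \<in> ?N"
    then obtain j :: int where "a = y [^] (int n * j)" by blast
    then have "inv a = y [^] (int n * - j)" by (simp add: int_pow_neg)
    then show "inv a \<in> ?N" by blast
  next
    fix a b assume "a \<in> ?N" "b \<in> ?N"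
    then obtain i j :: int where "a = y [^] (int n * i)" "b = y [^] (int n * j)" by blast
    then have "a \<otimes> b = y [^] (int n * (i + j))" by (simp add: int_pow_mult distrib_left)
    then show "a \<otimes> b \<in> ?N" by blast
  qed auto
  moreover have "g \<otimes> h \<otimes> inv g \<in> ?N" if g: "g \<in> carrier G" and h: "h \<in> ?N" for g h
  proof -
    obtain i j :: int where g: "g = x [^] i \<otimes> y [^] j" using factor g by blast
    obtain m :: int where h: "h = y [^] (int n * m)" using h by blast
    have gx: "x [^] i = x [^] nat (i mod int p)"
      using p_pos by (simp add: int_pow_int [symmetric] x_pow_mod)
    have "y [^] j \<otimes> h = h \<otimes> y [^] j" unfolding h by (rule int_pow_self_commute) simp
    then have "conjg (y [^] j) h = h" by (simp add: conjg_eq_iff h)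
    then have "conjg g h = conjg (x [^] i) h" by (simp add: g h conjg_conjg [symmetric])
    also have "\<dots> = conjg (x [^] i) (y [^] int n) [^] m"
      by (simp add: h conjg_int_pow [symmetric] int_pow_pow)
    also have "\<dots> = y [^] (int n * (c ^ nat (i mod int p) * m))"
      by (simp add: gx x int_pow_pow mult.assoc)
    finally show ?thesis by (simp add: conjg_def)
  qed
  ultimately show ?thesis by (simp add: normal_inv_iff)
qed

text \<open>The quotient is carried over to the natural numbers because atomicity speaks of
  polyhedra on that type, and because the later induction passes from a group to its quotient inside
  one fixed type.\<close>

lemma ex_y_quotient:
  fixes n :: nat and l :: int
  assumes n: "n dvd q" and eq: "conjg x (y [^] int n) = y [^] l"
  shows "\<exists>(H :: nat monoid) \<phi>. \<phi> \<in> hom G H \<and> tight_pair H (\<phi> x) (\<phi> y) p n \<and>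
    (\<forall>g \<in> carrier G. \<phi> g = \<one>\<^bsub>H\<^esub> \<longleftrightarrow> (\<exists>j::int. g = y [^] (int n * j)))"
proof -
  define N where "N = range (\<lambda>j::int. y [^] (int n * j))"
  interpret N: normal N G unfolding N_def using assms by (rule y_pow_normal)
  obtain r where r: "q = n * r" using n by blast
  have n0: "0 < n" and r0: "0 < r" using r q_pos by (auto intro!: Nat.gr0I)
  have "bij_betw (\<lambda>j. y [^] (int n * j)) {0..<int r} N"
  proof (intro bij_betw_imageI inj_onI)
    fix i j assume ij: "i \<in> {0..<int r}" "j \<in> {0..<int r}" "y [^] (int n * i) = y [^] (int n * j)"
    then have "int n * int r dvd int n * (i - j)" by (simp add: y_pow_eq_iff r right_diff_distrib)
    then have "int r dvd i - j" using n0 by simp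
    then show "i = j" using ij by (metis atLeastLessThan_iff mod_eq_dvd_iff mod_pos_pos_trivial)
  next
    have "y [^] (int n * j) = y [^] (int n * (j mod int r))" for j
      by (rule y_pow_cong) (simp add: r right_diff_distrib [symmetric] minus_mod_eq_mult_div)
    then show "(\<lambda>j. y [^] (int n * j)) ` {0..<int r} = N"
      using r0 by (force simp: N_def)
  qed
  then have "card N = r" using bij_betw_same_card by fastforce
  then have card: "card (rcosets N) = p * n"
    using lagrange[OF N.is_subgroup] r0 by (simp add: order_def card_carrier r)
  have "finite (rcosets N)" using card p_pos n0 by (metis card_ge_0_finite nat_0_less_mult_iff)
  then obtain f :: "'a set \<Rightarrow> nat" where f: "inj_on f (rcosets N)"
    using finite_imp_inj_to_nat_seg by meson
  define Q where "Q = G Mod N"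
  interpret Q: group Q unfolding Q_def by (rule N.factorgroup_is_group)
  have Qc: "carrier Q = rcosets N" by (simp add: Q_def FactGroup_def)
  \<comment> \<open>The full carrier and the unit 0 are placeholders.
    \<open>hom_imp_img_group\<close> asks only for a homomorphism into \<open>H0\<close> and then
    makes the image a group, with the image of the unit of Q as its unit.\<close>
  define H0 :: "nat monoid" where "H0 = \<lparr>carrier = UNIV,
     mult = (\<lambda>a b. f (inv_into (rcosets N) f a \<otimes>\<^bsub>Q\<^esub> inv_into (rcosets N) f b)), one = 0\<rparr>"
  have "f \<in> hom Q H0"
    by (rule homI) (simp_all add: H0_def Qc f inv_into_f_f)
  define H where "H = H0\<lparr>carrier := f ` carrier Q, one := f \<one>\<^bsub>Q\<^esub>\<rparr>"
  have "group H" unfolding H_def using \<open>f \<in> hom Q H0\<close> by (rule Q.hom_imp_img_group)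
  then interpret H: group H .
  have fH: "f \<in> hom Q H" using \<open>f \<in> hom Q H0\<close> by (auto simp: hom_def H_def)
  define \<phi> where "\<phi> = (\<lambda>g. f (N #> g))"
  have "(\<lambda>g. N #> g) \<in> hom G Q" unfolding Q_def by (rule N.r_coset_hom_Mod)
  then have hom: "\<phi> \<in> hom G H" using Group.hom_compose[OF _ fH] by (force simp: \<phi>_def comp_def)
  interpret \<phi>: group_hom G H \<phi> by unfold_locales (rule hom)
  have surj: "\<phi> ` carrier G = carrier H"
    by (auto simp: \<phi>_def H_def Qc RCOSETS_def)
  have ker: "\<phi> g = \<one>\<^bsub>H\<^esub> \<longleftrightarrow> g \<in> N" if "g \<in> carrier G" for g
  proof -
    have "\<phi> g = \<one>\<^bsub>H\<^esub> \<longleftrightarrow> f (N #> g) = f N" by (simp add: \<phi>_def H_def Q_def FactGroup_def)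
    also have "\<dots> \<longleftrightarrow> N #> g = N"
      using f that N.subgroup_in_rcosets[OF is_group] by (intro inj_on_eq_iff[OF f]) (auto simp: RCOSETS_def)
    also have "\<dots> \<longleftrightarrow> g \<in> N"
      using that N.is_subgroup coset_join1 coset_join2 N.subset by metis
    finally show ?thesis .
  qed
  have "tight_pair H (\<phi> x) (\<phi> y) p n"
  proof
    show "\<phi> x \<in> carrier H" "\<phi> y \<in> carrier H" by simp_all
    show "\<phi> x \<otimes>\<^bsub>H\<^esub> \<phi> y \<otimes>\<^bsub>H\<^esub> (\<phi> x \<otimes>\<^bsub>H\<^esub> \<phi> y) = \<one>\<^bsub>H\<^esub>"
      using invol by (simp flip: \<phi>.hom_mult)
    show "\<phi> x [^]\<^bsub>H\<^esub> p = \<one>\<^bsub>H\<^esub>" using x_pow by (simp flip: \<phi>.hom_nat_pow)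
    have "y [^] n \<in> N" unfolding N_def by (rule range_eqI[of _ _ 1]) (simp add: int_pow_int)
    then have "\<phi> (y [^] n) = \<one>\<^bsub>H\<^esub>" by (simp add: ker)
    then show "\<phi> y [^]\<^bsub>H\<^esub> n = \<one>\<^bsub>H\<^esub>" by (simp add: \<phi>.hom_nat_pow)
    show "card (carrier H) = p * n" using f card by (simp add: H_def Qc card_image)
    show "0 < p" "0 < n" by (fact p_pos, fact n0)
    fix u assume "u \<in> carrier H"
    then obtain g where "g \<in> carrier G" "u = \<phi> g" using surj by blast
    then obtain i j :: int where "u = \<phi> (x [^] i \<otimes> y [^] j)" using factor by blast
    then show "\<exists>(i::int) (j::int). u = \<phi> x [^]\<^bsub>H\<^esub> i \<otimes>\<^bsub>H\<^esub> \<phi> y [^]\<^bsub>H\<^esub> j"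
      by (auto simp: \<phi>.hom_int_pow)
  qed
  then show ?thesis using hom ker unfolding N_def by blast
qed

section \<open>Reflexibility of a pair and of its quotients\<close>

lemma mirror_lift:
  assumes "\<phi> \<in> hom G H" "tight_pair H (\<phi> x) (\<phi> y) p' q'" "tight_pair.mirror H (\<phi> x) (\<phi> y) u v"
  shows "\<exists>g h. mirror g h \<and> \<phi> g = u \<and> \<phi> h = v"
proof -
  interpret H: tight_pair H "\<phi> x" "\<phi> y" p' q' by (fact assms(2))
  interpret \<phi>: group_hom G H \<phi> by unfold_locales (rule assms(1))
  show ?thesis using assms(3)
  proof (induction rule: H.mirror.induct)
    case mirror_one
    show ?case using mirror.mirror_one \<phi>.hom_one by blast
  next
    case (mirror_x u v)
    then obtain g h where "mirror g h" "\<phi> g = u" "\<phi> h = v" by blast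
    moreover have "g \<in> carrier G" "h \<in> carrier G" using mirror_closed[OF \<open>mirror g h\<close>] by auto
    ultimately show ?case using mirror.mirror_x[of g h] by (intro exI[of _ "x \<otimes> g"] exI[of _ "inv x \<otimes> h"]) simp
  next
    case (mirror_y u v)
    then obtain g h where "mirror g h" "\<phi> g = u" "\<phi> h = v" by blast
    moreover have "g \<in> carrier G" "h \<in> carrier G" using mirror_closed[OF \<open>mirror g h\<close>] by auto
    ultimately show ?case using mirror.mirror_y[of g h] by (intro exI[of _ "y \<otimes> g"] exI[of _ "inv y \<otimes> h"]) simp
  qed
qed

text \<open>A pair over the unit of H lifts to a pair (g, h) with g = y^(n j). This g also has the
  mirror image y^(-n j), which lies in the kernel, and uniqueness modulo the kernel puts h there as
  well.\<close>

lemma quotient_reflexible: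
  assumes hom: "\<phi> \<in> hom G H" and H: "tight_pair H (\<phi> x) (\<phi> y) p' q'"
    and ker: "\<And>g. g \<in> carrier G \<Longrightarrow> \<phi> g = \<one>\<^bsub>H\<^esub> \<longleftrightarrow> (\<exists>j::int. g = y [^] (int n * j))"
    and refl: "reflexible_mod (range (\<lambda>j::int. y [^] (int n * j)))"
  shows "tight_pair.reflexible_mod H (\<phi> x) (\<phi> y) {\<one>\<^bsub>H\<^esub>}"
proof -
  interpret H: tight_pair H "\<phi> x" "\<phi> y" p' q' by (fact H)
  interpret \<phi>: group_hom G H \<phi> by unfold_locales (rule hom)
  have "v = \<one>\<^bsub>H\<^esub>" if "H.mirror \<one>\<^bsub>H\<^esub> v" for v
  proof -
    obtain g h where gh: "mirror g h" "\<phi> g = \<one>\<^bsub>H\<^esub>" "\<phi> h = v" using mirror_lift[OF hom H \<open>H.mirror _ v\<close>] by blast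
    then have c: "g \<in> carrier G" "h \<in> carrier G" using mirror_closed by auto
    then obtain j :: int where "g = y [^] (int n * j)" using ker gh by blast
    then have "mirror g (y [^] (int n * - j))" using mirror_y_pow[of "int n * j"] by simp
    then have "inv (y [^] (int n * - j)) \<otimes> h \<in> range (\<lambda>j::int. y [^] (int n * j))"
      by (rule mirror_unique_mod[OF refl _ gh(1)])
    then obtain i :: int where "inv (y [^] (int n * - j)) \<otimes> h = y [^] (int n * i)" by (rule rangeE)
    then have "\<phi> (inv (y [^] (int n * - j)) \<otimes> h) = \<one>\<^bsub>H\<^esub>"
      using ker[of "y [^] (int n * i)"] by auto
    moreover have "\<phi> (y [^] (int n * - j)) = \<one>\<^bsub>H\<^esub>" using ker[of "y [^] (int n * - j)"] by blast
    ultimately show ?thesis using gh c \<phi>.hom_closed[OF c(2)] by simp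
  qed
  then show ?thesis by (simp add: H.reflexible_mod_def)
qed

lemma reflexible_mod_mono: "reflexible_mod M \<Longrightarrow> M \<subseteq> N \<Longrightarrow> reflexible_mod N"
  by (auto simp: reflexible_mod_def)

section \<open>The larger factor has a nontrivial core\<close>

text \<open>If y^(q/2) is not central, then <y> and its conjugate by x meet trivially, and the q^2
  elements y^i x y^j are distinct. This exceeds p q unless p = q; in that case the elements exhaust
  G, so one of them is \<one> and x lies in <y>.\<close>

lemma y_half_central:
  assumes q: "q = 2 ^ b" and b1: "1 \<le> b" and pq: "p \<le> q"
  shows "conjg x (y [^] (2 ^ (b - 1) :: int)) = y [^] (2 ^ (b - 1) :: int)"
proof (rule ccontr)
  let ?h = "2 ^ (b - 1) :: int"
  assume nc: "conjg x (y [^] ?h) \<noteq> y [^] ?h"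
  have q2: "int q = 2 * ?h" using b1 by (cases b) (simp_all add: q)
  \<comment> \<open>Every nontrivial element of the cyclic 2-group <y> has y^(q/2) among its powers,
    so a nontrivial intersection of <y> with its conjugate would contain y^(q/2).\<close>
  have indep: "int q dvd n" if n: "conjg x (y [^] n) = y [^] l" for n l :: int
  proof (rule ccontr)
    assume "\<not> int q dvd n"
    then have "n \<noteq> 0" by auto
    then obtain v w where vw: "n = 2 ^ v * w" "odd w" using two_power_odd_decomp by blast
    have "\<not> b \<le> v" using \<open>\<not> int q dvd n\<close> two_power_dvd_odd_mult_iff[OF vw(2), of b v] by (simp add: vw q)
    then have "(2::int) ^ v * 2 ^ (b - 1 - v) = ?h" by (simp add: power_add [symmetric])
    then have "n * 2 ^ (b - 1 - v) = ?h * w" by (simp add: vw ac_simps)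
    moreover obtain r where "w = 2 * r + 1" using vw(2) by (rule oddE)
    ultimately have "n * 2 ^ (b - 1 - v) - ?h = int q * r" by (simp add: q2 algebra_simps)
    then have s: "y [^] (n * 2 ^ (b - 1 - v)) = y [^] ?h" by (intro y_pow_cong) simp
    have "conjg x (y [^] n) [^] ((2::int) ^ (b - 1 - v)) = y [^] (l * 2 ^ (b - 1 - v))"
      using n by (simp add: int_pow_pow)
    then have "conjg x (y [^] ?h) = y [^] (l * 2 ^ (b - 1 - v))"
      using s by (simp add: conjg_int_pow [symmetric] int_pow_pow)
    then show False using central_y_half[OF q2] nc by blast
  qed
  let ?A = "{0..<int q} \<times> {0..<int q}"
  let ?f = "\<lambda>(i::int, j::int). y [^] i \<otimes> x \<otimes> y [^] j"
  have inj: "inj_on ?f ?A"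
  proof (rule inj_onI, clarsimp)
    fix i j i' j'
    assume b: "0 \<le> i" "i < int q" "0 \<le> j" "j < int q" "0 \<le> i'" "i' < int q" "0 \<le> j'" "j' < int q"
      and "y [^] i \<otimes> x \<otimes> y [^] j = y [^] i' \<otimes> x \<otimes> y [^] j'"
    then have "y [^] (- i) \<otimes> (y [^] i \<otimes> x \<otimes> y [^] j) \<otimes> y [^] (- j') =
        y [^] (- i) \<otimes> (y [^] i' \<otimes> x \<otimes> y [^] j') \<otimes> y [^] (- j')" by simp
    then have eq: "x \<otimes> y [^] (j - j') = y [^] (i' - i) \<otimes> x"
      using int_pow_mult[of y j "- j'"] int_pow_mult[of y j' "- j'"]
      by (simp add: m_assoc int_pow_mult_left)
    then have "conjg x (y [^] (j - j')) = y [^] (i' - i)" by (simp add: conjg_eq_iff)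
    then have "int q dvd j - j'" by (rule indep)
    then have j: "j = j'" using b by (metis mod_eq_dvd_iff mod_pos_pos_trivial)
    then have "y [^] (i' - i) = \<one>" using eq by (simp add: r_cancel_one')
    then have "int q dvd i' - i" by (simp add: y_pow_eq_one_iff)
    then show "i = i' \<and> j = j'" using b j by (metis mod_eq_dvd_iff mod_pos_pos_trivial)
  qed
  have sub: "?f ` ?A \<subseteq> carrier G" by auto
  have "q * q \<le> p * q"
    using card_inj_on_le[OF inj sub finite_carrier] by (simp add: card_carrier)
  then have "p = q" using pq q_pos by simp
  then have "card (?f ` ?A) = card (carrier G)" using inj by (simp add: card_image card_carrier)
  then have "?f ` ?A = carrier G" using card_subset_eq[OF finite_carrier sub] by simp
  then have "\<one> \<in> ?f ` ?A" by simp
  then obtain i j :: int where "\<one> = y [^] i \<otimes> x \<otimes> y [^] j" by auto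
  then have "y [^] (- i) \<otimes> \<one> = y [^] (- i) \<otimes> (y [^] i \<otimes> x \<otimes> y [^] j)" by simp
  then have "y [^] (- i) = x \<otimes> y [^] j" by (simp add: m_assoc int_pow_mult_left)
  then have "y [^] (- i) \<otimes> y [^] (- j) = x"
    using int_pow_mult[of y j "- j"] by (simp add: m_assoc)
  then have "x = y [^] (- i - j)" using int_pow_mult[of y "- i" "- j"] by simp
  then have "x \<otimes> y [^] ?h = y [^] ?h \<otimes> x" using int_pow_self_commute[OF y_in, of "- i - j" ?h] by simp
  then show False using nc by (simp add: conjg_eq_iff)
qed

end

section \<open>Regular pairs with a core-free factor\<close>

context tight_pair
begin

text \<open>x^2 centralizes y^k, so x and x^-1 act on it alike.\<close>

lemma conjg_inv_x_y_pow:
  fixes c k :: int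
  assumes "conjg x (y [^] k) = y [^] (c * k)"
  shows "conjg (inv x) (y [^] k) = y [^] (c * k)"
proof -
  have "conjg x (y [^] (k * c)) = y [^] k"
    using conjg_x_pow_mult[OF assms, of c] square_normal_exponent[OF assms] by (simp add: ac_simps)
  then show ?thesis by (simp add: conjg_inv_eq_iff mult.commute)
qed

text \<open>The exponent \<open>2\<^sup>m\<close> generates the largest normal subgroup contained in \<open>\<langle>y\<rangle>\<close>.\<close>

lemma ex_core_exponent:
  assumes q: "q = 2 ^ b"
  obtains m c where "m \<le> b" "conjg x (y [^] (2 ^ m :: int)) = y [^] (c * 2 ^ m :: int)"
    "\<And>n (l::int). n < m \<Longrightarrow> conjg x (y [^] (2 ^ n :: int)) \<noteq> y [^] l"
proof -
  let ?P = "\<lambda>n::nat. \<exists>l::int. conjg x (y [^] (2 ^ n :: int)) = y [^] l"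
  define m where "m = (LEAST n. ?P n)"
  have "y [^] (2 ^ b :: int) = \<one>" using q by (simp add: y_pow_eq_one_iff)
  then have "conjg x (y [^] (2 ^ b :: int)) = y [^] (0::int)" by (simp add: conjg_eq_iff)
  then have b: "?P b" by blast
  then have "?P m" unfolding m_def by (rule LeastI)
  then obtain l :: int where l: "conjg x (y [^] (2 ^ m :: int)) = y [^] l" by blast
  have mb: "m \<le> b" unfolding m_def using b by (rule Least_le)
  then have "2 ^ m dvd l" using conjg_y_pow_dvd[OF x_in l] by (simp add: q le_imp_power_dvd)
  then obtain c where "l = c * 2 ^ m" by (metis dvdE mult.commute)
  moreover have "conjg x (y [^] (2 ^ n :: int)) \<noteq> y [^] l" if "n < m" for n and l :: int
    using not_less_Least[of n ?P] that unfolding m_def by blast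
  ultimately show ?thesis using that mb l by blast
qed

text \<open>After division by the core of <y> the image of <y> has no core left, and the statement
  about x^2 in the quotient lifts up to a factor from the kernel. The statement for quotients enters
  as the hypothesis \<open>R\<close>, since it is once the induction hypothesis and once the
  completed result.\<close>

lemma square_normal_mod_core:
  assumes p: "p = 2 ^ a" and q: "q = 2 ^ b" and mb: "m \<le> b"
    and c: "conjg x (y [^] (2 ^ m :: int)) = y [^] (c * 2 ^ m :: int)"
    and min: "\<And>n (l::int). n < m \<Longrightarrow> conjg x (y [^] (2 ^ n :: int)) \<noteq> y [^] l"
    and G_refl: "reflexible_mod (range (\<lambda>j::int. y [^] (2 ^ m * j)))"
    and R: "\<And>(H :: nat monoid) u v. \<lbrakk>tight_pair H u v (2 ^ a) (2 ^ m);
      tight_pair.reflexible_mod H u v {\<one>\<^bsub>H\<^esub>};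
      m = 0 \<or> group.conjg H u (v [^]\<^bsub>H\<^esub> (2 ^ (m - 1) :: int)) \<noteq> v [^]\<^bsub>H\<^esub> (2 ^ (m - 1) :: int)\<rbrakk> \<Longrightarrow>
      \<exists>d. group.conjg H (inv\<^bsub>H\<^esub> v) (u [^]\<^bsub>H\<^esub> (2::int)) = u [^]\<^bsub>H\<^esub> (2 * d :: int)"
  shows "\<exists>d e. conjg (inv y) (x [^] (2::int)) = x [^] (2 * d :: int) \<otimes> y [^] (2 ^ m * e :: int)"
proof -
  have "2 ^ m dvd q" using mb q by (simp add: le_imp_power_dvd)
  moreover have "conjg x (y [^] int (2 ^ m)) = y [^] (c * 2 ^ m)" using c by simp
  ultimately obtain H :: "nat monoid" and \<phi> where hom: "\<phi> \<in> hom G H"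
    and H: "tight_pair H (\<phi> x) (\<phi> y) p (2 ^ m)"
    and ker: "\<And>g. g \<in> carrier G \<Longrightarrow> \<phi> g = \<one>\<^bsub>H\<^esub> \<longleftrightarrow> (\<exists>j::int. g = y [^] (int (2 ^ m) * j))"
    using ex_y_quotient by metis
  interpret H: tight_pair H "\<phi> x" "\<phi> y" p "2 ^ m" by (fact H)
  interpret \<phi>: group_hom G H \<phi> by unfold_locales (rule hom)
  have phi_eq: "\<exists>j::int. g = h \<otimes> y [^] (2 ^ m * j)"
    if gh: "g \<in> carrier G" "h \<in> carrier G" "\<phi> g = \<phi> h" for g h
  proof -
    have "\<phi> (inv h \<otimes> g) = \<one>\<^bsub>H\<^esub>" using gh by simp
    then obtain j :: int where "inv h \<otimes> g = y [^] (2 ^ m * j)"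
      using ker[of "inv h \<otimes> g"] gh by auto
    then have "h \<otimes> (inv h \<otimes> g) = h \<otimes> y [^] (2 ^ m * j)" by simp
    then show ?thesis using gh by auto
  qed
  have phi_conjg: "\<phi> (conjg g h) = H.conjg (\<phi> g) (\<phi> h)" if "g \<in> carrier G" "h \<in> carrier G" for g h
    using that by (simp add: conjg_def H.conjg_def)
  have "H.reflexible_mod {\<one>\<^bsub>H\<^esub>}"
    using G_refl by (intro quotient_reflexible[OF hom H ker]) simp_all
  \<comment> \<open>If the image of y^(2^(m - 1)) were fixed in the quotient, its conjugate in G
    would lie in <y>, against minimality of m.\<close>
  moreover have "H.conjg (\<phi> x) (\<phi> y [^]\<^bsub>H\<^esub> (2 ^ (m - 1) :: int)) \<noteq> \<phi> y [^]\<^bsub>H\<^esub> (2 ^ (m - 1) :: int)"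
    if m0: "m \<noteq> 0"
  proof
    assume "H.conjg (\<phi> x) (\<phi> y [^]\<^bsub>H\<^esub> (2 ^ (m - 1) :: int)) = \<phi> y [^]\<^bsub>H\<^esub> (2 ^ (m - 1) :: int)"
    then have "\<phi> (conjg x (y [^] (2 ^ (m - 1) :: int))) = \<phi> (y [^] (2 ^ (m - 1) :: int))"
      by (simp add: phi_conjg \<phi>.hom_int_pow)
    then obtain j :: int
      where "conjg x (y [^] (2 ^ (m - 1) :: int)) = y [^] (2 ^ (m - 1) :: int) \<otimes> y [^] (2 ^ m * j)"
      using phi_eq by (metis conjg_closed int_pow_closed x_in y_in)
    then have "conjg x (y [^] (2 ^ (m - 1) :: int)) = y [^] (2 ^ (m - 1) + 2 ^ m * j)"
      by (simp add: int_pow_mult)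
    moreover have "m - 1 < m" using m0 by simp
    ultimately show False using min by blast
  qed
  ultimately have "\<exists>d. H.conjg (inv\<^bsub>H\<^esub> \<phi> y) (\<phi> x [^]\<^bsub>H\<^esub> (2::int)) = \<phi> x [^]\<^bsub>H\<^esub> (2 * d :: int)"
    using H p by (intro R) auto
  then obtain d where "H.conjg (inv\<^bsub>H\<^esub> \<phi> y) (\<phi> x [^]\<^bsub>H\<^esub> (2::int)) = \<phi> x [^]\<^bsub>H\<^esub> (2 * d :: int)" ..
  then have "\<phi> (conjg (inv y) (x [^] (2::int))) = \<phi> (x [^] (2 * d))"
    by (simp add: phi_conjg \<phi>.hom_int_pow)
  then show ?thesis using phi_eq by (metis conjg_closed int_pow_closed inv_closed x_in y_in)
qed

text \<open>As <y> is core-free, p > q, so x^(p/2) is central and <x> has a core <x^(2^m)> with m <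
  a. For 2 \<le> m the induction hypothesis applies to the quotient by this core with x and y
  exchanged, and the valuations contradict reflexibility. Hence m \<le> 1 and x^2 lies in the
  core.\<close>

lemma square_normal_of_core_free_step:
  assumes p: "p = 2 ^ a" and q: "q = 2 ^ b" and G_refl: "reflexible_mod {\<one>}"
    and y_core: "b = 0 \<or> conjg x (y [^] (2 ^ (b - 1) :: int)) \<noteq> y [^] (2 ^ (b - 1) :: int)"
    and IH: "\<And>(H :: nat monoid) u v m n. \<lbrakk>m + n < a + b; tight_pair H u v (2 ^ m) (2 ^ n);
      tight_pair.reflexible_mod H u v {\<one>\<^bsub>H\<^esub>};
      n = 0 \<or> group.conjg H u (v [^]\<^bsub>H\<^esub> (2 ^ (n - 1) :: int)) \<noteq> v [^]\<^bsub>H\<^esub> (2 ^ (n - 1) :: int)\<rbrakk> \<Longrightarrow>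
      \<exists>d. group.conjg H (inv\<^bsub>H\<^esub> v) (u [^]\<^bsub>H\<^esub> (2::int)) = u [^]\<^bsub>H\<^esub> (2 * d :: int)"
  shows "\<exists>d. conjg (inv y) (x [^] (2::int)) = x [^] (2 * d :: int)"
proof -
  interpret S: tight_pair G y x q p by (rule swap)
  show ?thesis
  proof (cases "a = 0 \<or> b = 0")
    case True
    then show ?thesis
    proof
      assume "a = 0"
      then have "x = \<one>" using x_pow p by simp
      then show ?thesis by (intro exI[of _ 0]) (simp add: conjg_def)
    next
      assume "b = 0"
      then have "y = \<one>" using y_pow q by simp
      then show ?thesis by (intro exI[of _ 1]) simp
    qed
  next
    case False
    then have a1: "1 \<le> a" and b1: "1 \<le> b" by simp_all
    have ync: "conjg x (y [^] (2 ^ (b - 1) :: int)) \<noteq> y [^] (2 ^ (b - 1) :: int)"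
      using y_core b1 by simp
    then have "\<not> p \<le> q" using y_half_central[OF q b1] by blast
    then have xc: "conjg y (x [^] (2 ^ (a - 1) :: int)) = x [^] (2 ^ (a - 1) :: int)"
      using S.y_half_central[OF p a1] by simp
    obtain m c where ma: "m \<le> a"
      and c: "conjg y (x [^] (2 ^ m :: int)) = x [^] (c * 2 ^ m :: int)"
      and min: "\<And>n (l::int). n < m \<Longrightarrow> conjg y (x [^] (2 ^ n :: int)) \<noteq> x [^] l"
      using S.ex_core_exponent[OF p] by metis
    have "\<not> a - 1 < m" using min xc by blast
    then have m_less: "m < a" using a1 by linarith
    show ?thesis
    proof (cases "m \<le> 1")
      case True
      then have "(2::int) = 2 ^ m * 2 ^ (1 - m)" by (simp add: power_add [symmetric])
      then obtain r where r: "(2::int) = 2 ^ m * r" by blast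
      have "conjg (inv y) (x [^] (2 ^ m * r :: int)) = x [^] (c * 2 ^ m * r :: int)"
        using S.conjg_inv_x_y_pow[OF c] conjg_int_pow[of "inv y" "x [^] (2 ^ m :: int)" r]
        by (simp add: int_pow_pow)
      then have "conjg (inv y) (x [^] (2::int)) = x [^] (2 * c)"
        using r by (simp add: ac_simps)
      then show ?thesis by blast
    next
      case False
      then have m2: "2 \<le> m" by simp
      have "{\<one>} \<subseteq> range (\<lambda>j::int. x [^] (2 ^ m * j))" by (auto intro!: range_eqI[of _ _ 0])
      then have "S.reflexible_mod (range (\<lambda>j::int. x [^] (2 ^ m * j)))"
        using G_refl reflexible_mod_swap S.reflexible_mod_mono by metis
      then have "\<exists>d e. conjg (inv x) (y [^] (2::int)) = y [^] (2 * d :: int) \<otimes> x [^] (2 ^ m * e :: int)"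
        using m_less by (intro S.square_normal_mod_core[OF q p _ c min] IH[of b m]) auto
      then obtain d e :: int
        where e: "conjg (inv x) (y [^] (2::int)) = y [^] (2 * d) \<otimes> x [^] (2 ^ m * e)" by blast
      interpret M: metabelian_pair G y x q p c d e "2 ^ m"
        by unfold_locales (fact c, fact e)
      \<comment> \<open>Reflexibility of G itself yields divisibility by the full 2^a, which the
        valuations exclude.\<close>
      have "x [^] (2 ^ m * e * (1 - c)) = \<one>"
        using M.reflexible_mod_exponent[of "{\<one>}"] G_refl reflexible_mod_swap by simp
      then have "2 ^ a dvd 2 ^ m * e * (1 - c)" by (simp add: x_pow_eq_one_iff p)
      then have ec: "2 ^ a dvd 2 ^ m * e * (c - 1)"
        by (metis dvd_minus_iff minus_diff_eq mult_minus_right)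
      then have ec': "2 ^ (a - 1) dvd 2 ^ m * e * (c - 1)"
        by (rule dvd_trans[rotated]) (simp add: le_imp_power_dvd)
      have min': "\<And>l::int. conjg y (x [^] (2 ^ (m - 1) :: int)) \<noteq> x [^] l" using min m2 by simp
      note * = M.structure_constraints[OF q p b1 HOL.refl m2 m_less min' ync ec']
      have False
        using exponent_arithmetic(2)[OF m2 m_less *(1-5) ec' *(6-8)] ec by simp
      then show ?thesis ..
    qed
  qed
qed

end

text \<open>The induction runs over a + b, and the carrier type is fixed because an induction cannot
  change it; the quotients of \<open>ex_y_quotient\<close> have this type.\<close>

lemma square_normal_of_core_free:
  fixes G :: "nat monoid"
  assumes "tight_pair G x y (2 ^ a) (2 ^ b)" "tight_pair.reflexible_mod G x y {\<one>\<^bsub>G\<^esub>}"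
    and "b = 0 \<or> group.conjg G x (y [^]\<^bsub>G\<^esub> (2 ^ (b - 1) :: int)) \<noteq> y [^]\<^bsub>G\<^esub> (2 ^ (b - 1) :: int)"
  shows "\<exists>d. group.conjg G (inv\<^bsub>G\<^esub> y) (x [^]\<^bsub>G\<^esub> (2::int)) = x [^]\<^bsub>G\<^esub> (2 * d :: int)"
  using assms
proof (induction "a + b" arbitrary: G x y a b rule: less_induct)
  case less
  show ?case
    by (rule tight_pair.square_normal_of_core_free_step[OF less.prems(1) HOL.refl HOL.refl less.prems(2,3)])
      (rule less.hyps)
qed

section \<open>Pairs with normal \<open>\<langle>y\<^sup>2\<rangle>\<close>\<close>

context tight_pair
begin

lemma conjg_y_x:
  "conjg y x = inv x \<otimes> y [^] (-2::int)"
  by (rule invol_pair.conjg_x_y[OF swap_invol])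

lemma conjg_y_x_even:
  fixes c n :: int
  assumes "conjg x (y [^] (2::int)) = y [^] (c * 2)"
  shows "conjg y (x [^] (2 * n)) = x [^] (2 * - n) \<otimes> y [^] (2 * (- (c + 1) * n))"
proof -
  have "conjg y (x [^] (2::int)) = inv x \<otimes> y [^] (-2::int) \<otimes> (inv x \<otimes> y [^] (-2::int))"
    using int_pow_mult[of "conjg y x" 1 1] by (simp add: conjg_int_pow conjg_y_x)
  also have "\<dots> = inv x \<otimes> inv x \<otimes> conjg x (y [^] (-2::int)) \<otimes> y [^] (-2::int)"
    by (simp add: conjg_def m_assoc)
  also have "inv x \<otimes> inv x = x [^] (2 * -1 :: int)"
    using int_pow_mult[of x "-1" "-1"] by (simp add: int_pow_neg)
  also have "conjg x (y [^] (-2::int)) = y [^] (2 * (c * -1))"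
    using conjg_x_pow_mult[OF assms, of "-1"] by simp
  also have "x [^] (2 * -1 :: int) \<otimes> y [^] (2 * (c * -1)) \<otimes> y [^] (-2::int) =
      x [^] (2 * -1 :: int) \<otimes> y [^] (2 * (- (c + 1)))"
    by (simp add: m_assoc int_pow_mult [symmetric] algebra_simps)
  finally have "conjg y (x [^] (2::int)) [^] n =
      (x [^] (2 * -1 :: int)) [^] n \<otimes> (y [^] (2 * (- (c + 1)))) [^] n"
    by (simp only: int_pow_mult_distrib[OF x_square_commute[OF assms]] int_pow_closed x_in y_in)
  then have "conjg y (x [^] (2 * n)) = x [^] (2 * -1 * n) \<otimes> y [^] (2 * (- (c + 1)) * n)"
    by (simp only: conjg_int_pow [symmetric] int_pow_pow int_pow_closed x_in y_in)
  then show ?thesis by (simp only: mult.assoc) simp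
qed

text \<open>Together with the odd case this is the complete table for left multiplication by y on
  normal forms x^i y^j. Its entries depend on c alone, which the proof of reflexibility below
  exploits.\<close>

lemma y_x_even:
  fixes c n :: int
  assumes "conjg x (y [^] (2::int)) = y [^] (c * 2)"
  shows "y \<otimes> (x [^] (2 * n) \<otimes> y [^] j) = x [^] (2 * - n) \<otimes> y [^] (1 - 2 * (c + 1) * n + j)"
proof -
  have "y \<otimes> (x [^] (2 * n) \<otimes> y [^] j) = conjg y (x [^] (2 * n)) \<otimes> (y \<otimes> y [^] j)"
    by (simp add: conjg_def m_assoc)
  also have "y \<otimes> y [^] j = y [^] (1 + j)" by (simp add: int_pow_mult)
  also have "conjg y (x [^] (2 * n)) \<otimes> y [^] (1 + j) =
      x [^] (2 * - n) \<otimes> y [^] (2 * (- (c + 1) * n) + (1 + j))"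
    unfolding conjg_y_x_even[OF assms] by (simp add: m_assoc int_pow_mult)
  also have "2 * (- (c + 1) * n) + (1 + j) = 1 - 2 * (c + 1) * n + j" by (simp add: algebra_simps)
  finally show ?thesis .
qed

lemma y_x_odd:
  fixes c n :: int
  assumes "conjg x (y [^] (2::int)) = y [^] (c * 2)"
  shows "y \<otimes> (x [^] (2 * n + 1) \<otimes> y [^] j) =
    x [^] (- (2 * n + 1)) \<otimes> y [^] (- 1 - 2 * (c * (c + 1)) * n + j)"
proof -
  have "y \<otimes> (x [^] (2 * n + 1) \<otimes> y [^] j) = conjg y (x [^] (2 * n)) \<otimes> (y \<otimes> x) \<otimes> y [^] j"
    by (simp add: int_pow_mult conjg_def m_assoc)
  also have "\<dots> = x [^] (2 * - n) \<otimes> (inv x \<otimes> conjg x (y [^] (2 * (- (c + 1) * n)))) \<otimes> inv y \<otimes> y [^] j"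
    unfolding conjg_y_x_even[OF assms] yx_eq by (simp add: conjg_def m_assoc)
  also have "\<dots> = x [^] (2 * - n) \<otimes> x [^] (-1::int) \<otimes>
      (y [^] (2 * (c * (- (c + 1) * n))) \<otimes> y [^] (-1::int) \<otimes> y [^] j)"
    using conjg_x_pow_mult[OF assms] by (simp add: m_assoc int_pow_neg)
  also have "\<dots> = x [^] (2 * - n + - 1) \<otimes> y [^] (2 * (c * (- (c + 1) * n)) + - 1 + j)"
    by (simp only: int_pow_mult x_in y_in)
  also have "2 * (c * (- (c + 1) * n)) + - 1 + j = - 1 - 2 * (c * (c + 1)) * n + j"
    by (simp add: algebra_simps)
  finally show ?thesis by simp
qed

lemma inverted: "tight_pair G (inv x) (inv y) p q"
proof unfold_locales
  have "inv (y \<otimes> x \<otimes> (y \<otimes> x)) = \<one>" using invol_pair.invol[OF swap_invol] by simp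
  then show "inv x \<otimes> inv y \<otimes> (inv x \<otimes> inv y) = \<one>" by (simp add: inv_mult_group m_assoc)
  show "\<exists>(i::int) (j::int). g = inv x [^] i \<otimes> inv y [^] j" if g: "g \<in> carrier G" for g
  proof -
    obtain i j :: int where "g = x [^] i \<otimes> y [^] j" using factor[OF g] by blast
    then have "g = inv x [^] (- i) \<otimes> inv y [^] (- j)" by (simp add: int_pow_inv int_pow_neg)
    then show ?thesis by blast
  qed
qed (simp_all add: nat_pow_inv x_pow y_pow p_pos q_pos card_carrier)

text \<open>x^-1 and y^-1 satisfy the same relation with the same c, hence have the same
  multiplication table. The pairs (x^i y^j, x^-i y^-j) are therefore closed under the rules
  generating \<open>mirror\<close>.\<close>

lemma y_square_normal_reflexible:
  fixes l :: int
  assumes "conjg x (y [^] (2::int)) = y [^] l" and "even q"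
  shows "reflexible_mod {\<one>}"
proof -
  interpret I: tight_pair G "inv x" "inv y" p q by (rule inverted)
  have "2 dvd int q" using assms(2) by simp
  then have "2 dvd l" using conjg_y_pow_dvd[OF x_in assms(1)] by blast
  then obtain c where "l = 2 * c" by blast
  then have c: "conjg x (y [^] (2::int)) = y [^] (c * 2)" using assms(1) by (simp add: mult.commute)
  have pow: "inv x [^] i = x [^] (- i)" "inv y [^] i = y [^] (- i)" for i :: int
    by (simp_all add: int_pow_inv int_pow_neg)
  have "conjg (inv x) (inv y [^] (2::int)) = inv y [^] (c * 2)"
    using conjg_inv_x_y_pow[OF c] conjg_inv[of "inv x" "y [^] (2::int)"] by (simp add: int_pow_inv)
  note even' = I.y_x_even[OF this, unfolded pow] and odd' = I.y_x_odd[OF this, unfolded pow]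
  have "\<exists>(i::int) (j::int). g = x [^] i \<otimes> y [^] j \<and> h = x [^] (- i) \<otimes> y [^] (- j)" if "mirror g h" for g h
    using that
  proof (induction rule: mirror.induct)
    case mirror_one
    show ?case by (intro exI[of _ 0]) simp
  next
    case (mirror_x g h)
    then obtain i j :: int where ij: "g = x [^] i \<otimes> y [^] j" "h = x [^] (- i) \<otimes> y [^] (- j)" by blast
    have "x \<otimes> g = x [^] (1 + i) \<otimes> y [^] j" unfolding ij by (simp add: int_pow_mult m_assoc)
    moreover have "inv x \<otimes> h = x [^] (- 1 + - i) \<otimes> y [^] (- j)"
      unfolding ij using int_pow_neg[of x 1] by (simp only: int_pow_mult x_in) (simp add: m_assoc)
    ultimately show ?case by (intro exI[of _ "1 + i"] exI[of _ j]) simp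
  next
    case (mirror_y g h)
    then obtain i j :: int where ij: "g = x [^] i \<otimes> y [^] j" "h = x [^] (- i) \<otimes> y [^] (- j)" by blast
    show ?case
    proof (cases "even i")
      case True
      then obtain n where n: "i = 2 * n" by blast
      show ?thesis unfolding ij n
        using y_x_even[OF c, of n j] even'[of n j]
        by (intro exI[of _ "2 * - n"] exI[of _ "1 - 2 * (c + 1) * n + j"]) simp
    next
      case False
      then obtain n where n: "i = 2 * n + 1" by (rule oddE)
      show ?thesis unfolding ij n
        using y_x_odd[OF c, of n j] odd'[of n j]
        by (intro exI[of _ "- (2 * n + 1)"] exI[of _ "- 1 - 2 * (c * (c + 1)) * n + j"]) simp
    qed
  qed
  then have "h = \<one>" if "mirror \<one> h" for h
    using that by (metis dvd_minus_iff xy_pow_eq_one_iff)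
  then show ?thesis by (simp add: reflexible_mod_def)
qed

end

section \<open>Minimal pairs without a reflection\<close>

text \<open>Origin of the sign in both families: the odd cofactor of a power of 2 enters the
  exponents of y only modulo 4.\<close>

lemma odd_sign_mod_4:
  fixes w :: int
  assumes "odd w"
  obtains s where "s \<in> {1, -1}" "4 dvd w + s"
proof -
  obtain n where n: "w = 2 * n + 1" using assms by (rule oddE)
  show ?thesis
  proof (cases "even n")
    case True
    then obtain k where "n = 2 * k" by blast
    then show ?thesis using that[of "-1"] n by simp
  next
    case False
    then obtain k where "n = 2 * k + 1" by (rule oddE)
    then have "w + 1 = 4 * (k + 1)" using n by simp
    then show ?thesis using that[of 1] by simp
  qed
qed

context metabelian_pair
begin

text \<open>Writing x = x^2 x^-1 lets y^-1 act on x^2 and leaves y^-1 x^-1 = x y. This product and y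
  x^-1 are the left sides of the two extra relations of the presentation.\<close>

lemma inv_y_x: "inv y \<otimes> x = x [^] (2 * d + 1) \<otimes> y [^] (k * (c * e) + 1)"
proof -
  have "conjg (inv x) (y [^] (k * e)) = y [^] (k * (c * e))"
    using conjg_inv_x_y_pow[OF conjg_x] conjg_int_pow[of "inv x" "y [^] k" e]
    by (simp add: int_pow_pow ac_simps)
  then have "conjg x (y [^] (k * (c * e))) = y [^] (k * e)"
    by (simp only: conjg_inv_eq_iff x_in y_in int_pow_closed)
  then have yx: "y [^] (k * e) \<otimes> x = x \<otimes> y [^] (k * (c * e))"
    by (simp add: conjg_eq_iff)
  have "x = x [^] (2::int) \<otimes> inv x"
    using int_pow_mult[of x 2 "-1"] by (simp add: int_pow_neg)
  then have "inv y \<otimes> x = inv y \<otimes> (x [^] (2::int) \<otimes> inv x)" by simp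
  also have "\<dots> = conjg (inv y) (x [^] (2::int)) \<otimes> (inv y \<otimes> inv x)" by (simp add: conjg_def m_assoc)
  also have "\<dots> = x [^] (2 * d) \<otimes> (y [^] (k * e) \<otimes> x) \<otimes> y"
    by (simp add: conjg_inv_y xy_eq [symmetric] m_assoc)
  also have "\<dots> = x [^] (2 * d) \<otimes> x [^] (1::int) \<otimes> (y [^] (k * (c * e)) \<otimes> y [^] (1::int))"
    by (simp add: yx m_assoc)
  finally show ?thesis by (simp only: int_pow_mult x_in y_in)
qed

text \<open>The companion computation with x^-1 = x^-2 x and y x = x^-1 y^-1.\<close>

lemma y_inv_x: "y \<otimes> inv x = x [^] (- (2 * d + 1)) \<otimes> y [^] (- (k * e) - 1)"
proof -
  have yx: "y [^] (k * (- (c * e))) \<otimes> inv x = inv x \<otimes> y [^] (k * - e)"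
  proof -
    have "conjg x (y [^] (k * (- (c * e)))) = y [^] (- e * (c * c * k))"
      using conjg_x_pow_mult[OF conjg_x, of "- (c * e)"] by (simp add: ac_simps)
    also have "\<dots> = (y [^] (c * c * k)) [^] (- e)" by (simp add: int_pow_pow mult.commute)
    also have "\<dots> = y [^] (k * - e)" by (simp add: square_normal_exponent[OF conjg_x] int_pow_pow)
    finally show ?thesis by (metis conjg_inv_cancel(2) conjg_eq_iff int_pow_closed inv_closed x_in y_in)
  qed
  have invs: "inv x = x [^] (-1::int)" "inv y = y [^] (-1::int)" by (simp_all add: int_pow_neg)
  have "inv x = x [^] (2 * - 1 :: int) \<otimes> x"
    using int_pow_mult[of x "-2" 1] by (simp add: int_pow_neg)
  then have "y \<otimes> inv x = y \<otimes> (t (-1) 0 \<otimes> x)" by (simp add: t_def)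
  also have "\<dots> = conjg y (t (-1) 0) \<otimes> (y \<otimes> x)" by (simp add: conjg_def m_assoc)
  also have "\<dots> = x [^] (2 * - d) \<otimes> (y [^] (k * (- (c * e))) \<otimes> inv x) \<otimes> inv y"
    unfolding conjg_y_t yx_eq by (simp add: t_def m_assoc)
  also have "\<dots> = x [^] (2 * - d) \<otimes> x [^] (-1::int) \<otimes> (y [^] (k * - e) \<otimes> y [^] (-1::int))"
    unfolding yx unfolding invs by (simp only: m_assoc int_pow_closed m_closed x_in y_in)
  also have "\<dots> = x [^] (2 * - d + - 1) \<otimes> y [^] (k * - e + - 1)"
    by (simp only: int_pow_mult x_in y_in)
  also have "2 * - d + - 1 = - (2 * d + 1)" by simp
  also have "k * - e + - 1 = - (k * e) - 1" by simp
  finally show ?thesis .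
qed

end

context tight_pair
begin

text \<open>The classification in terms of the group alone; the two quotient hypotheses are what
  atomicity will provide. The one for <x^(p/2)> is restricted to 2 \<le> a because the polyhedron of
  a pair is constructed for orders at least 2, and p/2 must be such an order.\<close>

theorem minimal_nonreflexible:
  assumes p: "p = 2 ^ a" and q: "q = 2 ^ b" and a1: "1 \<le> a" and ab: "a < b"
    and nonreflexible: "\<not> reflexible_mod {\<one>}"
    and y_quotient: "reflexible_mod (range (\<lambda>j::int. y [^] (2 ^ (b - 1) * j)))"
    and x_quotient: "\<lbrakk>2 \<le> a; conjg y (x [^] (2 ^ (a - 1) :: int)) = x [^] (2 ^ (a - 1) :: int)\<rbrakk> \<Longrightarrow>
      reflexible_mod (range (\<lambda>j::int. x [^] (2 ^ (a - 1) * j)))"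
  shows "(a = 3 \<and> 5 \<le> b \<and> (\<exists>s \<in> {1, -1 :: int}.
        inv y \<otimes> x = x [^] (3::int) \<otimes> y [^] (1 + s * 2 ^ (b - 2)) \<and>
        y \<otimes> inv x = x [^] (-3::int) \<otimes> y [^] (-1 + s * 2 ^ (b - 2)))) \<or>
    (b = a + 1 \<and> 4 \<le> a \<and> (\<exists>s \<in> {1, -1 :: int}.
        inv y \<otimes> x = x [^] (-1 + 2 ^ (a - 1) :: int) \<otimes> y [^] (-3 + s * 2 ^ (a - 1)) \<and>
        y \<otimes> inv x = x [^] (1 + 2 ^ (a - 1) :: int) \<otimes> y [^] (3 + s * 2 ^ (a - 1))))"
proof -
  interpret S: tight_pair G y x q p by (rule swap)
  have b1: "1 \<le> b" and pq: "p \<le> q" using a1 ab by (simp_all add: p q)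
  have q': "int q = 2 ^ b" and p': "int p = 2 ^ a" by (simp_all add: p q)
  have core: "conjg y (x [^] (2 ^ (a - 1) :: int)) \<noteq> x [^] (2 ^ (a - 1) :: int)"
  proof
    assume comm: "conjg y (x [^] (2 ^ (a - 1) :: int)) = x [^] (2 ^ (a - 1) :: int)"
    show False
    proof (cases "2 \<le> a")
      case True
      have "h = \<one>" if h: "mirror \<one> h" for h
      proof -
        obtain i :: int where i: "h = x [^] (2 ^ (a - 1) * i)"
          using x_quotient[OF True comm] h by (auto simp: reflexible_mod_def)
        moreover obtain j :: int where "h = y [^] (2 ^ (b - 1) * j)"
          using y_quotient h by (auto simp: reflexible_mod_def)
        ultimately have "x [^] (2 ^ (a - 1) * i) \<otimes> y [^] (0::int) =
            x [^] (0::int) \<otimes> y [^] (2 ^ (b - 1) * j)" by simp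
        then show ?thesis by (simp only: xy_pow_eq_iff) (simp add: i x_pow_eq_one_iff)
      qed
      then show False using nonreflexible by (simp add: reflexible_mod_def)
    next
      case False
      \<comment> \<open>For p = 2 the assumption says that x and y commute; then (x y)^2 = 1 reads
        x^2 y^2 = 1, so q divides 2 although b > 1.\<close>
      then have "a = 1" using a1 by simp
      then have "y \<otimes> x = x \<otimes> y" using comm by (simp add: conjg_eq_iff)
      then have "x [^] (1 + 1 :: int) \<otimes> y [^] (1 + 1 :: int) = \<one>"
        using invol by (simp only: int_pow_mult x_in y_in int_pow_1) (simp add: m_assoc, metis m_assoc x_in y_in m_closed)
      then have "(2::int) ^ b dvd 2 ^ 1" by (simp add: xy_pow_eq_one_iff q')
      then have "b \<le> 1" by (simp only: dvd_power_iff) simp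
      then show False using ab a1 by simp
    qed
  qed
  obtain m c where mb: "m \<le> b"
    and c: "conjg x (y [^] (2 ^ m :: int)) = y [^] (c * 2 ^ m :: int)"
    and min: "\<And>n (l::int). n < m \<Longrightarrow> conjg x (y [^] (2 ^ n :: int)) \<noteq> y [^] l"
    using ex_core_exponent[OF q] by metis
  have "\<not> b - 1 < m" using min y_half_central[OF q b1 pq] by blast
  then have m_less: "m < b" using b1 by linarith
  \<comment> \<open>For m \<le> 1 conjugation by x would keep y^2 in <y>, and that alone makes the
    pair reflexible.\<close>
  have m2: "2 \<le> m"
  proof (rule ccontr)
    assume "\<not> 2 \<le> m"
    then have "(2::int) = 2 ^ m * 2 ^ (1 - m)" by (simp add: power_add [symmetric])
    then obtain r where "(2::int) = 2 ^ m * r" by blast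
    then have "conjg x (y [^] (2::int)) = y [^] (2 ^ m * (c * r))"
      using conjg_x_pow_mult[OF c, of r] by simp
    moreover have "even q" using b1 by (simp add: q)
    ultimately show False using y_square_normal_reflexible nonreflexible by blast
  qed
  have "y [^] (2 ^ (b - 1) * j) \<in> range (\<lambda>j::int. y [^] (2 ^ m * j))" for j :: int
  proof -
    have "(2::int) ^ (b - 1) = 2 ^ m * 2 ^ (b - 1 - m)" using m_less by (simp add: power_add [symmetric])
    then show ?thesis by (intro range_eqI[of _ _ "2 ^ (b - 1 - m) * j"]) (simp add: mult.assoc)
  qed
  then have "reflexible_mod (range (\<lambda>j::int. y [^] (2 ^ m * j)))"
    using reflexible_mod_mono[OF y_quotient] by blast
  then have "\<exists>d e. conjg (inv y) (x [^] (2::int)) = x [^] (2 * d :: int) \<otimes> y [^] (2 ^ m * e :: int)"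
    by (intro square_normal_mod_core[OF p q mb c min] square_normal_of_core_free)
  then obtain d e :: int
    where e: "conjg (inv y) (x [^] (2::int)) = x [^] (2 * d) \<otimes> y [^] (2 ^ m * e)" by blast
  interpret M: metabelian_pair G x y p q c d e "2 ^ m"
    by unfold_locales (fact c, fact e)
  obtain j :: int where "y [^] (2 ^ m * e * (1 - c)) = y [^] (2 ^ (b - 1) * j)"
    using M.reflexible_mod_exponent[OF y_quotient] by blast
  then have "2 ^ b dvd 2 ^ m * e * (1 - c) - 2 ^ (b - 1) * j" by (simp add: y_pow_eq_iff q')
  moreover have "(2::int) ^ (b - 1) dvd 2 ^ b" by (simp add: le_imp_power_dvd)
  ultimately have "2 ^ (b - 1) dvd 2 ^ m * e * (1 - c) - 2 ^ (b - 1) * j" by (rule dvd_trans[rotated])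
  then have "2 ^ (b - 1) dvd 2 ^ m * e * (1 - c)" by (metis dvd_diff_left_iff dvd_triv_left)
  then have ec: "2 ^ (b - 1) dvd 2 ^ m * e * (c - 1)"
    by (metis dvd_minus_iff minus_diff_eq mult_minus_right)
  have min': "\<And>l::int. conjg x (y [^] (2 ^ (m - 1) :: int)) \<noteq> y [^] l" using min m2 by simp
  note * = M.structure_constraints[OF p q a1 HOL.refl m2 m_less min' core ec]
  note arith = exponent_arithmetic[OF m2 m_less *(1-5) ec *(6-8)]
  have m: "m = 2" by (rule arith(1))
  \<comment> \<open>The congruence for c is known only after multiplication by 4; a further factor e
    turns it into the value of 4 c e modulo q, the exponent needed in the first relation.\<close>
  have "2 ^ b dvd e * (4 * (c + 1 + 2 * e))" using *(8) m by simp
  also have "e * (4 * (c + 1 + 2 * e)) = 4 * (c * e) + 4 * e + 8 * (e * e)"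
    by (simp add: algebra_simps)
  finally have ce: "2 ^ b dvd 4 * (c * e) + 4 * e + 8 * (e * e)" .
  have split: "(2::int) ^ n = 2 ^ i * 2 ^ l" if "n = i + l" for n i l
    using that by (simp add: power_add)
  note xy = M.inv_y_x[unfolded m] and yx = M.y_inv_x[unfolded m]
  from arith(3) show ?thesis
  proof (elim disjE conjE exE)
    fix w assume a: "a = 3" and b5: "5 \<le> b" and w: "odd w" and e: "e = 2 ^ (b - 4) * w" and d: "4 dvd d - 1"
    obtain s where s: "s \<in> {1, -1}" "4 dvd w + s" using w by (rule odd_sign_mod_4)
    have "(2::int) ^ (b - 2) = 2 ^ 2 * 2 ^ (b - 4)" using b5 by (intro split) linarith
    then have b4: "4 * e = 2 ^ (b - 2) * w" by (simp add: e)
    have b2: "(2::int) ^ b = 2 ^ (b - 2) * 2 ^ 2" using b5 by (intro split) linarith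
    have "2 ^ b dvd 2 ^ (b - 2) * (w + s)"
      using s(2) by (simp add: b2)
    also have "2 ^ (b - 2) * (w + s) = 4 * e + s * 2 ^ (b - 2)"
      unfolding b4 by (simp add: algebra_simps)
    finally have es: "2 ^ b dvd 4 * e + s * 2 ^ (b - 2)" .
    \<comment> \<open>The quadratic term vanishes modulo 2^b because 3 + 2 (b - 4) \<ge> b for b
      \<ge> 5.\<close>
    have "8 * (e * e) = 2 ^ (3 + (b - 4) + (b - 4)) * (w * w)" unfolding e power_add by simp
    moreover have "b \<le> 3 + (b - 4) + (b - 4)" using b5 by linarith
    ultimately have "2 ^ b dvd 8 * (e * e)" by (simp add: le_imp_power_dvd)
    then have "2 ^ b dvd 4 * (c * e) - s * 2 ^ (b - 2)"
      using dvd_diff[OF ce dvd_add[OF es \<open>2 ^ b dvd 8 * (e * e)\<close>]] by (simp add: algebra_simps)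
    then have "y [^] (2\<^sup>2 * (c * e) + 1) = y [^] (1 + s * 2 ^ (b - 2))"
      by (intro y_pow_cong) (simp add: q')
    moreover have "y [^] (- (2\<^sup>2 * e) - 1) = y [^] (-1 + s * 2 ^ (b - 2))"
      using es dvd_minus_iff[of "2 ^ b" "4 * e + s * 2 ^ (b - 2)"]
      by (intro y_pow_cong) (simp add: q' algebra_simps)
    moreover obtain r where r: "d - 1 = 4 * r" using d by blast
    then have "x [^] (2 * d + 1) = x [^] (3::int)" "x [^] (- (2 * d + 1)) = x [^] (-3::int)"
      by (intro x_pow_cong; simp add: p' a algebra_simps)+
    ultimately show ?thesis using a b5 s(1) xy yx by auto
  next
    fix w u assume a4: "4 \<le> a" and b: "b = a + 1" and w: "odd w" and e: "e = - 1 + 2 ^ (a - 3) * w"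
      and u: "odd u" and d: "d = - 1 + 2 ^ (a - 2) * u"
    obtain s where s: "s \<in> {1, -1}" "4 dvd w + s" using w by (rule odd_sign_mod_4)
    \<comment> \<open>The shift e = -1 + g separates the constant -1, which produces the 3 and -3 in
      the exponents of y, from the part g of high valuation, which produces the signed power of
      2.\<close>
    define g where "g = 2 ^ (a - 3) * w"
    have eg: "e = - 1 + g" by (simp add: e g_def)
    have "(2::int) ^ (a - 1) = 2 ^ 2 * 2 ^ (a - 3)" using a4 by (intro split) linarith
    then have g4: "4 * g = 2 ^ (a - 1) * w" by (simp add: g_def)
    have "(2::int) ^ b = 2 ^ (a - 1) * 2 ^ 2" using a4 b by (intro split) linarith
    then have q4: "(2::int) ^ b = 2 ^ (a - 1) * 4" by simp
    have "2 ^ b dvd 2 ^ (a - 1) * (w + s)"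
      using s(2) by (simp add: q4)
    also have "2 ^ (a - 1) * (w + s) = 4 * g + s * 2 ^ (a - 1)"
      unfolding g4 by (simp add: algebra_simps)
    finally have gs: "2 ^ b dvd 4 * g + s * 2 ^ (a - 1)" .
    have "8 * (g * g) = 2 ^ (3 + (a - 3) + (a - 3)) * (w * w)" unfolding g_def power_add by simp
    moreover have "b \<le> 3 + (a - 3) + (a - 3)" using a4 b by linarith
    ultimately have gg: "2 ^ b dvd 8 * (g * g)" by (simp add: le_imp_power_dvd)
    have "16 * g = 2 ^ b * w" unfolding q4 using g4 by simp
    then have g16: "2 ^ b dvd 16 * g" by simp
    have "4 * (c * e) + 4 * e + 8 * (e * e) =
        (4 * (c * e) + 4 - s * 2 ^ (a - 1)) + (4 * g + s * 2 ^ (a - 1)) - 16 * g + 8 * (g * g)"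
      by (simp add: eg algebra_simps)
    then have "4 * (c * e) + 4 - s * 2 ^ (a - 1) =
        (4 * (c * e) + 4 * e + 8 * (e * e)) - (4 * g + s * 2 ^ (a - 1)) + 16 * g - 8 * (g * g)"
      by simp
    then have "2 ^ b dvd 4 * (c * e) + 4 - s * 2 ^ (a - 1)"
      using ce gs gg g16 by (metis dvd_add dvd_diff)
    then have y1: "y [^] (2\<^sup>2 * (c * e) + 1) = y [^] (-3 + s * 2 ^ (a - 1))"
      by (intro y_pow_cong) (simp add: q' algebra_simps)
    have y2: "y [^] (- (2\<^sup>2 * e) - 1) = y [^] (3 + s * 2 ^ (a - 1))"
      using gs dvd_minus_iff[of "2 ^ b" "4 * g + s * 2 ^ (a - 1)"]
      by (intro y_pow_cong) (simp add: q' eg algebra_simps)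
    have "(2::int) ^ a = 2 ^ (a - 1) * 2 ^ 1" using a4 by (intro split) linarith
    then have "2 ^ a dvd 2 ^ (a - 1) * (u - 1)" "2 ^ a dvd 2 ^ (a - 1) * (u + 1)" using u by simp_all
    moreover have "(2::int) ^ (a - 1) = 2 ^ 1 * 2 ^ (a - 2)" using a4 by (intro split) linarith
    then have d2: "2 * d = - 2 + 2 ^ (a - 1) * u" by (simp add: d algebra_simps)
    then have "2 * d + 1 - (-1 + 2 ^ (a - 1)) = 2 ^ (a - 1) * (u - 1)"
        "- (2 * d + 1) - (1 + 2 ^ (a - 1)) = - (2 ^ (a - 1) * (u + 1))"
      by (simp_all add: algebra_simps)
    ultimately have "x [^] (2 * d + 1) = x [^] (-1 + 2 ^ (a - 1) :: int)"
        "x [^] (- (2 * d + 1)) = x [^] (1 + 2 ^ (a - 1) :: int)"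
      by (simp_all only: x_pow_eq_iff p' dvd_minus_iff)
    then show ?thesis using a4 b s(1) xy yx y1 y2 by auto
  qed
qed

end

section \<open>The presented groups are products of two cyclic groups\<close>

context invol_pair
begin

definition xy_products :: "'a set" where
  "xy_products = {x [^] i \<otimes> y [^] j | (i::int) (j::int). True}"

lemma xy_productsI: "x [^] (i::int) \<otimes> y [^] (j::int) \<in> xy_products"
  by (auto simp: xy_products_def)

lemma inv_in_nat_powers:
  assumes "g \<in> carrier G" "g [^] (n::nat) = \<one>" "0 < n"
  shows "inv g = g [^] (n - 1)"
proof -
  have "g [^] (n - 1) \<otimes> g = g [^] Suc (n - 1)" by simp
  also have "\<dots> = \<one>" using assms by (simp del: nat_pow_Suc)
  finally show ?thesis using assms(1) by (intro inv_equality) simp_all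
qed

text \<open>In a group generated by x and y this closure makes <x><y> the whole group. The
  conditions on i and j turn the relation for y x^-1 into y x^2 y^-1 = x^(2 d) y^(k e). So y passes
  even powers of x at the cost of powers of y^k, and a last single x is handled by y x = x^-1
  y^-1.\<close>

lemma xy_products_left_mult:
  fixes c k i j :: int
  assumes c: "conjg x (y [^] k) = y [^] (c * k)"
    and yx: "y \<otimes> inv x = x [^] i \<otimes> y [^] j" and i: "odd i" and j: "k dvd j + 1"
    and x_pow: "x [^] (p::nat) = \<one>" and p: "0 < p"
    and y_pow: "y [^] (q::nat) = \<one>" and q: "0 < q"
    and g: "g \<in> xy_products"
  shows "x \<otimes> g \<in> xy_products" "inv x \<otimes> g \<in> xy_products" "y \<otimes> g \<in> xy_products"
    "inv y \<otimes> g \<in> xy_products"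
proof -
  have x: "x \<otimes> g \<in> xy_products" if g': "g \<in> xy_products" for g
  proof -
    obtain m n :: int where g: "g = x [^] m \<otimes> y [^] n" using g' by (auto simp: xy_products_def)
    have "x \<otimes> g = x [^] (1 + m) \<otimes> y [^] n" by (simp add: g int_pow_mult m_assoc)
    then show ?thesis by (simp only: xy_productsI)
  qed
  then show "x \<otimes> g \<in> xy_products" using g by blast
  have inv_x: "inv x \<otimes> g \<in> xy_products" if g': "g \<in> xy_products" for g
  proof -
    obtain m n :: int where g: "g = x [^] m \<otimes> y [^] n" using g' by (auto simp: xy_products_def)
    have "inv x = x [^] (-1::int)" by (simp add: int_pow_neg)
    then have "inv x \<otimes> g = x [^] (- 1 + m) \<otimes> y [^] n" by (simp only: g int_pow_mult_left int_pow_closed x_in y_in)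
    then show ?thesis by (simp only: xy_productsI)
  qed
  then show "inv x \<otimes> g \<in> xy_products" using g by blast
  \<comment> \<open>The action on <y^k> is known for natural powers of x; finite order of x reduces
    negative powers to these.\<close>
  have conj_x: "\<exists>m::int. conjg (x [^] (n::int)) (y [^] (k * l)) = y [^] (k * m)" for n l
  proof -
    have nat: "conjg (x [^] (n::nat)) (y [^] k) = (y [^] k) [^] (c ^ n)" for n
      using c by (intro conjg_nat_pow) (simp_all add: int_pow_pow mult.commute)
    obtain n' :: nat where n': "x [^] n = x [^] n'"
    proof (cases "0 \<le> n")
      case True
      then show ?thesis using that[of "nat n"] by (simp add: int_pow_int [symmetric])
    next
      case False
      have "x [^] n = inv (x [^] nat (- n))" using False by (simp add: int_pow_int [symmetric] int_pow_neg [symmetric])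
      also have "\<dots> = inv x [^] nat (- n)" by (simp add: nat_pow_inv)
      also have "\<dots> = x [^] ((p - 1) * nat (- n))"
        by (simp add: inv_in_nat_powers[OF x_in x_pow p] nat_pow_pow)
      finally show ?thesis by (rule that)
    qed
    have "conjg (x [^] n) (y [^] (k * l)) = ((y [^] k) [^] (c ^ n')) [^] l"
      unfolding n' nat[symmetric] by (simp add: conjg_int_pow [symmetric] int_pow_pow)
    then show ?thesis by (auto simp: int_pow_pow mult.assoc)
  qed
  have y_x2: "\<exists>(d::int) (e::int). conjg y (x [^] (2::int)) = x [^] (2 * d) \<otimes> y [^] (k * e)"
  proof -
    have "conjg y (x [^] (-2::int)) = (y \<otimes> inv x) \<otimes> (inv x \<otimes> inv y)"
      using int_pow_mult[of x "-1" "-1"] by (simp add: conjg_def int_pow_neg m_assoc)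
    also have "\<dots> = x [^] i \<otimes> y [^] j \<otimes> (y \<otimes> x)" by (simp only: yx yx_eq)
    also have "\<dots> = x [^] i \<otimes> y [^] (j + 1) \<otimes> x" by (simp add: m_assoc int_pow_mult)
    finally have "inv (conjg y (x [^] (-2::int))) = inv x \<otimes> (inv (y [^] (j + 1)) \<otimes> inv (x [^] i))"
      by (simp add: inv_mult_group m_assoc)
    also have "inv (conjg y (x [^] (-2::int))) = conjg y (x [^] (2::int))"
      by (simp add: conjg_inv [symmetric] int_pow_neg [symmetric])
    also obtain r where r: "j + 1 = k * r" using j by blast
    obtain m where m: "conjg (x [^] i) (y [^] (k * - r)) = y [^] (k * m)" using conj_x by blast
    have "inv (y [^] (j + 1)) \<otimes> inv (x [^] i) = inv (x [^] i) \<otimes> y [^] (k * m)"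
      unfolding m [symmetric] by (simp add: conjg_def m_assoc r int_pow_neg)
    finally have "conjg y (x [^] (2::int)) = inv x \<otimes> inv (x [^] i) \<otimes> y [^] (k * m)"
      by (simp add: m_assoc)
    also have "inv x \<otimes> inv (x [^] i) = x [^] (- 1 + - i)"
      using int_pow_mult[of x "-1" "- i"] by (simp add: int_pow_neg)
    also obtain r' where "i = 2 * r' + 1" using i by (rule oddE)
    then have "- 1 + - i = 2 * (- r' - 1)" by simp
    finally show ?thesis by blast
  qed
  then obtain d e :: int where de: "conjg y (x [^] (2::int)) = x [^] (2 * d) \<otimes> y [^] (k * e)" by blast
  have y_even: "conjg y (x [^] (2 * n)) = x [^] (2 * d * n) \<otimes> y [^] (k * (e * n))" for n :: int
  proof -
    have "conjg y (x [^] (2 * n)) = conjg y (x [^] (2::int)) [^] n"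
      by (simp add: conjg_int_pow [symmetric] int_pow_pow)
    also have "\<dots> = (x [^] (2 * d)) [^] n \<otimes> (y [^] (k * e)) [^] n"
      unfolding de by (rule int_pow_mult_distrib[OF x_square_commute[OF c]]) simp_all
    finally show ?thesis by (simp add: int_pow_pow mult.assoc)
  qed
  have y: "y \<otimes> g \<in> xy_products" if g': "g \<in> xy_products" for g
  proof -
    obtain m n :: int where g: "g = x [^] m \<otimes> y [^] n" using g' by (auto simp: xy_products_def)
    show ?thesis
    proof (cases "even m")
      case True
      then obtain r where r: "m = 2 * r" by blast
      have "y \<otimes> g = conjg y (x [^] (2 * r)) \<otimes> (y \<otimes> y [^] n)"
        by (simp add: conjg_def m_assoc g r)
      also have "\<dots> = x [^] (2 * d * r) \<otimes> y [^] (k * (e * r) + (1 + n))"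
        by (simp add: y_even m_assoc int_pow_mult)
      finally show ?thesis by (simp only: xy_productsI)
    next
      case False
      then obtain r where r: "m = 2 * r + 1" by (rule oddE)
      have "y \<otimes> g = conjg y (x [^] (2 * r)) \<otimes> (y \<otimes> x) \<otimes> y [^] n"
        by (simp add: conjg_def m_assoc g r int_pow_mult)
      also have "\<dots> = x [^] (2 * d * r) \<otimes> (inv x \<otimes> conjg x (y [^] (k * (e * r)))) \<otimes> inv y \<otimes> y [^] n"
        unfolding y_even yx_eq by (simp add: conjg_def m_assoc)
      also have "\<dots> = x [^] (2 * d * r) \<otimes> x [^] (-1::int) \<otimes>
          (y [^] (k * (c * (e * r))) \<otimes> y [^] (-1::int) \<otimes> y [^] n)"
        using conjg_x_pow_mult[OF c] by (simp add: m_assoc int_pow_neg)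
      also have "\<dots> = x [^] (2 * d * r + - 1) \<otimes> y [^] (k * (c * (e * r)) + - 1 + n)"
        by (simp only: int_pow_mult x_in y_in)
      finally show ?thesis by (simp only: xy_productsI)
    qed
  qed
  then show "y \<otimes> g \<in> xy_products" using g by blast
  have "y [^] n \<otimes> g \<in> xy_products" for n :: nat
  proof (induction n)
    case (Suc n)
    have "g \<in> carrier G" using g by (auto simp: xy_products_def)
    then have "y [^] Suc n \<otimes> g = y \<otimes> (y [^] n \<otimes> g)" by (simp only: nat_pow_Suc2 y_in m_assoc nat_pow_closed)
    then show ?case using y[OF Suc] by (simp only:)
  next
    case 0
    have "g \<in> carrier G" using g by (auto simp: xy_products_def)
    then show ?case using g by simp
  qed
  then show "inv y \<otimes> g \<in> xy_products"
    by (simp add: inv_in_nat_powers[OF y_in y_pow q])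
qed

text \<open>Conjugating the first relation by \<open>x\<close> eliminates all conjugates by \<open>y\<close>.\<close>

lemma relations_consequence:
  fixes i j i' j' :: int
  assumes r1: "inv y \<otimes> x = x [^] i \<otimes> y [^] j" and r2: "y \<otimes> inv x = x [^] i' \<otimes> y [^] j'"
  shows "x [^] i \<otimes> y [^] (j - 1) \<otimes> x [^] i' = y [^] (- j' - 1)"
proof -
  have x2: "x [^] (2::int) = x \<otimes> x" using int_pow_mult[of x 1 1] by simp
  have yy: "y [^] (j - 1) \<otimes> inv x = y [^] j \<otimes> (x \<otimes> y)"
    using int_pow_mult[of y j "-1"] by (simp add: xy_eq int_pow_neg m_assoc)
  have "conjg (inv y) (x [^] (2::int)) = (inv y \<otimes> x) \<otimes> (x \<otimes> y)" by (simp add: conjg_def x2 m_assoc)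
  also have "\<dots> = x [^] i \<otimes> y [^] (j - 1) \<otimes> inv x" by (simp add: r1 yy m_assoc)
  finally have A: "conjg x (conjg (inv y) (x [^] (2::int))) = x \<otimes> (x [^] i \<otimes> y [^] (j - 1)) \<otimes> inv x \<otimes> inv x"
    by (simp add: conjg_def m_assoc)
  have yy': "y [^] (j' + 1) \<otimes> x = y [^] j' \<otimes> (y \<otimes> x)" by (simp add: int_pow_mult m_assoc)
  have "conjg y (inv (x [^] (2::int))) = (y \<otimes> inv x) \<otimes> (inv x \<otimes> inv y)"
    by (simp add: conjg_def x2 group_norm)
  also have "\<dots> = x [^] i' \<otimes> y [^] (j' + 1) \<otimes> x" unfolding r2 yx_eq[symmetric] by (simp add: yy' m_assoc)
  finally have "inv (conjg y (inv (x [^] (2::int)))) = inv x \<otimes> (inv (y [^] (j' + 1)) \<otimes> inv (x [^] i'))"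
    by (simp add: inv_mult_group m_assoc)
  then have B: "conjg y (x [^] (2::int)) = inv x \<otimes> (y [^] (- j' - 1) \<otimes> inv (x [^] i'))"
    using int_pow_neg[of y "j' + 1"] by (simp add: conjg_inv)
  have "x \<otimes> inv y = x \<otimes> x \<otimes> y \<otimes> x" by (simp add: xy_eq m_assoc)
  then have "conjg x (conjg (inv y) (x [^] (2::int))) = conjg (x \<otimes> x) (conjg y (conjg x (x [^] (2::int))))"
    by (simp add: conjg_conjg m_assoc)
  also have "conjg x (x [^] (2::int)) = x [^] (2::int)" by (rule conjg_x_x_pow)
  finally have "x \<otimes> (x [^] i \<otimes> y [^] (j - 1)) \<otimes> inv x \<otimes> inv x =
      x \<otimes> (y [^] (- j' - 1) \<otimes> inv (x [^] i')) \<otimes> inv x \<otimes> inv x"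
    unfolding A B by (simp add: conjg_def group_norm)
  then have "x [^] i \<otimes> y [^] (j - 1) = y [^] (- j' - 1) \<otimes> inv (x [^] i')" by simp
  then show ?thesis by (simp add: m_assoc)
qed

text \<open>An odd i is invertible modulo 2^a, so x is itself a power of x^i and normalizes whatever
  x^i normalizes in <y>.\<close>

lemma conjg_odd_power:
  fixes i c k :: int
  assumes c: "conjg (x [^] i) (y [^] k) = y [^] (c * k)" and i: "odd i"
    and x_pow: "x [^] ((2::nat) ^ a) = \<one>"
  shows "\<exists>c. conjg x (y [^] k) = y [^] (c * k)"
proof -
  have "coprime i ((2::int) ^ a)" using i by simp
  then obtain r s where r: "r * i + s * 2 ^ a = 1" using bezout_int[of i "2 ^ a"] by auto
  define n where "n = nat (r mod 2 ^ a)"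
  have "int n = r - 2 ^ a * (r div 2 ^ a)" by (simp add: n_def minus_mult_div_eq_mod)
  then have "i * int n = i * (r - 2 ^ a * (r div 2 ^ a))" by simp
  also have "\<dots> = r * i + s * 2 ^ a + 2 ^ a * (- s - i * (r div 2 ^ a))" by (simp add: algebra_simps)
  finally have "i * int n = 1 + 2 ^ a * (- s - i * (r div 2 ^ a))" by (simp only: r)
  then obtain l where "i * int n = 1 + 2 ^ a * l" by blast
  moreover have "x [^] (int (2 ^ a) * l) = \<one>"
    using x_pow by (simp only: int_pow_pow [symmetric] x_in int_pow_int) simp
  ultimately have "x [^] (i * int n) = x" by (simp add: int_pow_mult)
  then have x: "(x [^] i) [^] n = x" by (simp add: int_pow_pow int_pow_int [symmetric])
  have "conjg ((x [^] i) [^] n) (y [^] k) = (y [^] k) [^] (c ^ n)"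
    using c by (intro conjg_nat_pow) (simp_all add: int_pow_pow mult.commute)
  then have "conjg x (y [^] k) = y [^] (c ^ n * k)" by (simp add: x int_pow_pow mult.commute)
  then show ?thesis by blast
qed

end

section \<open>Homomorphisms from presented groups\<close>

fun letter :: "('a, 'b) monoid_scheme \<Rightarrow> ('g \<Rightarrow> 'a) \<Rightarrow> 'g \<times> bool \<Rightarrow> 'a" where
  "letter G f (g, b) = (if b then f g else inv\<^bsub>G\<^esub> f g)"

definition eval_word :: "('a, 'b) monoid_scheme \<Rightarrow> ('g \<Rightarrow> 'a) \<Rightarrow> 'g word \<Rightarrow> 'a" where
  "eval_word G f u = foldr (\<lambda>l a. letter G f l \<otimes>\<^bsub>G\<^esub> a) u \<one>\<^bsub>G\<^esub>"

context group
begin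

lemma letter_closed [simp]: "range f \<subseteq> carrier G \<Longrightarrow> letter G f l \<in> carrier G"
  by (cases l) auto

lemma eval_word_Nil [simp]: "eval_word G f [] = \<one>"
  and eval_word_Cons [simp]: "eval_word G f (l # u) = letter G f l \<otimes> eval_word G f u"
  by (simp_all add: eval_word_def)

lemma eval_word_closed [simp]: "range f \<subseteq> carrier G \<Longrightarrow> eval_word G f u \<in> carrier G"
  by (induction u) simp_all

lemma eval_word_append:
  "range f \<subseteq> carrier G \<Longrightarrow> eval_word G f (u @ v) = eval_word G f u \<otimes> eval_word G f v"
  by (induction u) (simp_all add: m_assoc)

lemma eval_word_gen_pow:
  assumes f: "range f \<subseteq> carrier G"
  shows "eval_word G f (gen_pow g k) = f g [^] k"
proof -
  have fg: "f g \<in> carrier G" using f by blast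
  have rep: "eval_word G f (replicate n (g, b)) = letter G f (g, b) [^] n" for n b
  proof (induction n)
    case (Suc n)
    have "letter G f (g, b) [^] Suc n = letter G f (g, b) \<otimes> letter G f (g, b) [^] n"
      by (rule nat_pow_Suc2[OF letter_closed[OF f]])
    then show ?case by (simp only: replicate_Suc eval_word_Cons Suc)
  qed simp
  show ?thesis
  proof (cases "0 \<le> k")
    case True
    then show ?thesis by (simp add: gen_pow_def rep int_pow_int [symmetric])
  next
    case False
    have "f g [^] k = inv f g [^] nat (- k)"
      unfolding int_pow_def2 nat_pow_inv[OF fg] using False by simp
    then show ?thesis using False by (simp add: gen_pow_def rep)
  qed
qed

lemma pres_eq_eval_word:
  assumes f: "range f \<subseteq> carrier G"
    and R: "\<And>u v. (u, v) \<in> R \<Longrightarrow> eval_word G f u = eval_word G f v"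
    and "pres_eq R u v"
  shows "eval_word G f u = eval_word G f v"
  using assms(3)
proof (induction rule: pres_eq.induct)
  case (cancel g b)
  have "f g \<in> carrier G" using f by blast
  then show ?case by simp
qed (simp_all add: R f eval_word_append)

end

text \<open>Through this identity defining relations become equations between powers of the two
  generators inside the presented group.\<close>

lemma pres_class_eval_word:
  "pres_class R u = eval_word (presented_group R) (\<lambda>g. pres_class R [(g, True)]) u"
proof -
  interpret group "presented_group R" by (rule group_presented_group)
  have one: "\<one>\<^bsub>presented_group R\<^esub> = pres_class R []" by (simp add: presented_group_def)
  have car: "pres_class R u \<in> carrier (presented_group R)" for u by (simp add: presented_group_def)
  have letter: "letter (presented_group R) (\<lambda>g. pres_class R [(g, True)]) (g, b) = pres_class R [(g, b)]" for g b
  proof (cases b)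
    case False
    have "pres_class R [(g, False)] \<otimes>\<^bsub>presented_group R\<^esub> pres_class R [(g, True)] = \<one>\<^bsub>presented_group R\<^esub>"
      using pres_eq.cancel[of R g False] by (simp add: presented_group_mult one pres_class_eq_iff)
    then show ?thesis using False by (simp add: inv_equality car)
  qed simp
  show ?thesis
  proof (induction u)
    case (Cons l u)
    have "pres_class R (l # u) = pres_class R [l] \<otimes>\<^bsub>presented_group R\<^esub> pres_class R u"
      by (simp add: presented_group_mult)
    moreover have "letter (presented_group R) (\<lambda>g. pres_class R [(g, True)]) l = pres_class R [l]"
      using letter by (cases l) metis
    ultimately show ?case using Cons by (simp only: eval_word_Cons)
  qed (simp add: one)
qed

text \<open>Von Dyck's theorem; the value on a class is read off from an arbitrary representative,
  which is harmless because evaluation respects \<open>pres_eq\<close>.\<close>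

lemma (in group) hom_presented_group:
  assumes f: "range f \<subseteq> carrier G"
    and R: "\<And>u v. (u, v) \<in> R \<Longrightarrow> eval_word G f u = eval_word G f v"
  obtains h where "h \<in> hom (presented_group R) G" "\<And>u. h (pres_class R u) = eval_word G f u"
proof -
  define h where "h A = eval_word G f (SOME u. u \<in> A)" for A
  have h: "h (pres_class R u) = eval_word G f u" for u
  proof -
    have "u \<in> pres_class R u" by (simp add: pres_class_def pres_eq.refl)
    then have "(SOME v. v \<in> pres_class R u) \<in> pres_class R u" by (rule someI)
    then have "pres_eq R u (SOME v. v \<in> pres_class R u)" by (simp add: pres_class_def)
    then show ?thesis using pres_eq_eval_word[OF f R] by (metis h_def)
  qed
  have "h \<in> hom (presented_group R) G"
  proof (rule homI)
    fix A B assume "A \<in> carrier (presented_group R)" "B \<in> carrier (presented_group R)"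
    then obtain u v where "A = pres_class R u" "B = pres_class R v" by (auto simp: presented_group_def)
    then show "h (A \<otimes>\<^bsub>presented_group R\<^esub> B) = h A \<otimes> h B"
      using f by (simp add: presented_group_mult h eval_word_append)
  qed (use f h in \<open>auto simp: presented_group_def\<close>)
  then show ?thesis using h by (rule that)
qed

text \<open>It suffices that the presented group has at most \<open>p q\<close> elements.\<close>

lemma (in tight_pair) Gamma_iso:
  fixes i j i' j' :: int
  assumes r1: "inv y \<otimes> x = x [^] i \<otimes> y [^] j" and r2: "y \<otimes> inv x = x [^] i' \<otimes> y [^] j'"
    and i': "odd i'"
    and normal: "\<And>(H :: gen word set monoid) u v. \<lbrakk>invol_pair H u v; u [^]\<^bsub>H\<^esub> p = \<one>\<^bsub>H\<^esub>; v [^]\<^bsub>H\<^esub> q = \<one>\<^bsub>H\<^esub>;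
      u [^]\<^bsub>H\<^esub> i \<otimes>\<^bsub>H\<^esub> v [^]\<^bsub>H\<^esub> (j - 1) \<otimes>\<^bsub>H\<^esub> u [^]\<^bsub>H\<^esub> i' = v [^]\<^bsub>H\<^esub> (- j' - 1)\<rbrakk> \<Longrightarrow>
      \<exists>k c. k dvd j' + 1 \<and> group.conjg H u (v [^]\<^bsub>H\<^esub> k) = v [^]\<^bsub>H\<^esub> (c * k)"
  shows "\<exists>h \<in> iso (presented_group (Gamma_rels (int p) (int q) i j i' j')) G.
    h (pres_class (Gamma_rels (int p) (int q) i j i' j') (gen_pow S1 1)) = x \<and>
    h (pres_class (Gamma_rels (int p) (int q) i j i' j') (gen_pow S2 1)) = y"
proof -
  define R where "R = Gamma_rels (int p) (int q) i j i' j'"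
  define f where "f = case_gen x y"
  have f: "range f \<subseteq> carrier G" "f S1 = x" "f S2 = y" by (auto simp: f_def split: gen.split)
  note word = eval_word_append eval_word_gen_pow
  have "eval_word G f u = eval_word G f v" if "(u, v) \<in> R" for u v
    using that f(1) r1 r2 x_int_pow[of 1] y_int_pow[of 1] invol
    by (auto simp: R_def Gamma_rels_def word f(2,3) int_pow_neg m_assoc)
  then obtain h where h: "h \<in> hom (presented_group R) G" and h_eval: "\<And>u. h (pres_class R u) = eval_word G f u"
    using hom_presented_group[OF f(1)] by blast
  define P where "P = presented_group R"
  define u where "u = pres_class R [(S1, True)]"
  define v where "v = pres_class R [(S2, True)]"
  interpret P: group P unfolding P_def by (rule group_presented_group)
  have uv: "u \<in> carrier P" "v \<in> carrier P" by (simp_all add: u_def v_def P_def presented_group_def)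
  define F where "F = (\<lambda>g. pres_class R [(g, True)])"
  have F: "range F \<subseteq> carrier P" "F S1 = u" "F S2 = v"
    by (auto simp: F_def u_def v_def P_def presented_group_def)
  have class_eq: "pres_class R w = eval_word P F w" for w
    unfolding P_def F_def by (rule pres_class_eval_word)
  note word' = P.eval_word_append P.eval_word_gen_pow
  have rel: "eval_word P F w = eval_word P F w'" if "(w, w') \<in> R" for w w'
    using pres_eq.rel[OF that] by (simp add: class_eq [symmetric] pres_class_eq_iff)
  have up: "u [^]\<^bsub>P\<^esub> p = \<one>\<^bsub>P\<^esub>" and vq: "v [^]\<^bsub>P\<^esub> q = \<one>\<^bsub>P\<^esub>"
    using rel[of "gen_pow S1 (int p)" "[]"] rel[of "gen_pow S2 (int q)" "[]"] F
    by (simp_all add: R_def Gamma_rels_def word' int_pow_int)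
  have inv: "u \<otimes>\<^bsub>P\<^esub> v \<otimes>\<^bsub>P\<^esub> (u \<otimes>\<^bsub>P\<^esub> v) = \<one>\<^bsub>P\<^esub>"
    using rel[of "(gen_pow S1 1 @ gen_pow S2 1) @ (gen_pow S1 1 @ gen_pow S2 1)" "[]"] F uv
    by (simp add: R_def Gamma_rels_def word' P.m_assoc)
  have rel1: "inv\<^bsub>P\<^esub> v \<otimes>\<^bsub>P\<^esub> u = u [^]\<^bsub>P\<^esub> i \<otimes>\<^bsub>P\<^esub> v [^]\<^bsub>P\<^esub> j"
    using rel[of "gen_pow S2 (-1) @ gen_pow S1 1" "gen_pow S1 i @ gen_pow S2 j"] F uv
    by (simp add: R_def Gamma_rels_def word' P.int_pow_neg)
  have rel2: "v \<otimes>\<^bsub>P\<^esub> inv\<^bsub>P\<^esub> u = u [^]\<^bsub>P\<^esub> i' \<otimes>\<^bsub>P\<^esub> v [^]\<^bsub>P\<^esub> j'"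
    using rel[of "gen_pow S2 1 @ gen_pow S1 (-1)" "gen_pow S1 i' @ gen_pow S2 j'"] F uv
    by (simp add: R_def Gamma_rels_def word' P.int_pow_neg)
  interpret P: invol_pair P u v by unfold_locales (fact uv inv)+
  \<comment> \<open>The order of the presented group is still unknown here. One consequence of its
    relations provides a subgroup <v^k> stable under u, and that is enough to collect every word
    into a product of powers.\<close>
  obtain k c where kc: "k dvd j' + 1" "P.conjg u (v [^]\<^bsub>P\<^esub> k) = v [^]\<^bsub>P\<^esub> (c * k)"
    using normal[OF P.invol_pair_axioms up vq P.relations_consequence[OF rel1 rel2]] by blast
  note left_mult = P.xy_products_left_mult[OF kc(2) rel2 i' kc(1) up p_pos vq q_pos]
  have products: "eval_word P F w \<in> P.xy_products" for w
  proof (induction w)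
    case Nil
    show ?case using P.xy_productsI[of 0 0] by simp
  next
    case (Cons l w)
    obtain g b where l: "l = (g, b)" by (cases l)
    show ?case unfolding l P.eval_word_Cons letter.simps
    proof (cases g)
      case S1
      show "(if b then F g else inv\<^bsub>P\<^esub> F g) \<otimes>\<^bsub>P\<^esub> eval_word P F w \<in> P.xy_products"
        unfolding S1 F(2) using left_mult(1,2)[OF Cons] by (cases b) simp_all
    next
      case S2
      show "(if b then F g else inv\<^bsub>P\<^esub> F g) \<otimes>\<^bsub>P\<^esub> eval_word P F w \<in> P.xy_products"
        unfolding S2 F(3) using left_mult(3,4)[OF Cons] by (cases b) simp_all
    qed
  qed
  have "carrier P \<subseteq> P.xy_products"
  proof
    fix A assume "A \<in> carrier P"
    then obtain w where "A = pres_class R w" by (auto simp: P_def presented_group_def)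
    then show "A \<in> P.xy_products" using products[of w] by (simp only: class_eq)
  qed
  also have "P.xy_products \<subseteq> (\<lambda>(m, n). u [^]\<^bsub>P\<^esub> m \<otimes>\<^bsub>P\<^esub> v [^]\<^bsub>P\<^esub> n) ` ({0..<int p} \<times> {0..<int q})"
  proof
    have mod: "w [^]\<^bsub>P\<^esub> (m mod int r) = w [^]\<^bsub>P\<^esub> m" if "w \<in> carrier P" "w [^]\<^bsub>P\<^esub> r = \<one>\<^bsub>P\<^esub>" for w r and m :: int
    proof -
      have "w [^]\<^bsub>P\<^esub> (int r * (m div int r) + m mod int r) =
          (w [^]\<^bsub>P\<^esub> int r) [^]\<^bsub>P\<^esub> (m div int r) \<otimes>\<^bsub>P\<^esub> w [^]\<^bsub>P\<^esub> (m mod int r)"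
        using that(1) by (simp only: P.int_pow_mult P.int_pow_pow)
      then show ?thesis using that by (simp add: int_pow_int)
    qed
    fix w assume "w \<in> P.xy_products"
    then obtain m n :: int where "w = u [^]\<^bsub>P\<^esub> m \<otimes>\<^bsub>P\<^esub> v [^]\<^bsub>P\<^esub> n" by (auto simp: P.xy_products_def)
    then have "w = u [^]\<^bsub>P\<^esub> (m mod int p) \<otimes>\<^bsub>P\<^esub> v [^]\<^bsub>P\<^esub> (n mod int q)"
      by (simp add: mod up vq)
    then show "w \<in> (\<lambda>(m, n). u [^]\<^bsub>P\<^esub> m \<otimes>\<^bsub>P\<^esub> v [^]\<^bsub>P\<^esub> n) ` ({0..<int p} \<times> {0..<int q})"
      using p_pos q_pos by (intro image_eqI[of _ _ "(m mod int p, n mod int q)"]) auto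
  qed
  finally have sub: "carrier P \<subseteq> (\<lambda>(m, n). u [^]\<^bsub>P\<^esub> m \<otimes>\<^bsub>P\<^esub> v [^]\<^bsub>P\<^esub> n) ` ({0..<int p} \<times> {0..<int q})" .
  have fin: "finite (carrier P)" by (rule finite_subset[OF sub]) simp
  have "card (carrier P) \<le> card ({0..<int p} \<times> {0..<int q})"
    by (rule surj_card_le[OF _ sub]) simp
  then have card: "card (carrier P) \<le> card (carrier G)" by (simp add: card_carrier)
  have "h ` carrier P = carrier G"
  proof
    show "h ` carrier P \<subseteq> carrier G" using hom_carrier[OF h] by (simp add: P_def)
    show "carrier G \<subseteq> h ` carrier P"
    proof
      fix g assume "g \<in> carrier G"
      then obtain m n :: int where "g = x [^] m \<otimes> y [^] n" using factor by blast
      then have "g = h (pres_class R (gen_pow S1 m @ gen_pow S2 n))"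
        using f by (simp add: h_eval word)
      then show "g \<in> h ` carrier P" by (auto simp: P_def presented_group_def)
    qed
  qed
  \<comment> \<open>A surjection from at most p q elements onto p q elements leaves no room for a
    kernel.\<close>
  moreover have "card (carrier P) = card (h ` carrier P)"
    using calculation card card_image_le[OF fin, of h] by simp
  then have "inj_on h (carrier P)" by (intro eq_card_imp_inj_on[OF fin]) simp
  ultimately have "h \<in> iso P G" using h by (simp add: iso_def bij_betw_def P_def)
  moreover have "h (pres_class R (gen_pow S1 1)) = x" "h (pres_class R (gen_pow S2 1)) = y"
    using f by (simp_all add: h_eval word)
  ultimately show ?thesis unfolding P_def R_def by blast
qed

section \<open>Flags of a polyhedron\<close>

locale polyh =
  fixes P :: "'a ranked_poset"
  assumes polyhedron: "polyhedron P"
begin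

lemma ple_elems: "(a, b) \<in> ple P \<Longrightarrow> a \<in> elems P \<and> b \<in> elems P"
  and ple_refl: "a \<in> elems P \<Longrightarrow> (a, a) \<in> ple P"
  and ple_trans: "(a, b) \<in> ple P \<Longrightarrow> (b, c) \<in> ple P \<Longrightarrow> (a, c) \<in> ple P"
  using polyhedron
  unfolding polyhedron_def partial_order_on_def preorder_on_def refl_on_def trans_def by blast+

lemma ple_rank: "(a, b) \<in> ple P \<Longrightarrow> a \<noteq> b \<Longrightarrow> rank_of P a < rank_of P b"
  using polyhedron unfolding polyhedron_def by blast

lemma rank_cases: "a \<in> elems P \<Longrightarrow> a \<in> vertices P \<or> a \<in> edges P \<or> a \<in> faces P"
  using polyhedron unfolding polyhedron_def of_rank_def by fastforce

lemma incident_sym: "incident P a b \<longleftrightarrow> incident P b a"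
  by (auto simp: incident_def)

lemma incident_ple: "incident P a b \<Longrightarrow> rank_of P a < rank_of P b \<Longrightarrow> (a, b) \<in> ple P"
  using ple_rank unfolding incident_def by force

lemma incident_rank_eq: "incident P a b \<Longrightarrow> rank_of P a = rank_of P b \<Longrightarrow> a = b"
  using ple_rank unfolding incident_def by force

lemma incident_vef:
  "incident P v e \<Longrightarrow> incident P e f \<Longrightarrow> v \<in> vertices P \<Longrightarrow> e \<in> edges P \<Longrightarrow> f \<in> faces P \<Longrightarrow> incident P v f"
  using incident_ple[of v e] incident_ple[of e f] ple_trans[of v e f] unfolding of_rank_def
  by (auto simp: incident_def)

lemma flags_iff:
  "(v, e, f) \<in> flags P \<longleftrightarrow>
    v \<in> vertices P \<and> e \<in> edges P \<and> f \<in> faces P \<and> incident P v e \<and> incident P e f"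
  using incident_vef by (auto simp: flags_def)

lemma card_edge: "e \<in> edges P \<Longrightarrow> card {v \<in> vertices P. incident P v e} = 2"
  "e \<in> edges P \<Longrightarrow> card {f \<in> faces P. incident P e f} = 2"
  using polyhedron unfolding polyhedron_def by blast+

lemma card_vertex_face:
  "v \<in> vertices P \<Longrightarrow> f \<in> faces P \<Longrightarrow> incident P v f \<Longrightarrow>
    card {e \<in> edges P. incident P v e \<and> incident P e f} = 2"
  using polyhedron unfolding polyhedron_def by blast

lemma card_2_other:
  assumes "card A = 2" "a \<in> A"
  shows "\<exists>b. b \<in> A \<and> b \<noteq> a \<and> (\<forall>c \<in> A. c = a \<or> c = b)"
  using assms by (auto simp: card_2_iff)

lemma ex1_adjacent:
  assumes "\<Phi> \<in> flags P" "i \<in> {0, 1, 2}"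
  shows "\<exists>!\<Psi>. \<Psi> \<in> flags P \<and> (\<forall>j\<in>{0, 1, 2}. flag_elem \<Psi> j \<noteq> flag_elem \<Phi> j \<longleftrightarrow> j = i)"
proof -
  obtain v e f where \<Phi>: "\<Phi> = (v, e, f)" by (cases \<Phi>)
  have F: "(v, e, f) \<in> flags P" using assms \<Phi> by simp
  then have vef: "v \<in> vertices P" "e \<in> edges P" "f \<in> faces P" "incident P v e" "incident P e f"
    by (simp_all add: flags_iff)
  have vf: "incident P v f" using vef incident_vef by blast
  consider "i = 0" | "i = 1" | "i = 2" using assms(2) by blast
  then show ?thesis
  proof cases
    case 1
    obtain v' where v': "v' \<in> vertices P" "incident P v' e" "v' \<noteq> v"
      "\<And>w. w \<in> vertices P \<Longrightarrow> incident P w e \<Longrightarrow> w = v \<or> w = v'"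
      using card_2_other[OF card_edge(1)[OF vef(2)], of v] vef by blast
    show ?thesis
    proof (rule ex1I[of _ "(v', e, f)"])
      show "(v', e, f) \<in> flags P \<and> (\<forall>j\<in>{0, 1, 2}. flag_elem (v', e, f) j \<noteq> flag_elem \<Phi> j \<longleftrightarrow> j = i)"
        using v' vef 1 by (auto simp: flags_iff flag_elem_def \<Phi>)
      fix \<Psi> assume "\<Psi> \<in> flags P \<and> (\<forall>j\<in>{0, 1, 2}. flag_elem \<Psi> j \<noteq> flag_elem \<Phi> j \<longleftrightarrow> j = i)"
      then show "\<Psi> = (v', e, f)"
        using v'(4) 1 by (cases \<Psi>) (auto simp: flags_iff flag_elem_def \<Phi>)
    qed
  next
    case 2
    obtain e' where e': "e' \<in> edges P" "incident P v e'" "incident P e' f" "e' \<noteq> e"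
      "\<And>w. w \<in> edges P \<Longrightarrow> incident P v w \<Longrightarrow> incident P w f \<Longrightarrow> w = e \<or> w = e'"
      using card_2_other[OF card_vertex_face[OF vef(1,3) vf], of e] vef by blast
    show ?thesis
    proof (rule ex1I[of _ "(v, e', f)"])
      show "(v, e', f) \<in> flags P \<and> (\<forall>j\<in>{0, 1, 2}. flag_elem (v, e', f) j \<noteq> flag_elem \<Phi> j \<longleftrightarrow> j = i)"
        using e' vef 2 by (auto simp: flags_iff flag_elem_def \<Phi>)
      fix \<Psi> assume "\<Psi> \<in> flags P \<and> (\<forall>j\<in>{0, 1, 2}. flag_elem \<Psi> j \<noteq> flag_elem \<Phi> j \<longleftrightarrow> j = i)"
      then show "\<Psi> = (v, e', f)"
        using e'(5) 2 by (cases \<Psi>) (auto simp: flags_iff flag_elem_def \<Phi>)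
    qed
  next
    case 3
    obtain f' where f': "f' \<in> faces P" "incident P e f'" "f' \<noteq> f"
      "\<And>w. w \<in> faces P \<Longrightarrow> incident P e w \<Longrightarrow> w = f \<or> w = f'"
      using card_2_other[OF card_edge(2)[OF vef(2)], of f] vef by blast
    show ?thesis
    proof (rule ex1I[of _ "(v, e, f')"])
      show "(v, e, f') \<in> flags P \<and> (\<forall>j\<in>{0, 1, 2}. flag_elem (v, e, f') j \<noteq> flag_elem \<Phi> j \<longleftrightarrow> j = i)"
        using f' vef 3 by (auto simp: flags_iff flag_elem_def \<Phi>)
      fix \<Psi> assume "\<Psi> \<in> flags P \<and> (\<forall>j\<in>{0, 1, 2}. flag_elem \<Psi> j \<noteq> flag_elem \<Phi> j \<longleftrightarrow> j = i)"
      then show "\<Psi> = (v, e, f')"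
        using f'(4) 3 by (cases \<Psi>) (auto simp: flags_iff flag_elem_def \<Phi>)
    qed
  qed
qed

lemma flag_adj:
  assumes "\<Phi> \<in> flags P" "i \<in> {0, 1, 2}"
  shows flag_adj_closed: "flag_adj P i \<Phi> \<in> flags P"
    and flag_adj_elem: "j \<in> {0, 1, 2} \<Longrightarrow> flag_elem (flag_adj P i \<Phi>) j \<noteq> flag_elem \<Phi> j \<longleftrightarrow> j = i"
  using theI'[OF ex1_adjacent[OF assms]] unfolding flag_adj_def by blast+

lemma flag_adj_eqI:
  assumes "\<Phi> \<in> flags P" "i \<in> {0, 1, 2}" "\<Psi> \<in> flags P"
    "\<And>j. j \<in> {0, 1, 2} \<Longrightarrow> flag_elem \<Psi> j \<noteq> flag_elem \<Phi> j \<longleftrightarrow> j = i"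
  shows "flag_adj P i \<Phi> = \<Psi>"
  unfolding flag_adj_def by (rule the1_equality[OF ex1_adjacent[OF assms(1,2)]])
    (intro conjI ballI assms(3), rule assms(4))

lemma flag_adj_involution:
  assumes "\<Phi> \<in> flags P" "i \<in> {0, 1, 2}"
  shows "flag_adj P i (flag_adj P i \<Phi>) = \<Phi>"
proof (rule flag_adj_eqI)
  show "flag_elem \<Phi> j \<noteq> flag_elem (flag_adj P i \<Phi>) j \<longleftrightarrow> j = i" if "j \<in> {0, 1, 2}" for j
    using flag_adj_elem[OF assms that] by auto
qed (use assms flag_adj_closed in auto)

lemma flag_adj_neq: "\<Phi> \<in> flags P \<Longrightarrow> i \<in> {0, 1, 2} \<Longrightarrow> flag_adj P i \<Phi> \<noteq> \<Phi>"
  using flag_adj_elem by metis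

lemma flag_adj_0: "(v, e, f) \<in> flags P \<Longrightarrow> (v', e, f) \<in> flags P \<Longrightarrow> v' \<noteq> v \<Longrightarrow> flag_adj P 0 (v, e, f) = (v', e, f)"
  by (rule flag_adj_eqI) (auto simp: flag_elem_def)

lemma flag_adj_1: "(v, e, f) \<in> flags P \<Longrightarrow> (v, e', f) \<in> flags P \<Longrightarrow> e' \<noteq> e \<Longrightarrow> flag_adj P 1 (v, e, f) = (v, e', f)"
  by (rule flag_adj_eqI) (auto simp: flag_elem_def)

lemma flag_adj_2: "(v, e, f) \<in> flags P \<Longrightarrow> (v, e, f') \<in> flags P \<Longrightarrow> f' \<noteq> f \<Longrightarrow> flag_adj P 2 (v, e, f) = (v, e, f')"
  by (rule flag_adj_eqI) (auto simp: flag_elem_def)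

lemma flag_adj_proj:
  assumes "\<Phi> \<in> flags P"
  shows "fst (flag_adj P 1 \<Phi>) = fst \<Phi>" "fst (flag_adj P 2 \<Phi>) = fst \<Phi>"
    "fst (snd (flag_adj P 0 \<Phi>)) = fst (snd \<Phi>)" "fst (snd (flag_adj P 2 \<Phi>)) = fst (snd \<Phi>)"
    "snd (snd (flag_adj P 0 \<Phi>)) = snd (snd \<Phi>)" "snd (snd (flag_adj P 1 \<Phi>)) = snd (snd \<Phi>)"
proof -
  have *: "flag_elem \<Psi> 0 = fst \<Psi>" "flag_elem \<Psi> 1 = fst (snd \<Psi>)" "flag_elem \<Psi> 2 = snd (snd \<Psi>)" for \<Psi> :: "'a flag"
    by (cases \<Psi>, simp add: flag_elem_def)+
  show "fst (flag_adj P 1 \<Phi>) = fst \<Phi>" "fst (flag_adj P 2 \<Phi>) = fst \<Phi>"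
    "fst (snd (flag_adj P 0 \<Phi>)) = fst (snd \<Phi>)" "fst (snd (flag_adj P 2 \<Phi>)) = fst (snd \<Phi>)"
    "snd (snd (flag_adj P 0 \<Phi>)) = snd (snd \<Phi>)" "snd (snd (flag_adj P 1 \<Phi>)) = snd (snd \<Phi>)"
    using flag_adj_elem[OF assms, of 1 0] flag_adj_elem[OF assms, of 2 0] flag_adj_elem[OF assms, of 0 1]
      flag_adj_elem[OF assms, of 2 1] flag_adj_elem[OF assms, of 0 2] flag_adj_elem[OF assms, of 1 2]
    by (simp_all add: * [symmetric])
qed

text \<open>A vertex and a face on a common edge are always incident, so they can be exchanged
  independently of each other.\<close>

lemma flag_adj_0_2_commute:
  assumes "\<Phi> \<in> flags P"
  shows "flag_adj P 0 (flag_adj P 2 \<Phi>) = flag_adj P 2 (flag_adj P 0 \<Phi>)"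
proof -
  obtain v e f where \<Phi>: "\<Phi> = (v, e, f)" by (cases \<Phi>)
  obtain v' where v': "flag_adj P 0 \<Phi> = (v', e, f)" using flag_adj_proj[OF assms] \<Phi>
    by (metis fst_conv snd_conv prod.exhaust_sel)
  obtain f' where f': "flag_adj P 2 \<Phi> = (v, e, f')" using flag_adj_proj[OF assms] \<Phi>
    by (metis fst_conv snd_conv prod.exhaust_sel)
  have fl: "(v, e, f) \<in> flags P" "(v', e, f) \<in> flags P" "(v, e, f') \<in> flags P"
    using assms \<Phi> v' f' flag_adj_closed[OF assms, of 0] flag_adj_closed[OF assms, of 2] by auto
  then have fl': "(v', e, f') \<in> flags P" by (simp add: flags_iff)
  have ne: "v' \<noteq> v" "f' \<noteq> f"
    using flag_adj_neq[OF assms, of 0] flag_adj_neq[OF assms, of 2] v' f' \<Phi> by auto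
  show ?thesis unfolding v' f' using flag_adj_0[OF fl(3) fl' ne(1)] flag_adj_2[OF fl(2) fl' ne(2)] by simp
qed

section \<open>Flag connectedness\<close>

lemma adj_closed_0:
  assumes "\<And>\<Psi>. \<Psi> \<in> S \<Longrightarrow> flag_adj P 0 \<Psi> \<in> S" "(v, e, f) \<in> S" "S \<subseteq> flags P" "(v', e, f) \<in> flags P"
  shows "(v', e, f) \<in> S"
  using assms flag_adj_0[of v e f v'] by (metis subsetD)

lemma adj_closed_1:
  assumes "\<And>\<Psi>. \<Psi> \<in> S \<Longrightarrow> flag_adj P 1 \<Psi> \<in> S" "(v, e, f) \<in> S" "S \<subseteq> flags P" "(v, e', f) \<in> flags P"
  shows "(v, e', f) \<in> S"
  using assms flag_adj_1[of v e f e'] by (metis subsetD)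

lemma adj_closed_2:
  assumes "\<And>\<Psi>. \<Psi> \<in> S \<Longrightarrow> flag_adj P 2 \<Psi> \<in> S" "(v, e, f) \<in> S" "S \<subseteq> flags P" "(v, e, f') \<in> flags P"
  shows "(v, e, f') \<in> S"
  using assms flag_adj_2[of v e f f'] by (metis subsetD)

lemma inc_connected_induct:
  assumes "inc_connected P S" "a \<in> S" "b \<in> S" "Q a"
    and "\<And>c d. c \<in> S \<Longrightarrow> d \<in> S \<Longrightarrow> incident P c d \<Longrightarrow> Q c \<Longrightarrow> Q d"
  shows "Q b"
proof -
  have "(a, b) \<in> {(a, b). a \<in> S \<and> b \<in> S \<and> incident P a b}\<^sup>*"
    using assms(1-3) by (simp add: inc_connected_def)
  then show ?thesis by (induction rule: rtrancl_induct) (use assms in auto)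
qed

lemma nbrs_connected: "a \<in> vertices P \<Longrightarrow> inc_connected P (nbrs P a)" "a \<in> faces P \<Longrightarrow> inc_connected P (nbrs P a)"
  using polyhedron unfolding polyhedron_def by blast+

lemma nbrs_iff: "b \<in> nbrs P a \<longleftrightarrow> incident P a b \<and> rank_of P a \<noteq> rank_of P b"
  using incident_rank_eq by (auto simp: nbrs_def)

text \<open>Connectedness of the neighbours of f carries along the property that all flags of f
  through a given neighbour belong to S.\<close>

lemma face_flags_induct:
  assumes S: "S \<subseteq> flags P" and start: "(v0, e0, f) \<in> S"
    and a0: "\<And>\<Psi>. \<Psi> \<in> S \<Longrightarrow> flag_adj P 0 \<Psi> \<in> S" and a1: "\<And>\<Psi>. \<Psi> \<in> S \<Longrightarrow> flag_adj P 1 \<Psi> \<in> S"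
    and \<Psi>: "(v, e, f) \<in> flags P"
  shows "(v, e, f) \<in> S"
proof -
  let ?Q = "\<lambda>z. \<forall>v e. (v, e, f) \<in> flags P \<and> (z = v \<or> z = e) \<longrightarrow> (v, e, f) \<in> S"
  have f: "f \<in> faces P" using \<Psi> by (simp add: flags_iff)
  have "?Q v"
  proof (rule inc_connected_induct[OF nbrs_connected(2)[OF f], where a = v0 and Q = ?Q])
    have "(v0, e0, f) \<in> flags P" using S start by blast
    then show "v0 \<in> nbrs P f" using incident_vef[of v0 e0 f]
      by (auto simp: nbrs_iff flags_iff of_rank_def incident_sym)
    show "v \<in> nbrs P f" using \<Psi> incident_vef[of v e f]
      by (auto simp: nbrs_iff flags_iff of_rank_def incident_sym)
    have "v0 \<notin> edges P" using \<open>(v0, e0, f) \<in> flags P\<close> by (auto simp: flags_iff of_rank_def)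
    then show "?Q v0" using adj_closed_1[OF a1 start S] by (auto simp: flags_iff)
  next
    fix c d assume cd: "c \<in> nbrs P f" "d \<in> nbrs P f" "incident P c d" "?Q c"
    then have "c \<in> vertices P \<or> c \<in> edges P" "d \<in> vertices P \<or> d \<in> edges P"
      using f rank_cases[of c] rank_cases[of d] by (auto simp: nbrs_iff of_rank_def incident_def)
    moreover have "c = d" if "rank_of P c = rank_of P d" using that cd incident_rank_eq by blast
    moreover have cf: "incident P c f" "incident P d f" using cd by (auto simp: nbrs_iff incident_sym)
    ultimately consider "c = d" | "c \<in> vertices P" "d \<in> edges P" | "c \<in> edges P" "d \<in> vertices P"
      by (auto simp: of_rank_def)
    then show "?Q d"
    proof cases
      case 1
      then show ?thesis using cd by blast
    next
      case 2
      then have "(c, d, f) \<in> flags P" using cd cf f by (simp add: flags_iff)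
      then have "(c, d, f) \<in> S" using cd by blast
      moreover have "d \<notin> vertices P" using 2 by (auto simp: of_rank_def)
      ultimately show ?thesis using adj_closed_0[OF a0 _ S] by (auto simp: flags_iff)
    next
      case 3
      then have "(d, c, f) \<in> flags P" using cd cf f by (simp add: flags_iff incident_sym)
      then have "(d, c, f) \<in> S" using cd by blast
      moreover have "d \<notin> edges P" using 3 by (auto simp: of_rank_def)
      ultimately show ?thesis using adj_closed_1[OF a1 _ S] by (auto simp: flags_iff)
    qed
  qed
  then show ?thesis using \<Psi> by blast
qed

lemma vertex_flags_induct:
  assumes S: "S \<subseteq> flags P" and start: "(v, e0, f0) \<in> S"
    and a1: "\<And>\<Psi>. \<Psi> \<in> S \<Longrightarrow> flag_adj P 1 \<Psi> \<in> S" and a2: "\<And>\<Psi>. \<Psi> \<in> S \<Longrightarrow> flag_adj P 2 \<Psi> \<in> S"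
    and \<Psi>: "(v, e, f) \<in> flags P"
  shows "(v, e, f) \<in> S"
proof -
  let ?Q = "\<lambda>z. \<forall>e f. (v, e, f) \<in> flags P \<and> (z = f \<or> z = e) \<longrightarrow> (v, e, f) \<in> S"
  have v: "v \<in> vertices P" using \<Psi> by (simp add: flags_iff)
  have "?Q f"
  proof (rule inc_connected_induct[OF nbrs_connected(1)[OF v], where a = f0 and Q = ?Q])
    have "(v, e0, f0) \<in> flags P" using S start by blast
    then show "f0 \<in> nbrs P v" using incident_vef[of v e0 f0]
      by (auto simp: nbrs_iff flags_iff of_rank_def)
    show "f \<in> nbrs P v" using \<Psi> incident_vef[of v e f]
      by (auto simp: nbrs_iff flags_iff of_rank_def)
    have "f0 \<notin> edges P" using \<open>(v, e0, f0) \<in> flags P\<close> by (auto simp: flags_iff of_rank_def)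
    then show "?Q f0" using adj_closed_1[OF a1 start S] by (auto simp: flags_iff)
  next
    fix c d assume cd: "c \<in> nbrs P v" "d \<in> nbrs P v" "incident P c d" "?Q c"
    then have "c \<in> faces P \<or> c \<in> edges P" "d \<in> faces P \<or> d \<in> edges P"
      using v rank_cases[of c] rank_cases[of d] by (auto simp: nbrs_iff of_rank_def incident_def)
    moreover have "c = d" if "rank_of P c = rank_of P d" using that cd incident_rank_eq by blast
    moreover have cf: "incident P v c" "incident P v d" using cd by (auto simp: nbrs_iff)
    ultimately consider "c = d" | "c \<in> faces P" "d \<in> edges P" | "c \<in> edges P" "d \<in> faces P"
      by (auto simp: of_rank_def)
    then show "?Q d"
    proof cases
      case 1
      then show ?thesis using cd by blast
    next
      case 2
      then have "(v, d, c) \<in> flags P" using cd cf v by (simp add: flags_iff incident_sym)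
      then have "(v, d, c) \<in> S" using cd by blast
      moreover have "d \<notin> faces P" using 2 by (auto simp: of_rank_def)
      ultimately show ?thesis using adj_closed_2[OF a2 _ S] by (auto simp: flags_iff)
    next
      case 3
      then have "(v, c, d) \<in> flags P" using cd cf v by (simp add: flags_iff)
      then have "(v, c, d) \<in> S" using cd by blast
      moreover have "d \<notin> edges P" using 3 by (auto simp: of_rank_def)
      ultimately show ?thesis using adj_closed_1[OF a1 _ S] by (auto simp: flags_iff)
    qed
  qed
  then show ?thesis using \<Psi> by blast
qed

lemma flag_of_edge:
  assumes "e \<in> edges P"
  shows "\<exists>v f. (v, e, f) \<in> flags P"
proof -
  have "{v \<in> vertices P. incident P v e} \<noteq> {}" "{f \<in> faces P. incident P e f} \<noteq> {}"
    using card_edge[OF assms] by (metis card.empty zero_neq_numeral)+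
  then show ?thesis using assms by (auto simp: flags_iff)
qed

lemma flag_of_vertex_edge:
  assumes "v \<in> vertices P" "e \<in> edges P" "incident P v e"
  shows "\<exists>f. (v, e, f) \<in> flags P"
  using flag_of_edge[OF assms(2)] assms by (auto simp: flags_iff)

lemma flag_of_edge_face:
  assumes "e \<in> edges P" "f \<in> faces P" "incident P e f"
  shows "\<exists>v. (v, e, f) \<in> flags P"
  using flag_of_edge[OF assms(1)] assms by (auto simp: flags_iff)

lemma flag_of_vertex_face:
  assumes "v \<in> vertices P" "f \<in> faces P" "incident P v f"
  shows "\<exists>e. (v, e, f) \<in> flags P"
proof -
  have "{e \<in> edges P. incident P v e \<and> incident P e f} \<noteq> {}"
    using card_vertex_face[OF assms] by (metis card.empty zero_neq_numeral)
  then show ?thesis using assms by (auto simp: flags_iff)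
qed

definition flag_set :: "'a flag \<Rightarrow> 'a set" where
  "flag_set \<Phi> = {fst \<Phi>, fst (snd \<Phi>), snd (snd \<Phi>)}"

lemma flag_set_simp [simp]: "flag_set (v, e, f) = {v, e, f}"
  by (simp add: flag_set_def)

lemma flag_of_incident:
  assumes "incident P a b" "a \<noteq> b"
  shows "\<exists>\<Phi> \<in> flags P. a \<in> flag_set \<Phi> \<and> b \<in> flag_set \<Phi>"
proof -
  have ordered: "\<exists>\<Phi> \<in> flags P. a \<in> flag_set \<Phi> \<and> b \<in> flag_set \<Phi>"
    if ab: "incident P a b" "rank_of P a < rank_of P b" for a b
  proof -
    have "a \<in> elems P" "b \<in> elems P" using ab by (auto simp: incident_def)
    then consider "a \<in> vertices P" "b \<in> edges P" | "a \<in> vertices P" "b \<in> faces P"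
      | "a \<in> edges P" "b \<in> faces P"
      using rank_cases[of a] rank_cases[of b] ab(2) by (auto simp: of_rank_def)
    then show ?thesis
    proof cases
      case 1
      then obtain f where "(a, b, f) \<in> flags P" using flag_of_vertex_edge ab(1) by blast
      then show ?thesis by (intro bexI[of _ "(a, b, f)"]) simp_all
    next
      case 2
      then obtain e where "(a, e, b) \<in> flags P" using flag_of_vertex_face ab(1) by blast
      then show ?thesis by (intro bexI[of _ "(a, e, b)"]) simp_all
    next
      case 3
      then obtain v where "(v, a, b) \<in> flags P" using flag_of_edge_face ab(1) by blast
      then show ?thesis by (intro bexI[of _ "(v, a, b)"]) simp_all
    qed
  qed
  have "rank_of P a \<noteq> rank_of P b" using assms incident_rank_eq by blast
  then consider "rank_of P a < rank_of P b" | "rank_of P b < rank_of P a" by linarith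
  then show ?thesis
  proof cases
    case 1
    then show ?thesis using ordered assms(1) by blast
  next
    case 2
    then show ?thesis using ordered[of b a] assms(1) incident_sym by blast
  qed
qed

lemma flag_of_elem:
  assumes "a \<in> elems P"
  shows "\<exists>\<Phi> \<in> flags P. a \<in> flag_set \<Phi>"
proof (cases "a \<in> edges P")
  case True
  then show ?thesis using flag_of_edge by force
next
  case False
  then have "a \<in> vertices P \<or> a \<in> faces P" using assms rank_cases by blast
  then have "inc_connected P (nbrs P a)" using nbrs_connected by blast
  then obtain b where "b \<in> nbrs P a" by (auto simp: inc_connected_def)
  then show ?thesis using flag_of_incident[of a b] by (auto simp: nbrs_def)
qed

text \<open>Flags with a common element are linked: at a vertex or a face by local connectedness, at
  an edge by exchanging vertex and face. Connectedness of the incidence graph then links any two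
  flags.\<close>

lemma flags_induct:
  assumes S: "S \<subseteq> flags P" and start: "\<Phi> \<in> S"
    and a0: "\<And>\<Psi>. \<Psi> \<in> S \<Longrightarrow> flag_adj P 0 \<Psi> \<in> S"
    and a1: "\<And>\<Psi>. \<Psi> \<in> S \<Longrightarrow> flag_adj P 1 \<Psi> \<in> S"
    and a2: "\<And>\<Psi>. \<Psi> \<in> S \<Longrightarrow> flag_adj P 2 \<Psi> \<in> S"
  shows "flags P = S"
proof
  let ?Q = "\<lambda>z. \<forall>\<Psi> \<in> flags P. z \<in> flag_set \<Psi> \<longrightarrow> \<Psi> \<in> S"
  have transfer: "?Q z" if \<Theta>: "\<Theta> \<in> S" "z \<in> flag_set \<Theta>" for z \<Theta>
  proof (intro ballI impI)
    fix \<Psi> assume \<Psi>: "\<Psi> \<in> flags P" "z \<in> flag_set \<Psi>"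
    obtain v e f v' e' f' where vef: "\<Theta> = (v, e, f)" "\<Psi> = (v', e', f')" by (cases \<Theta>; cases \<Psi>)
    have fl: "(v, e, f) \<in> flags P" "(v', e', f') \<in> flags P" using \<Theta> \<Psi> S vef by auto
    then have "(z = v \<and> z = v') \<or> (z = e \<and> z = e') \<or> (z = f \<and> z = f')"
      using \<Theta>(2) \<Psi>(2) vef by (auto simp: flags_iff of_rank_def)
    then show "\<Psi> \<in> S"
    proof (elim disjE conjE)
      assume "z = v" "z = v'"
      then show ?thesis using vertex_flags_induct[OF S _ a1 a2] \<Theta>(1) fl vef by metis
    next
      assume "z = f" "z = f'"
      then show ?thesis using face_flags_induct[OF S _ a0 a1] \<Theta>(1) fl vef by metis
    next
      assume z: "z = e" "z = e'"
      then have "(v', e, f) \<in> flags P" using fl by (simp add: flags_iff)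
      then have "(v', e, f) \<in> S" using adj_closed_0[OF a0 _ S] \<Theta>(1) vef by blast
      then show ?thesis using adj_closed_2[OF a2 _ S] fl vef z by blast
    qed
  qed
  have conn: "inc_connected P (elems P)" using polyhedron by (simp add: polyhedron_def)
  have in_elems: "flag_set \<Psi> \<subseteq> elems P" if "\<Psi> \<in> flags P" for \<Psi>
    using that by (cases \<Psi>) (auto simp: flags_iff of_rank_def)
  have fst: "fst \<Psi> \<in> flag_set \<Psi>" for \<Psi> :: "'a flag" by (simp add: flag_set_def)
  show "flags P \<subseteq> S"
  proof
    fix \<Psi> assume \<Psi>: "\<Psi> \<in> flags P"
    have "?Q (fst \<Psi>)"
    proof (rule inc_connected_induct[OF conn, where a = "fst \<Phi>" and Q = ?Q])
      show "fst \<Phi> \<in> elems P" "fst \<Psi> \<in> elems P" using in_elems fst S start \<Psi> by blast+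
      show "?Q (fst \<Phi>)" using transfer[OF start fst] .
      fix c d assume "incident P c d" "?Q c"
      then show "?Q d" using flag_of_incident[of c d] transfer by (cases "c = d") blast+
    qed
    then show "\<Psi> \<in> S" using \<Psi> fst by blast
  qed
qed (rule S)

end

section \<open>Automorphisms and flags\<close>

context polyh
begin

lemma flag_elem_simps [simp]:
  "flag_elem (v, e, f) 0 = v" "flag_elem (v, e, f) 1 = e" "flag_elem (v, e, f) (Suc 0) = e" "flag_elem (v, e, f) 2 = f"
  by (simp_all add: flag_elem_def)

lemma flag_elem_rank:
  assumes "\<Phi> \<in> flags P" "j \<in> {0, 1, 2}"
  shows "flag_elem \<Phi> j \<in> elems P" "rank_of P (flag_elem \<Phi> j) = j"
  using assms by (cases \<Phi>; auto simp: flags_iff of_rank_def)+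

lemma flag_eqI:
  assumes "\<And>j. j \<in> {0, 1, 2} \<Longrightarrow> flag_elem \<Phi> j = flag_elem \<Psi> j"
  shows "\<Phi> = \<Psi>"
  using assms[of 0] assms[of 1] assms[of 2] by (cases \<Phi>; cases \<Psi>) simp

lemma flag_elem_flag_map: "j \<in> {0, 1, 2} \<Longrightarrow> flag_elem (flag_map \<gamma> \<Phi>) j = \<gamma> (flag_elem \<Phi> j)"
  by (cases \<Phi>) (auto simp: flag_map_def)

lemma flag_of_elem_rank:
  assumes "z \<in> elems P"
  shows "\<exists>\<Phi> \<in> flags P. flag_elem \<Phi> (rank_of P z) = z" "rank_of P z \<in> {0, 1, 2}"
proof -
  obtain \<Phi> where \<Phi>: "\<Phi> \<in> flags P" "z \<in> flag_set \<Phi>" using flag_of_elem[OF assms] by blast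
  then obtain j where "j \<in> {0, 1, 2}" "z = flag_elem \<Phi> j" by (cases \<Phi>) force
  then show "\<exists>\<Phi> \<in> flags P. flag_elem \<Phi> (rank_of P z) = z" "rank_of P z \<in> {0, 1, 2}"
    using \<Phi>(1) flag_elem_rank[OF \<Phi>(1)] by auto
qed

lemma flag_elem_adj:
  "\<Phi> \<in> flags P \<Longrightarrow> i \<in> {0, 1, 2} \<Longrightarrow> j \<in> {0, 1, 2} \<Longrightarrow> i \<noteq> j \<Longrightarrow>
    flag_elem (flag_adj P i \<Phi>) j = flag_elem \<Phi> j"
  using flag_adj_elem by metis

lemma local_flags_induct:
  assumes S: "S \<subseteq> flags P" and \<Psi>: "\<Psi> \<in> S"
    and adj: "\<And>\<Theta> i. \<Theta> \<in> S \<Longrightarrow> i \<in> {0, 1, 2} \<Longrightarrow> i \<noteq> j \<Longrightarrow> flag_adj P i \<Theta> \<in> S"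
    and \<Psi>': "\<Psi>' \<in> flags P" "flag_elem \<Psi>' j = flag_elem \<Psi> j" and j: "j \<in> {0, 1, 2}"
  shows "\<Psi>' \<in> S"
proof -
  obtain v e f where vef: "\<Psi> = (v, e, f)" by (cases \<Psi>)
  obtain v' e' f' where vef': "\<Psi>' = (v', e', f')" by (cases \<Psi>')
  consider "j = 0" | "j = 1" | "j = 2" using j by blast
  then show ?thesis
  proof cases
    case 1
    then have "v' = v" using \<Psi>' vef vef' by simp
    then show ?thesis
      using vertex_flags_induct[OF S, of v e f e' f'] adj \<Psi> \<Psi>' vef vef' 1 by auto
  next
    case 2
    then have "e' = e" using \<Psi>' vef vef' by simp
    moreover have "(v, e, f) \<in> flags P" using S \<Psi> vef by blast
    ultimately have fl: "(v', e, f) \<in> flags P" using \<Psi>' vef' by (simp add: flags_iff)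
    have "(v', e, f) \<in> S" by (rule adj_closed_0[OF _ _ S fl]) (use adj \<Psi> vef 2 in auto)
    then show ?thesis
      using adj_closed_2[OF _ _ S, of v' e f f'] adj \<Psi>' vef' 2 \<open>e' = e\<close> by auto
  next
    case 3
    then have "f' = f" using \<Psi>' vef vef' by simp
    then show ?thesis
      using face_flags_induct[OF S, of v e f v' e'] adj \<Psi> \<Psi>' vef vef' 3 by auto
  qed
qed

lemma flag_set_elem: "flag_set \<Phi> = flag_elem \<Phi> ` {0, 1, 2}"
  by (cases \<Phi>) auto

lemma flag_elem_ple:
  assumes "\<Phi> \<in> flags P" "i \<in> {0, 1, 2}" "j \<in> {0, 1, 2}" "i < j"
  shows "(flag_elem \<Phi> i, flag_elem \<Phi> j) \<in> ple P"
proof -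
  obtain v e f where \<Phi>: "\<Phi> = (v, e, f)" by (cases \<Phi>)
  then have fl: "v \<in> vertices P" "e \<in> edges P" "f \<in> faces P" "incident P v e" "incident P e f"
    using assms by (auto simp: flags_iff)
  have "(v, e) \<in> ple P" "(e, f) \<in> ple P" "(v, f) \<in> ple P"
    using fl incident_vef[of v e f] by (auto intro!: incident_ple simp: of_rank_def)
  then show ?thesis using assms \<Phi> by auto
qed

text \<open>A map of flags commuting with all adjacencies acts on the elements of the polyhedron.\<close>

definition elem_map :: "('a flag \<Rightarrow> 'a flag) \<Rightarrow> 'a \<Rightarrow> 'a" where
  "elem_map F = (\<lambda>z \<in> elems P. flag_elem (F (SOME \<Phi>. \<Phi> \<in> flags P \<and> flag_elem \<Phi> (rank_of P z) = z)) (rank_of P z))"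

text \<open>The choice of flag is immaterial: flags with the same element of rank j are joined by
  adjacencies of the other ranks, which F respects and which leave that element unchanged.\<close>

lemma elem_map:
  assumes closed: "\<And>\<Phi>. \<Phi> \<in> flags P \<Longrightarrow> F \<Phi> \<in> flags P"
    and comm: "\<And>\<Phi> i. \<Phi> \<in> flags P \<Longrightarrow> i \<in> {0, 1, 2} \<Longrightarrow> F (flag_adj P i \<Phi>) = flag_adj P i (F \<Phi>)"
    and \<Phi>: "\<Phi> \<in> flags P" and j: "j \<in> {0, 1, 2}"
  shows "elem_map F (flag_elem \<Phi> j) = flag_elem (F \<Phi>) j"
proof -
  let ?z = "flag_elem \<Phi> j"
  have z: "?z \<in> elems P" "rank_of P ?z = j" using flag_elem_rank[OF \<Phi> j] by simp_all
  define \<Psi> where "\<Psi> = (SOME \<Psi>. \<Psi> \<in> flags P \<and> flag_elem \<Psi> j = ?z)"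
  have \<Psi>: "\<Psi> \<in> flags P" "flag_elem \<Psi> j = ?z"
    using someI[of "\<lambda>\<Psi>. \<Psi> \<in> flags P \<and> flag_elem \<Psi> j = ?z" \<Phi>] \<Phi> by (auto simp: \<Psi>_def)
  let ?S = "{\<Theta> \<in> flags P. flag_elem (F \<Theta>) j = flag_elem (F \<Phi>) j}"
  have "\<Psi> \<in> ?S"
  proof (rule local_flags_induct[where \<Psi> = \<Phi> and j = j])
    show "flag_adj P i \<Theta> \<in> ?S" if "\<Theta> \<in> ?S" "i \<in> {0, 1, 2}" "i \<noteq> j" for \<Theta> i
    proof -
      have "flag_elem (flag_adj P i (F \<Theta>)) j = flag_elem (F \<Theta>) j"
        using that j closed flag_elem_adj by blast
      then show ?thesis using that comm flag_adj_closed by auto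
    qed
  qed (use \<Phi> \<Psi> j in auto)
  then show ?thesis using z by (simp add: elem_map_def \<Psi>_def)
qed

text \<open>The inverse G is part of the data, so bijectivity and preservation of order in both
  directions follow from the same facts applied to F and to G.\<close>

lemma ex_automorphism:
  assumes F: "\<And>\<Phi>. \<Phi> \<in> flags P \<Longrightarrow> F \<Phi> \<in> flags P"
    and Fc: "\<And>\<Phi> i. \<Phi> \<in> flags P \<Longrightarrow> i \<in> {0, 1, 2} \<Longrightarrow> F (flag_adj P i \<Phi>) = flag_adj P i (F \<Phi>)"
    and G: "\<And>\<Phi>. \<Phi> \<in> flags P \<Longrightarrow> G \<Phi> \<in> flags P"
    and Gc: "\<And>\<Phi> i. \<Phi> \<in> flags P \<Longrightarrow> i \<in> {0, 1, 2} \<Longrightarrow> G (flag_adj P i \<Phi>) = flag_adj P i (G \<Phi>)"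
    and FG: "\<And>\<Phi>. \<Phi> \<in> flags P \<Longrightarrow> F (G \<Phi>) = \<Phi>" and GF: "\<And>\<Phi>. \<Phi> \<in> flags P \<Longrightarrow> G (F \<Phi>) = \<Phi>"
  shows "\<exists>\<gamma> \<in> automorphisms P. \<forall>\<Phi> \<in> flags P. flag_map \<gamma> \<Phi> = F \<Phi>"
proof -
  have map: "elem_map H z \<in> elems P \<and> rank_of P (elem_map H z) = rank_of P z"
    if H: "\<And>\<Phi>. \<Phi> \<in> flags P \<Longrightarrow> H \<Phi> \<in> flags P"
      "\<And>\<Phi> i. \<Phi> \<in> flags P \<Longrightarrow> i \<in> {0, 1, 2} \<Longrightarrow> H (flag_adj P i \<Phi>) = flag_adj P i (H \<Phi>)"
      and z: "z \<in> elems P" for H z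
  proof -
    obtain \<Phi> where \<Phi>: "\<Phi> \<in> flags P" "flag_elem \<Phi> (rank_of P z) = z"
      using flag_of_elem_rank(1)[OF z] by blast
    then show ?thesis
      using elem_map[OF H \<Phi>(1) flag_of_elem_rank(2)[OF z]] flag_elem_rank[OF H(1)[OF \<Phi>(1)] flag_of_elem_rank(2)[OF z]]
      by simp
  qed
  have inv: "elem_map K (elem_map H z) = z"
    if H: "\<And>\<Phi>. \<Phi> \<in> flags P \<Longrightarrow> H \<Phi> \<in> flags P"
      "\<And>\<Phi> i. \<Phi> \<in> flags P \<Longrightarrow> i \<in> {0, 1, 2} \<Longrightarrow> H (flag_adj P i \<Phi>) = flag_adj P i (H \<Phi>)"
      and K: "\<And>\<Phi>. \<Phi> \<in> flags P \<Longrightarrow> K \<Phi> \<in> flags P"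
      "\<And>\<Phi> i. \<Phi> \<in> flags P \<Longrightarrow> i \<in> {0, 1, 2} \<Longrightarrow> K (flag_adj P i \<Phi>) = flag_adj P i (K \<Phi>)"
      and KH: "\<And>\<Phi>. \<Phi> \<in> flags P \<Longrightarrow> K (H \<Phi>) = \<Phi>" and z: "z \<in> elems P" for H K z
  proof -
    obtain \<Phi> where \<Phi>: "\<Phi> \<in> flags P" "flag_elem \<Phi> (rank_of P z) = z"
      using flag_of_elem_rank(1)[OF z] by blast
    note r = flag_of_elem_rank(2)[OF z]
    have "elem_map H z = flag_elem (H \<Phi>) (rank_of P z)" using elem_map[OF H \<Phi>(1) r] \<Phi>(2) by simp
    then have "elem_map K (elem_map H z) = flag_elem (K (H \<Phi>)) (rank_of P z)"
      using elem_map[OF K H(1)[OF \<Phi>(1)] r] by simp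
    then show ?thesis using KH \<Phi> by simp
  qed
  have ple: "(elem_map H a, elem_map H b) \<in> ple P"
    if H: "\<And>\<Phi>. \<Phi> \<in> flags P \<Longrightarrow> H \<Phi> \<in> flags P"
      "\<And>\<Phi> i. \<Phi> \<in> flags P \<Longrightarrow> i \<in> {0, 1, 2} \<Longrightarrow> H (flag_adj P i \<Phi>) = flag_adj P i (H \<Phi>)"
      and ab: "(a, b) \<in> ple P" for H a b
  proof (cases "a = b")
    case True
    then show ?thesis using ple_elems[OF ab] map[OF H] ple_refl by blast
  next
    case False
    then have "incident P a b" using ab ple_elems by (auto simp: incident_def)
    then obtain \<Phi> where \<Phi>: "\<Phi> \<in> flags P" "a \<in> flag_set \<Phi>" "b \<in> flag_set \<Phi>"
      using flag_of_incident False by blast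
    then obtain i j where ij: "i \<in> {0, 1, 2}" "j \<in> {0, 1, 2}" "a = flag_elem \<Phi> i" "b = flag_elem \<Phi> j"
      by (auto simp: flag_set_elem)
    then have "i < j" using ple_rank[OF ab False] flag_elem_rank[OF \<Phi>(1)] by simp
    then show ?thesis
      using flag_elem_ple[OF H(1)[OF \<Phi>(1)] ij(1,2)] elem_map[OF H \<Phi>(1)] ij by simp
  qed
  define \<gamma> where "\<gamma> = elem_map F"
  have "bij_betw \<gamma> (elems P) (elems P)"
    unfolding \<gamma>_def using map[OF F Fc] map[OF G Gc] inv[OF F Fc G Gc GF] inv[OF G Gc F Fc FG]
    by (intro bij_betw_byWitness[where f' = "elem_map G"]) auto
  then have "\<gamma> \<in> Bij (elems P)" by (simp add: Bij_def \<gamma>_def elem_map_def)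
  moreover have "(\<gamma> a, \<gamma> b) \<in> ple P \<longleftrightarrow> (a, b) \<in> ple P" if "a \<in> elems P" "b \<in> elems P" for a b
    using ple[OF F Fc, of a b] ple[OF G Gc, of "\<gamma> a" "\<gamma> b"] inv[OF F Fc G Gc GF] that
    by (auto simp: \<gamma>_def)
  moreover have "rank_of P (\<gamma> a) = rank_of P a" if "a \<in> elems P" for a
    using map[OF F Fc that] by (simp add: \<gamma>_def)
  ultimately have "\<gamma> \<in> automorphisms P" by (simp add: automorphisms_def)
  moreover have "flag_map \<gamma> \<Phi> = F \<Phi>" if "\<Phi> \<in> flags P" for \<Phi>
    using elem_map[OF F Fc that] by (intro flag_eqI) (simp add: flag_elem_flag_map \<gamma>_def)
  ultimately show ?thesis by blast
qed

lemma automorphism: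
  assumes "\<gamma> \<in> automorphisms P"
  shows aut_closed: "a \<in> elems P \<Longrightarrow> \<gamma> a \<in> elems P"
    and aut_inj: "a \<in> elems P \<Longrightarrow> b \<in> elems P \<Longrightarrow> \<gamma> a = \<gamma> b \<longleftrightarrow> a = b"
    and aut_rank: "a \<in> elems P \<Longrightarrow> rank_of P (\<gamma> a) = rank_of P a"
    and aut_ple: "a \<in> elems P \<Longrightarrow> b \<in> elems P \<Longrightarrow> (\<gamma> a, \<gamma> b) \<in> ple P \<longleftrightarrow> (a, b) \<in> ple P"
    and aut_ext: "\<gamma> \<in> extensional (elems P)"
  using assms by (auto simp: automorphisms_def Bij_def bij_betw_def dest: inj_onD)

lemma flag_map_closed:
  assumes "\<gamma> \<in> automorphisms P" "\<Phi> \<in> flags P"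
  shows "flag_map \<gamma> \<Phi> \<in> flags P"
proof -
  obtain v e f where \<Phi>: "\<Phi> = (v, e, f)" by (cases \<Phi>)
  then have "v \<in> elems P" "e \<in> elems P" "f \<in> elems P" using assms(2) by (auto simp: flags_iff of_rank_def)
  then show ?thesis
    using assms(2) automorphism[OF assms(1)]
    by (simp add: \<Phi> flag_map_def flags_iff of_rank_def incident_def)
qed

lemma flag_map_adj:
  assumes "\<gamma> \<in> automorphisms P" "\<Phi> \<in> flags P" "i \<in> {0, 1, 2}"
  shows "flag_map \<gamma> (flag_adj P i \<Phi>) = flag_adj P i (flag_map \<gamma> \<Phi>)"
proof (rule flag_adj_eqI[symmetric])
  fix j :: nat assume j: "j \<in> {0, 1, 2}"
  show "flag_elem (flag_map \<gamma> (flag_adj P i \<Phi>)) j \<noteq> flag_elem (flag_map \<gamma> \<Phi>) j \<longleftrightarrow> j = i"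
    using flag_adj_elem[OF assms(2,3) j] flag_elem_rank(1)[OF _ j] flag_adj_closed[OF assms(2,3)] assms
    by (simp add: flag_elem_flag_map[OF j] aut_inj)
qed (use assms flag_map_closed flag_adj_closed in auto)

text \<open>Agreement at one flag spreads along adjacencies to all flags, and every element occurs
  in a flag.\<close>

lemma aut_eqI:
  assumes \<gamma>: "\<gamma> \<in> automorphisms P" and \<delta>: "\<delta> \<in> automorphisms P"
    and \<Phi>: "\<Phi> \<in> flags P" "flag_map \<gamma> \<Phi> = flag_map \<delta> \<Phi>"
  shows "\<gamma> = \<delta>"
proof -
  have all: "flags P = {\<Psi> \<in> flags P. flag_map \<gamma> \<Psi> = flag_map \<delta> \<Psi>}"
    by (rule flags_induct[where \<Phi> = \<Phi>])
      (use \<Phi> in \<open>auto simp: flag_map_adj[OF \<gamma>] flag_map_adj[OF \<delta>] flag_adj_closed\<close>)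
  show ?thesis
  proof (rule extensionalityI[OF aut_ext[OF \<gamma>] aut_ext[OF \<delta>]])
    fix z assume z: "z \<in> elems P"
    then obtain \<Psi> where \<Psi>: "\<Psi> \<in> flags P" "flag_elem \<Psi> (rank_of P z) = z"
      using flag_of_elem_rank(1) by blast
    then have "flag_map \<gamma> \<Psi> = flag_map \<delta> \<Psi>" using all by blast
    then show "\<gamma> z = \<delta> z" using \<Psi>(2) flag_elem_flag_map[OF flag_of_elem_rank(2)[OF z]] by metis
  qed
qed

lemma aut_group_simps [simp]:
  "carrier (aut_group P) = automorphisms P"
  "\<gamma> \<otimes>\<^bsub>aut_group P\<^esub> \<delta> = compose (elems P) \<delta> \<gamma>"
  by (simp_all add: aut_group_def)

lemma flag_map_mult:
  assumes "\<Phi> \<in> flags P"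
  shows "flag_map (\<gamma> \<otimes>\<^bsub>aut_group P\<^esub> \<delta>) \<Phi> = flag_map \<delta> (flag_map \<gamma> \<Phi>)"
  using flag_elem_rank(1)[OF assms]
  by (intro flag_eqI) (simp add: flag_elem_flag_map compose_eq)

lemma flag_map_one: "\<Phi> \<in> flags P \<Longrightarrow> flag_map \<one>\<^bsub>aut_group P\<^esub> \<Phi> = \<Phi>"
  using flag_elem_rank(1) by (intro flag_eqI) (simp add: flag_elem_flag_map aut_group_def)

lemma sigmas:
  assumes \<Phi>: "\<Phi> \<in> flags P"
  shows sigma1_eqI: "\<gamma> \<in> automorphisms P \<Longrightarrow> flag_map \<gamma> \<Phi> = flag_adj P 0 (flag_adj P 1 \<Phi>) \<Longrightarrow> sigma1 P \<Phi> = \<gamma>"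
    and sigma2_eqI: "\<gamma> \<in> automorphisms P \<Longrightarrow> flag_map \<gamma> \<Phi> = flag_adj P 1 (flag_adj P 2 \<Phi>) \<Longrightarrow> sigma2 P \<Phi> = \<gamma>"
  unfolding sigma1_def sigma2_def using aut_eqI \<Phi> by (intro the_equality; simp)+

end

section \<open>Parametrizing flags by a group\<close>

text \<open>The flags in the rotation class of the base flag are \<open>\<phi> g False\<close>, those in the other
  class are \<open>\<phi> g True\<close>; the group acts by right multiplication on \<open>g\<close>.\<close>

locale flag_param = polyh P + tight_pair G x y p q
  for P :: "'a ranked_poset" and G :: "('g, 'b) monoid_scheme" (structure) and x y p q +
  fixes \<phi> :: "'g \<Rightarrow> bool \<Rightarrow> 'a flag"
  assumes flags_eq: "flags P = (\<lambda>(g, b). \<phi> g b) ` (carrier G \<times> UNIV)"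
    and \<phi>_inj: "g \<in> carrier G \<Longrightarrow> h \<in> carrier G \<Longrightarrow> \<phi> g b = \<phi> h c \<Longrightarrow> g = h \<and> b = c"
    and adj_0: "g \<in> carrier G \<Longrightarrow> flag_adj P 0 (\<phi> g b) = \<phi> ((if b then x else inv x) \<otimes> g) (\<not> b)"
    and adj_1: "g \<in> carrier G \<Longrightarrow> flag_adj P 1 (\<phi> g b) = \<phi> g (\<not> b)"
    and adj_2: "g \<in> carrier G \<Longrightarrow> flag_adj P 2 (\<phi> g b) = \<phi> ((if b then inv y else y) \<otimes> g) (\<not> b)"
begin

lemmas adj_simps = adj_0 adj_1 adj_1[unfolded One_nat_def] adj_2

lemma \<phi>_flag: "g \<in> carrier G \<Longrightarrow> \<phi> g b \<in> flags P"
  by (auto simp: flags_eq)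

lemma flag_cases:
  assumes "\<Phi> \<in> flags P"
  obtains g b where "g \<in> carrier G" "\<Phi> = \<phi> g b"
  using assms by (auto simp: flags_eq)

lemma ex_flag_map:
  assumes u: "u ` carrier G \<subseteq> carrier G"
  shows "\<exists>F. \<forall>g \<in> carrier G. \<forall>b. F (\<phi> g b) = \<phi> (u g) (t b)"
proof -
  define F where "F \<Phi> = (let (g, b) = (SOME (g, b). g \<in> carrier G \<and> \<Phi> = \<phi> g b) in \<phi> (u g) (t b))" for \<Phi>
  have "F (\<phi> g b) = \<phi> (u g) (t b)" if g: "g \<in> carrier G" for g b
  proof -
    have "(SOME (h, c). h \<in> carrier G \<and> \<phi> g b = \<phi> h c) = (g, b)"
    proof (rule some_equality)
      show "case (g, b) of (h, c) \<Rightarrow> h \<in> carrier G \<and> \<phi> g b = \<phi> h c" using g by simp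
      fix z assume "case z of (h, c) \<Rightarrow> h \<in> carrier G \<and> \<phi> g b = \<phi> h c"
      then show "z = (g, b)" using \<phi>_inj[OF g, of "fst z" b "snd z"] by (cases z) auto
    qed
    then show ?thesis by (simp add: F_def)
  qed
  then show ?thesis by blast
qed

text \<open>Adjacencies multiply the group coordinate on the left, so they commute with
  multiplication on the right.\<close>

lemma ex_right_mult:
  assumes h: "h \<in> carrier G"
  shows "\<exists>\<gamma> \<in> automorphisms P. \<forall>g \<in> carrier G. \<forall>b. flag_map \<gamma> (\<phi> g b) = \<phi> (g \<otimes> h) b"
proof -
  obtain F where F: "\<And>g b. g \<in> carrier G \<Longrightarrow> F (\<phi> g b) = \<phi> (g \<otimes> h) b"
    using ex_flag_map[of "\<lambda>g. g \<otimes> h" "\<lambda>b. b"] h by blast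
  obtain F' where F': "\<And>g b. g \<in> carrier G \<Longrightarrow> F' (\<phi> g b) = \<phi> (g \<otimes> inv h) b"
    using ex_flag_map[of "\<lambda>g. g \<otimes> inv h" "\<lambda>b. b"] h by blast
  have adj: "K (flag_adj P i \<Phi>) = flag_adj P i (K \<Phi>)"
    if K: "\<And>g b. g \<in> carrier G \<Longrightarrow> K (\<phi> g b) = \<phi> (g \<otimes> k) b" and k: "k \<in> carrier G"
      and \<Phi>: "\<Phi> \<in> flags P" and i: "i \<in> {0, 1, 2}" for K k \<Phi> i
  proof -
    obtain g b where g: "g \<in> carrier G" "\<Phi> = \<phi> g b" using \<Phi> by (rule flag_cases)
    have m: "K (\<phi> (w \<otimes> g) c) = \<phi> (w \<otimes> (g \<otimes> k)) c" if "w \<in> carrier G" for w c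
      using K[of "w \<otimes> g" c] that g k by (simp add: m_assoc)
    consider "i = 0" | "i = 1" | "i = 2" using i by blast
    then show ?thesis
      using g k m[of x] m[of "inv x"] m[of y] m[of "inv y"] by cases (simp_all add: adj_simps K)
  qed
  have "\<exists>\<gamma> \<in> automorphisms P. \<forall>\<Phi> \<in> flags P. flag_map \<gamma> \<Phi> = F \<Phi>"
  proof (rule ex_automorphism)
    show "F \<Phi> \<in> flags P" if "\<Phi> \<in> flags P" for \<Phi> using flag_cases[OF that] F \<phi>_flag h by (metis m_closed)
    show "F' \<Phi> \<in> flags P" if "\<Phi> \<in> flags P" for \<Phi> using flag_cases[OF that] F' \<phi>_flag h by (metis m_closed inv_closed)
    show "F (F' \<Phi>) = \<Phi>" if \<Phi>: "\<Phi> \<in> flags P" for \<Phi>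
    proof -
      obtain g b where g: "g \<in> carrier G" "\<Phi> = \<phi> g b" using \<Phi> by (rule flag_cases)
      then show ?thesis using h by (simp add: F F' m_assoc)
    qed
    show "F' (F \<Phi>) = \<Phi>" if \<Phi>: "\<Phi> \<in> flags P" for \<Phi>
    proof -
      obtain g b where g: "g \<in> carrier G" "\<Phi> = \<phi> g b" using \<Phi> by (rule flag_cases)
      then show ?thesis using h by (simp add: F F' m_assoc)
    qed
  qed (use adj[OF F h] adj[OF F' inv_closed[OF h]] in blast)+
  then obtain \<gamma> where \<gamma>: "\<gamma> \<in> automorphisms P" "\<forall>\<Phi> \<in> flags P. flag_map \<gamma> \<Phi> = F \<Phi>" by blast
  then have "\<forall>g \<in> carrier G. \<forall>b. flag_map \<gamma> (\<phi> g b) = \<phi> (g \<otimes> h) b" using F \<phi>_flag by simp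
  then show ?thesis using \<gamma>(1) by blast
qed

text \<open>\<open>mirror\<close> is now the graph of an involutory map u. The adjacency rules of
  the two flag classes differ by inverting x and y, which is exactly what u does, so applying u and
  changing the class is an automorphism.\<close>

lemma reflexible_reflection:
  assumes refl: "reflexible_mod {\<one>}"
  shows "\<exists>\<gamma> \<in> automorphisms P. flag_map \<gamma> (\<phi> \<one> False) = \<phi> \<one> True"
proof -
  define u where "u g = (THE h. mirror g h)" for g
  have unique: "h = h'" if "mirror g h" "mirror g h'" for g h h'
  proof -
    have "inv h \<otimes> h' = \<one>" using mirror_unique_mod[OF refl that] by simp
    moreover have "h \<in> carrier G" "h' \<in> carrier G" using that mirror_closed by auto
    ultimately show ?thesis by (metis inv_closed inv_equality inv_inv l_inv)
  qed
  then have u_eqI: "u g = h" if "mirror g h" for g h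
    unfolding u_def using that by (intro the_equality) blast+
  have u: "mirror g (u g)" if g: "g \<in> carrier G" for g
    using mirror_total[OF g] u_eqI by blast
  have u_closed: "u g \<in> carrier G" if "g \<in> carrier G" for g using u[OF that] mirror_closed by blast
  have uu: "u (u g) = g" if "g \<in> carrier G" for g using u_eqI[OF mirror_sym[OF u[OF that]]] .
  have u_mult: "u (w \<otimes> g) = w' \<otimes> u g" if "mirror w w'" "g \<in> carrier G" for w w' g
    using u_eqI mirror_mult[OF that(1) u[OF that(2)]] by blast
  have xy: "mirror x (inv x)" "mirror (inv x) x" "mirror y (inv y)" "mirror (inv y) y"
    using mirror_x_pow[of 1] mirror_x_pow[of "-1"] mirror_y_pow[of 1] mirror_y_pow[of "-1"]
    by (simp_all add: int_pow_neg)
  obtain F where F: "\<And>g b. g \<in> carrier G \<Longrightarrow> F (\<phi> g b) = \<phi> (u g) (\<not> b)"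
    using ex_flag_map[of u Not] u_closed by blast
  have closed: "F \<Phi> \<in> flags P" if \<Phi>: "\<Phi> \<in> flags P" for \<Phi>
    using flag_cases[OF \<Phi>] F \<phi>_flag u_closed by metis
  have adj: "F (flag_adj P i \<Phi>) = flag_adj P i (F \<Phi>)" if \<Phi>: "\<Phi> \<in> flags P" and i: "i \<in> {0, 1, 2}" for \<Phi> i
  proof -
    obtain g b where g: "g \<in> carrier G" "\<Phi> = \<phi> g b" using \<Phi> by (rule flag_cases)
    consider "i = 0" | "i = 1" | "i = 2" using i by blast
    then show ?thesis
      using g u_closed u_mult[OF xy(1)] u_mult[OF xy(2)] u_mult[OF xy(3)] u_mult[OF xy(4)]
      by cases (simp_all add: adj_simps F)
  qed
  have inv: "F (F \<Phi>) = \<Phi>" if \<Phi>: "\<Phi> \<in> flags P" for \<Phi>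
  proof -
    obtain g b where g: "g \<in> carrier G" "\<Phi> = \<phi> g b" using \<Phi> by (rule flag_cases)
    then show ?thesis using u_closed uu by (simp add: F)
  qed
  have "\<exists>\<gamma> \<in> automorphisms P. \<forall>\<Phi> \<in> flags P. flag_map \<gamma> \<Phi> = F \<Phi>"
    by (rule ex_automorphism[OF closed adj closed adj inv inv])
  then obtain \<gamma> where \<gamma>: "\<gamma> \<in> automorphisms P" "\<forall>\<Phi> \<in> flags P. flag_map \<gamma> \<Phi> = F \<Phi>" by blast
  have "F (\<phi> \<one> False) = \<phi> \<one> True" using F u_eqI[OF mirror_one] by simp
  then have "flag_map \<gamma> (\<phi> \<one> False) = \<phi> \<one> True" using \<gamma>(2) \<phi>_flag by simp
  then show ?thesis using \<gamma>(1) by blast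
qed

text \<open>A reflection carries a walk by x and y from the base flag to the walk by x^-1 and y^-1
  in the other class. A word with value \<one> closes up, so its image closes up too.\<close>

lemma reflection_reflexible:
  assumes \<gamma>: "\<gamma> \<in> automorphisms P" and swap: "flag_map \<gamma> (\<phi> \<one> False) = \<phi> \<one> True"
  shows "reflexible_mod {\<one>}"
proof -
  have x: "\<phi> (x \<otimes> g) False = flag_adj P 0 (flag_adj P 1 (\<phi> g False))"
    "\<phi> (inv x \<otimes> g) True = flag_adj P 0 (flag_adj P 1 (\<phi> g True))"
    "\<phi> (y \<otimes> g) False = flag_adj P 1 (flag_adj P 2 (\<phi> g False))"
    "\<phi> (inv y \<otimes> g) True = flag_adj P 1 (flag_adj P 2 (\<phi> g True))" if "g \<in> carrier G" for g
    using that by (simp_all add: adj_simps)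
  have "flag_map \<gamma> (\<phi> g False) = \<phi> h True" if "mirror g h" for g h
    using that
  proof (induction rule: mirror.induct)
    case (mirror_x g h)
    have "g \<in> carrier G" "h \<in> carrier G" using mirror_closed[OF mirror_x.hyps] by auto
    then show ?case using mirror_x.IH
      by (simp add: x(1,2) flag_map_adj[OF \<gamma>] flag_adj_closed \<phi>_flag)
  next
    case (mirror_y g h)
    have "g \<in> carrier G" "h \<in> carrier G" using mirror_closed[OF mirror_y.hyps] by auto
    then show ?case using mirror_y.IH
      by (simp add: x(3,4) flag_map_adj[OF \<gamma>] flag_adj_closed \<phi>_flag)
  qed (rule swap)
  then have "h = \<one>" if "mirror \<one> h" for h
    using that swap \<phi>_inj[of h \<one> True True] mirror_closed[OF that] by metis
  then show ?thesis by (simp add: reflexible_mod_def)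
qed

end

section \<open>From groups to chiral polyhedra\<close>

context flag_param
begin

lemma chiralI:
  assumes "\<not> reflexible_mod {\<one>}"
  shows "chiral P"
proof -
  have trans: "\<exists>\<gamma>\<in>automorphisms P. flag_map \<gamma> (\<phi> g b) = \<phi> h b" if gh: "g \<in> carrier G" "h \<in> carrier G" for g h b
  proof -
    have "inv g \<otimes> h \<in> carrier G" using gh by simp
    then obtain \<gamma> where "\<gamma> \<in> automorphisms P" "\<forall>k \<in> carrier G. \<forall>b. flag_map \<gamma> (\<phi> k b) = \<phi> (k \<otimes> (inv g \<otimes> h)) b"
      using ex_right_mult by blast
    then show ?thesis using gh by (intro bexI[of _ \<gamma>]) simp_all
  qed
  have "\<not> aut_transitive_on P (flags P)"
    using reflection_reflexible \<phi>_flag[OF one_closed] assms unfolding aut_transitive_on_def by blast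
  moreover have "\<exists>A B. A \<union> B = flags P \<and> A \<inter> B = {} \<and>
      (\<forall>\<Phi>\<in>flags P. \<forall>i\<in>{0, 1, 2}. \<Phi> \<in> A \<longleftrightarrow> flag_adj P i \<Phi> \<in> B) \<and>
      aut_transitive_on P A \<and> aut_transitive_on P B"
  proof (intro exI conjI)
    let ?C = "\<lambda>b. (\<lambda>g. \<phi> g b) ` carrier G"
    show "?C False \<union> ?C True = flags P"
    proof
      show "flags P \<subseteq> ?C False \<union> ?C True"
      proof
        fix \<Phi> assume "\<Phi> \<in> flags P"
        then obtain g b where "g \<in> carrier G" "\<Phi> = \<phi> g b" by (rule flag_cases)
        then show "\<Phi> \<in> ?C False \<union> ?C True" by (cases b) auto
      qed
    qed (use \<phi>_flag in auto)
    show "?C False \<inter> ?C True = {}" using \<phi>_inj by blast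
    have mem: "\<phi> g b \<in> ?C c \<longleftrightarrow> b = c" if "g \<in> carrier G" for g b c using \<phi>_inj that by blast
    show "\<forall>\<Phi>\<in>flags P. \<forall>i\<in>{0, 1, 2}. \<Phi> \<in> ?C False \<longleftrightarrow> flag_adj P i \<Phi> \<in> ?C True"
    proof (intro ballI)
      fix \<Phi> and i :: nat assume \<Phi>: "\<Phi> \<in> flags P" and i: "i \<in> {0, 1, 2}"
      obtain g b where g: "g \<in> carrier G" "\<Phi> = \<phi> g b" using \<Phi> by (rule flag_cases)
      have "\<exists>h \<in> carrier G. flag_adj P i \<Phi> = \<phi> h (\<not> b)"
        using i g by (auto simp: adj_simps)
      then obtain h where h: "h \<in> carrier G" "flag_adj P i \<Phi> = \<phi> h (\<not> b)" by blast
      show "\<Phi> \<in> ?C False \<longleftrightarrow> flag_adj P i \<Phi> \<in> ?C True"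
        unfolding g(2) h(2)[unfolded g(2)] mem[OF g(1)] mem[OF h(1)] by simp
    qed
    show "aut_transitive_on P (?C False)" "aut_transitive_on P (?C True)"
      using trans by (auto simp: aut_transitive_on_def)
  qed
  ultimately show ?thesis using polyhedron by (simp add: chiral_def)
qed

text \<open>Right multiplications compose in the order of the product of automorphisms. The
  factorization into powers of x and y keeps all images in the subgroup generated by the two
  distinguished rotations.\<close>

lemma hom_rotation_group:
  "\<exists>\<theta> \<in> hom G (rotation_group P (\<phi> \<one> False)).
    \<theta> x = sigma1 P (\<phi> \<one> False) \<and> \<theta> y = sigma2 P (\<phi> \<one> False)"
proof -
  let ?A = "aut_group P" and ?\<Phi> = "\<phi> \<one> False"
  interpret A: group ?A by (rule group_aut_group)
  have "\<forall>h \<in> carrier G. \<exists>\<gamma>. \<gamma> \<in> automorphisms P \<and> (\<forall>g \<in> carrier G. \<forall>b. flag_map \<gamma> (\<phi> g b) = \<phi> (g \<otimes> h) b)"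
    using ex_right_mult by blast
  then obtain \<theta> where \<theta>: "\<And>h. h \<in> carrier G \<Longrightarrow> \<theta> h \<in> automorphisms P"
    "\<And>g h b. g \<in> carrier G \<Longrightarrow> h \<in> carrier G \<Longrightarrow> flag_map (\<theta> h) (\<phi> g b) = \<phi> (g \<otimes> h) b"
    by (metis bchoice)
  have hom: "\<theta> \<in> hom G ?A"
  proof (rule homI)
    fix g h assume gh: "g \<in> carrier G" "h \<in> carrier G"
    have "flag_map (\<theta> g \<otimes>\<^bsub>?A\<^esub> \<theta> h) ?\<Phi> = flag_map (\<theta> (g \<otimes> h)) ?\<Phi>"
      using gh by (simp add: flag_map_mult \<phi>_flag \<theta> del: aut_group_simps(2))
    moreover have "\<theta> g \<otimes>\<^bsub>?A\<^esub> \<theta> h \<in> automorphisms P"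
      using A.m_closed[of "\<theta> g" "\<theta> h"] gh \<theta>(1) by simp
    ultimately show "\<theta> (g \<otimes> h) = \<theta> g \<otimes>\<^bsub>?A\<^esub> \<theta> h"
      using gh \<theta>(1) \<phi>_flag[OF one_closed] by (intro aut_eqI[symmetric]) auto
  qed (use \<theta> in simp)
  interpret \<theta>: group_hom G ?A \<theta> by unfold_locales (rule hom)
  have sx: "\<theta> x = sigma1 P ?\<Phi>" and sy: "\<theta> y = sigma2 P ?\<Phi>"
    using \<theta> \<phi>_flag by (auto intro!: sigma1_eqI[symmetric] sigma2_eqI[symmetric] simp: adj_simps)
  let ?D = "generate ?A {\<theta> x, \<theta> y}"
  have sub: "subgroup ?D ?A" using \<theta>(1) by (intro A.generate_is_subgroup) auto
  have gens: "\<theta> x \<in> ?D" "\<theta> y \<in> ?D" by (auto intro: generate.incl)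
  have car: "carrier (rotation_group P ?\<Phi>) = ?D"
    using \<theta>(1) by (simp add: rotation_group_def carrier_subgroup_generated sx[symmetric] sy[symmetric] Int_absorb1)
  have "\<theta> g \<in> ?D" if g: "g \<in> carrier G" for g
  proof -
    obtain i j :: int where "g = x [^] i \<otimes> y [^] j" using factor[OF g] by blast
    then have "\<theta> g = \<theta> x [^]\<^bsub>?A\<^esub> i \<otimes>\<^bsub>?A\<^esub> \<theta> y [^]\<^bsub>?A\<^esub> j" by (simp only: \<theta>.hom_mult \<theta>.hom_int_pow int_pow_closed x_in y_in)
    then show ?thesis
      using subgroup.m_closed[OF sub] A.subgroup_int_pow_closed[OF sub] gens by simp
  qed
  then have "\<theta> \<in> hom G (rotation_group P ?\<Phi>)"
    using hom car by (auto simp: hom_def rotation_group_def)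
  then show ?thesis using sx sy by blast
qed

end

section \<open>The rotation group of a tight chiral polyhedron\<close>

locale chiral_flag = polyh P for P :: "'a ranked_poset" +
  fixes \<Phi> :: "'a flag"
  assumes chiral: "chiral P" and base: "\<Phi> \<in> flags P"
begin

abbreviation "A \<equiv> aut_group P"
abbreviation "s1 \<equiv> sigma1 P \<Phi>"
abbreviation "s2 \<equiv> sigma2 P \<Phi>"
abbreviation "\<Phi>1 \<equiv> flag_adj P 1 \<Phi>"

sublocale A: group A by (rule group_aut_group)

lemma base1: "\<Phi>1 \<in> flags P" using base flag_adj_closed by simp

lemma aut_mult_closed: "g \<in> automorphisms P \<Longrightarrow> h \<in> automorphisms P \<Longrightarrow> g \<otimes>\<^bsub>A\<^esub> h \<in> automorphisms P"
  using A.m_closed[of g h] by simp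

lemma aut_inv_closed: "g \<in> automorphisms P \<Longrightarrow> inv\<^bsub>A\<^esub> g \<in> automorphisms P"
  using A.inv_closed[of g] by simp

lemma flag_map_inv:
  assumes "g \<in> automorphisms P" "\<Psi> \<in> flags P"
  shows "flag_map (inv\<^bsub>A\<^esub> g) (flag_map g \<Psi>) = \<Psi>" "flag_map g (flag_map (inv\<^bsub>A\<^esub> g) \<Psi>) = \<Psi>"
  using assms flag_map_mult[of \<Psi> g "inv\<^bsub>A\<^esub> g"] flag_map_mult[of \<Psi> "inv\<^bsub>A\<^esub> g" g] flag_map_one
  by (simp_all add: A.r_inv A.l_inv del: aut_group_simps(2))

text \<open>Two adjacencies lead back to the class of the starting flag, and the automorphism group
  is transitive on that class.\<close>

lemma rotations_exist:
  "\<exists>\<gamma> \<in> automorphisms P. flag_map \<gamma> \<Phi> = flag_adj P 0 (flag_adj P 1 \<Phi>)"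
  "\<exists>\<gamma> \<in> automorphisms P. flag_map \<gamma> \<Phi> = flag_adj P 1 (flag_adj P 2 \<Phi>)"
proof -
  obtain C D where CD: "C \<union> D = flags P" "C \<inter> D = {}"
      "\<And>\<Psi> i. \<Psi> \<in> flags P \<Longrightarrow> i \<in> {0, 1, 2} \<Longrightarrow> \<Psi> \<in> C \<longleftrightarrow> flag_adj P i \<Psi> \<in> D"
      "aut_transitive_on P C" "aut_transitive_on P D"
    using chiral unfolding chiral_def by blast
  have "\<exists>\<gamma> \<in> automorphisms P. flag_map \<gamma> \<Phi> = flag_adj P i (flag_adj P j \<Phi>)"
    if ij: "i \<in> {0, 1, 2}" "j \<in> {0, 1, 2}" for i j
  proof -
    have fl: "flag_adj P j \<Phi> \<in> flags P" "flag_adj P i (flag_adj P j \<Phi>) \<in> flags P"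
      using base ij flag_adj_closed by blast+
    have "\<Phi> \<in> C \<longleftrightarrow> flag_adj P i (flag_adj P j \<Phi>) \<in> C"
      using CD(1,2) CD(3)[OF base ij(2)] CD(3)[OF fl(1) ij(1)] fl by blast
    then have "\<Phi> \<in> C \<and> flag_adj P i (flag_adj P j \<Phi>) \<in> C \<or> \<Phi> \<in> D \<and> flag_adj P i (flag_adj P j \<Phi>) \<in> D"
      using CD(1) fl base by blast
    then show ?thesis using CD(4,5) unfolding aut_transitive_on_def by blast
  qed
  then show "\<exists>\<gamma> \<in> automorphisms P. flag_map \<gamma> \<Phi> = flag_adj P 0 (flag_adj P 1 \<Phi>)"
    "\<exists>\<gamma> \<in> automorphisms P. flag_map \<gamma> \<Phi> = flag_adj P 1 (flag_adj P 2 \<Phi>)" by simp_all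
qed

lemma s_aut: "s1 \<in> automorphisms P" "s2 \<in> automorphisms P"
  and s_base: "flag_map s1 \<Phi> = flag_adj P 0 \<Phi>1" "flag_map s2 \<Phi> = flag_adj P 1 (flag_adj P 2 \<Phi>)"
  using rotations_exist sigma1_eqI[OF base] sigma2_eqI[OF base] by blast+

lemma adj_base:
  "flag_adj P 0 \<Phi> = flag_map (inv\<^bsub>A\<^esub> s1) \<Phi>1" "flag_adj P 0 \<Phi>1 = flag_map s1 \<Phi>"
  "flag_adj P 2 \<Phi> = flag_map s2 \<Phi>1" "flag_adj P 2 \<Phi>1 = flag_map (inv\<^bsub>A\<^esub> s2) \<Phi>"
proof -
  have fl: "flag_adj P 0 \<Phi> \<in> flags P" "flag_adj P 2 \<Phi> \<in> flags P" "flag_adj P 2 \<Phi>1 \<in> flags P"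
    using base base1 flag_adj_closed by simp_all
  have "flag_map s1 (flag_adj P 0 \<Phi>) = \<Phi>1"
    using base base1 by (simp add: flag_map_adj s_aut s_base flag_adj_involution)
  then show "flag_adj P 0 \<Phi> = flag_map (inv\<^bsub>A\<^esub> s1) \<Phi>1"
    using flag_map_inv(1)[OF s_aut(1) fl(1)] by simp
  show "flag_adj P 0 \<Phi>1 = flag_map s1 \<Phi>" by (simp add: s_base)
  have "flag_map s2 \<Phi>1 = flag_adj P 1 (flag_map s2 \<Phi>)"
    using base by (intro flag_map_adj s_aut) simp_all
  then show s2: "flag_adj P 2 \<Phi> = flag_map s2 \<Phi>1"
    using fl flag_adj_involution[of "flag_adj P 2 \<Phi>" 1] by (simp add: s_base)
  have "flag_map s2 (flag_adj P 2 \<Phi>1) = flag_adj P 2 (flag_map s2 \<Phi>1)"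
    using base1 by (intro flag_map_adj s_aut) simp_all
  then have "flag_map s2 (flag_adj P 2 \<Phi>1) = \<Phi>"
    using base by (simp add: s2[symmetric] flag_adj_involution del: One_nat_def)
  then show "flag_adj P 2 \<Phi>1 = flag_map (inv\<^bsub>A\<^esub> s2) \<Phi>"
    using flag_map_inv(1)[OF s_aut(2) fl(3)] by simp
qed

definition \<psi> :: "('a \<Rightarrow> 'a) \<Rightarrow> bool \<Rightarrow> 'a flag" where
  "\<psi> g b = flag_map g (if b then \<Phi>1 else \<Phi>)"

lemma \<psi>_flag: "g \<in> automorphisms P \<Longrightarrow> \<psi> g b \<in> flags P"
  using base base1 flag_map_closed by (simp add: \<psi>_def)

lemma \<psi>_adj:
  assumes g: "g \<in> automorphisms P"
  shows "flag_adj P 0 (\<psi> g b) = \<psi> ((if b then s1 else inv\<^bsub>A\<^esub> s1) \<otimes>\<^bsub>A\<^esub> g) (\<not> b)"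
    "flag_adj P 1 (\<psi> g b) = \<psi> g (\<not> b)"
    "flag_adj P 2 (\<psi> g b) = \<psi> ((if b then inv\<^bsub>A\<^esub> s2 else s2) \<otimes>\<^bsub>A\<^esub> g) (\<not> b)"
  using base base1 g flag_adj_involution[of \<Phi> 1]
  by (simp_all add: \<psi>_def flag_map_adj[OF g, symmetric] adj_base flag_map_mult del: aut_group_simps(2) One_nat_def)

text \<open>Such an automorphism would merge the two classes, so all flags would form a single
  orbit.\<close>

lemma no_reflection:
  assumes \<delta>: "\<delta> \<in> automorphisms P"
  shows "flag_map \<delta> \<Phi> \<noteq> \<Phi>1"
proof
  assume d: "flag_map \<delta> \<Phi> = \<Phi>1"
  have \<psi>_True: "\<psi> g True = \<psi> (\<delta> \<otimes>\<^bsub>A\<^esub> g) False" for g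
    using base by (simp add: \<psi>_def flag_map_mult d del: aut_group_simps(2))
  let ?S = "(\<lambda>g. \<psi> g False) ` automorphisms P"
  have "flags P = ?S"
  proof (rule flags_induct)
    show "?S \<subseteq> flags P" using \<psi>_flag by auto
    have "flag_map \<one>\<^bsub>A\<^esub> \<Phi> = \<Phi>" using base by (rule flag_map_one)
    then show "\<Phi> \<in> ?S" using A.one_closed by (intro image_eqI[of _ _ "\<one>\<^bsub>A\<^esub>"]) (simp_all add: \<psi>_def)
    fix \<Psi> assume "\<Psi> \<in> ?S"
    then obtain g where g: "g \<in> automorphisms P" "\<Psi> = \<psi> g False" by blast
    show "flag_adj P 0 \<Psi> \<in> ?S" "flag_adj P 1 \<Psi> \<in> ?S" "flag_adj P 2 \<Psi> \<in> ?S"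
      unfolding g(2) \<psi>_adj[OF g(1)] using g(1) \<delta> s_aut
      by (simp_all only: \<psi>_True not_False_eq_True if_False, rule_tac[!] imageI)
        (auto intro!: aut_mult_closed aut_inv_closed simp del: aut_group_simps(2))
  qed
  moreover have "\<exists>\<gamma>\<in>automorphisms P. flag_map \<gamma> (\<psi> g False) = \<psi> h False"
    if gh: "g \<in> automorphisms P" "h \<in> automorphisms P" for g h
  proof (rule bexI)
    show "inv\<^bsub>A\<^esub> g \<otimes>\<^bsub>A\<^esub> h \<in> automorphisms P" using gh by (intro aut_mult_closed aut_inv_closed)
    show "flag_map (inv\<^bsub>A\<^esub> g \<otimes>\<^bsub>A\<^esub> h) (\<psi> g False) = \<psi> h False"
      using gh base \<psi>_flag flag_map_inv by (simp add: flag_map_mult \<psi>_def flag_map_closed del: aut_group_simps(2))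
  qed
  ultimately have "aut_transitive_on P (flags P)" by (auto simp: aut_transitive_on_def)
  then show False using chiral by (simp add: chiral_def)
qed

lemma \<psi>_inj:
  assumes gh: "g \<in> automorphisms P" "h \<in> automorphisms P" and eq: "\<psi> g b = \<psi> h c"
  shows "g = h \<and> b = c"
proof -
  have no: "\<psi> g False \<noteq> \<psi> h True" if "g \<in> automorphisms P" "h \<in> automorphisms P" for g h
  proof
    assume "\<psi> g False = \<psi> h True"
    then have "flag_map (inv\<^bsub>A\<^esub> h) (flag_map g \<Phi>) = \<Phi>1"
      using that base1 flag_map_inv by (simp add: \<psi>_def del: One_nat_def)
    then have "flag_map (g \<otimes>\<^bsub>A\<^esub> inv\<^bsub>A\<^esub> h) \<Phi> = \<Phi>1" using base by (simp only: flag_map_mult)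
    then show False using no_reflection that aut_mult_closed aut_inv_closed by blast
  qed
  have "b = c" using no[of g h] no[of h g] gh eq by (cases b; cases c) auto
  moreover have "g = h"
    using eq \<open>b = c\<close> gh base base1 by (intro aut_eqI[of g h "if b then \<Phi>1 else \<Phi>"]) (auto simp: \<psi>_def simp del: One_nat_def)
  ultimately show ?thesis by blast
qed

lemma card_\<psi>:
  assumes "D \<subseteq> automorphisms P"
  shows "card ((\<lambda>(g, b). \<psi> g b) ` (D \<times> UNIV)) = 2 * card D"
proof -
  have "inj_on (\<lambda>(g, b). \<psi> g b) (D \<times> UNIV)" 
  proof (rule inj_onI)
    fix z w assume zw: "z \<in> D \<times> UNIV" "w \<in> D \<times> UNIV" "(case z of (g, b) \<Rightarrow> \<psi> g b) = (case w of (g, b) \<Rightarrow> \<psi> g b)"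
    then have "fst z \<in> automorphisms P" "fst w \<in> automorphisms P" "\<psi> (fst z) (snd z) = \<psi> (fst w) (snd w)"
      using assms by (auto simp: case_prod_beta)
    then show "z = w" using \<psi>_inj by (simp add: prod_eq_iff)
  qed
  then show ?thesis by (simp add: card_image card_cartesian_product)
qed

lemma subgroup_stabilizer:
  assumes z: "z \<in> elems P"
  shows "subgroup {g \<in> automorphisms P. g z = z} A"
proof (rule A.subgroupI)
  show "{g \<in> automorphisms P. g z = z} \<noteq> {}"
    using A.one_closed z by (auto simp: aut_group_def)
  fix g assume g: "g \<in> {g \<in> automorphisms P. g z = z}"
  have "(g \<otimes>\<^bsub>A\<^esub> inv\<^bsub>A\<^esub> g) z = \<one>\<^bsub>A\<^esub> z" using g A.r_inv[of g] by simp
  then have "(inv\<^bsub>A\<^esub> g) z = z" using g z by (simp add: compose_eq) (simp add: aut_group_def)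
  then show "inv\<^bsub>A\<^esub> g \<in> {g \<in> automorphisms P. g z = z}" using g aut_inv_closed by simp
  fix h assume h: "h \<in> {g \<in> automorphisms P. g z = z}"
  then have "(g \<otimes>\<^bsub>A\<^esub> h) z = z" using g z by (simp add: compose_eq)
  then show "g \<otimes>\<^bsub>A\<^esub> h \<in> {g \<in> automorphisms P. g z = z}" using g h aut_mult_closed by simp
qed auto

end

context chiral_flag
begin

lemma \<psi>_one: "\<psi> \<one>\<^bsub>A\<^esub> False = \<Phi>"
  using base by (simp only: \<psi>_def flag_map_one if_False)

lemma \<psi>_image_adj:
  assumes D: "subgroup D A" and \<Psi>: "\<Psi> \<in> (\<lambda>(g, b). \<psi> g b) ` (D \<times> UNIV)"
  shows "s1 \<in> D \<Longrightarrow> flag_adj P 0 \<Psi> \<in> (\<lambda>(g, b). \<psi> g b) ` (D \<times> UNIV)"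
    "flag_adj P 1 \<Psi> \<in> (\<lambda>(g, b). \<psi> g b) ` (D \<times> UNIV)"
    "s2 \<in> D \<Longrightarrow> flag_adj P 2 \<Psi> \<in> (\<lambda>(g, b). \<psi> g b) ` (D \<times> UNIV)"
proof -
  obtain g b where g: "g \<in> D" "\<Psi> = \<psi> g b" using \<Psi> by auto
  have ga: "g \<in> automorphisms P" using subgroup.subset[OF D] g(1) by auto
  have I: "\<psi> h c \<in> (\<lambda>(g, b). \<psi> g b) ` (D \<times> UNIV)" if "h \<in> D" for h c
    using that by (intro image_eqI[of _ _ "(h, c)"]) simp_all
  have m: "w \<otimes>\<^bsub>A\<^esub> g \<in> D" if "w \<in> D" for w using subgroup.m_closed[OF D that g(1)] .
  show "flag_adj P 1 \<Psi> \<in> (\<lambda>(g, b). \<psi> g b) ` (D \<times> UNIV)"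
    unfolding g(2) \<psi>_adj[OF ga] by (rule I[OF g(1)])
  show "flag_adj P 0 \<Psi> \<in> (\<lambda>(g, b). \<psi> g b) ` (D \<times> UNIV)" if s: "s1 \<in> D"
    unfolding g(2) \<psi>_adj[OF ga] by (rule I, rule m) (use s subgroup.m_inv_closed[OF D s] in simp)
  show "flag_adj P 2 \<Psi> \<in> (\<lambda>(g, b). \<psi> g b) ` (D \<times> UNIV)" if s: "s2 \<in> D"
    unfolding g(2) \<psi>_adj[OF ga] by (rule I, rule m) (use s subgroup.m_inv_closed[OF D s] in simp)
qed

lemma \<psi>_image:
  assumes D: "subgroup D A"
  shows "(\<lambda>(g, b). \<psi> g b) ` (D \<times> UNIV) \<subseteq> flags P" "\<Phi> \<in> (\<lambda>(g, b). \<psi> g b) ` (D \<times> UNIV)"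
proof -
  show "(\<lambda>(g, b). \<psi> g b) ` (D \<times> UNIV) \<subseteq> flags P"
    using subgroup.subset[OF D] \<psi>_flag by auto
  show "\<Phi> \<in> (\<lambda>(g, b). \<psi> g b) ` (D \<times> UNIV)"
    using subgroup.one_closed[OF D] \<psi>_one by (intro image_eqI[of _ _ "(\<one>\<^bsub>A\<^esub>, False)"]) simp_all
qed

lemma \<psi>_elem_fixed:
  assumes g: "g \<in> automorphisms P" and j: "j \<in> {0, 2}" and fixed: "g (flag_elem \<Phi> j) = flag_elem \<Phi> j"
  shows "flag_elem (\<psi> g b) j = flag_elem \<Phi> j"
proof -
  have "flag_elem (flag_adj P 1 \<Phi>) j = flag_elem \<Phi> j" using base j by (intro flag_elem_adj) auto
  moreover have "j \<in> {0, 1, 2}" using j by auto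
  ultimately show ?thesis using fixed by (simp add: \<psi>_def flag_elem_flag_map del: One_nat_def)
qed

lemma s_fixes: "s1 (flag_elem \<Phi> 2) = flag_elem \<Phi> 2" "s2 (flag_elem \<Phi> 0) = flag_elem \<Phi> 0"
proof -
  have "flag_elem (flag_map s1 \<Phi>) 2 = flag_elem \<Phi> 2" "flag_elem (flag_map s2 \<Phi>) 0 = flag_elem \<Phi> 0"
    unfolding s_base using base base1 flag_adj_closed[OF base, of 2]
    by (simp_all add: flag_elem_adj del: One_nat_def)
  then show "s1 (flag_elem \<Phi> 2) = flag_elem \<Phi> 2" "s2 (flag_elem \<Phi> 0) = flag_elem \<Phi> 0"
    by (simp_all add: flag_elem_flag_map)
qed

text \<open>An incident vertex and face share two edges, and moving the base edge to the other one
  would be a reflection. Hence <\<open>s1\<close>> and <\<open>s2\<close>> meet trivially.\<close>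

lemma fixes_vertex_face:
  assumes g: "g \<in> automorphisms P" and "g (flag_elem \<Phi> 0) = flag_elem \<Phi> 0" "g (flag_elem \<Phi> 2) = flag_elem \<Phi> 2"
  shows "g = \<one>\<^bsub>A\<^esub>"
proof -
  obtain v e f where \<Phi>: "\<Phi> = (v, e, f)" by (cases \<Phi>)
  have "flag_elem (\<psi> g False) 0 = v" "flag_elem (\<psi> g False) 2 = f"
    using \<psi>_elem_fixed[OF g, of 0 False] \<psi>_elem_fixed[OF g, of 2 False] assms \<Phi> by auto
  then obtain e' where e': "\<psi> g False = (v, e', f)" by (cases "\<psi> g False") simp
  have "\<psi> g False = \<Phi>"
  proof (rule ccontr)
    assume "\<psi> g False \<noteq> \<Phi>"
    then have "flag_adj P 1 \<Phi> = \<psi> g False"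
      using flag_adj_1[of v e f e'] base \<psi>_flag[OF g, of False] e' \<Phi> by auto
    then show False using no_reflection[OF g] by (simp add: \<psi>_def)
  qed
  then show ?thesis using \<psi>_inj[OF g, of "\<one>\<^bsub>A\<^esub>" False False] \<psi>_one A.one_closed by simp
qed

lemma card_face_flags:
  assumes f: "f \<in> faces P" and fin: "finite {e \<in> edges P. incident P e f}"
  shows "card {\<Psi> \<in> flags P. flag_elem \<Psi> 2 = f} = 2 * card {e \<in> edges P. incident P e f}"
proof -
  let ?D = "SIGMA e:{e \<in> edges P. incident P e f}. {v \<in> vertices P. incident P v e}"
  have "bij_betw (\<lambda>(e, v). (v, e, f)) ?D {\<Psi> \<in> flags P. flag_elem \<Psi> 2 = f}"
    using f by (intro bij_betw_byWitness[where f' = "\<lambda>(v, e, f). (e, v)"]) (auto simp: flags_iff)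
  then have "card {\<Psi> \<in> flags P. flag_elem \<Psi> 2 = f} = card ?D" by (rule bij_betw_same_card[symmetric])
  also have "\<dots> = (\<Sum>e\<in>{e \<in> edges P. incident P e f}. card {v \<in> vertices P. incident P v e})"
    using fin card_edge(1) by (intro card_SigmaI) (auto intro: card_ge_0_finite)
  also have "\<dots> = (\<Sum>e\<in>{e \<in> edges P. incident P e f}. 2)" using card_edge(1) by (intro sum.cong) auto
  finally show ?thesis by simp
qed

lemma card_vertex_flags:
  assumes v: "v \<in> vertices P" and fin: "finite {e \<in> edges P. incident P v e}"
  shows "card {\<Psi> \<in> flags P. flag_elem \<Psi> 0 = v} = 2 * card {e \<in> edges P. incident P v e}"
proof -
  let ?D = "SIGMA e:{e \<in> edges P. incident P v e}. {f \<in> faces P. incident P e f}"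
  have "bij_betw (\<lambda>(e, f). (v, e, f)) ?D {\<Psi> \<in> flags P. flag_elem \<Psi> 0 = v}"
    using v by (intro bij_betw_byWitness[where f' = "\<lambda>(v, e, f). (e, f)"]) (auto simp: flags_iff)
  then have "card {\<Psi> \<in> flags P. flag_elem \<Psi> 0 = v} = card ?D" by (rule bij_betw_same_card[symmetric])
  also have "\<dots> = (\<Sum>e\<in>{e \<in> edges P. incident P v e}. card {f \<in> faces P. incident P e f})"
    using fin card_edge(2) by (intro card_SigmaI) (auto intro: card_ge_0_finite)
  also have "\<dots> = (\<Sum>e\<in>{e \<in> edges P. incident P v e}. 2)" using card_edge(2) by (intro sum.cong) auto
  finally show ?thesis by simp
qed

lemma generate_s:
  shows "subgroup (generate A {s1}) A" "subgroup (generate A {s2}) A"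
    "generate A {s1} \<subseteq> {g \<in> automorphisms P. g (flag_elem \<Phi> 2) = flag_elem \<Phi> 2}"
    "generate A {s2} \<subseteq> {g \<in> automorphisms P. g (flag_elem \<Phi> 0) = flag_elem \<Phi> 0}"
proof -
  show "subgroup (generate A {s1}) A" "subgroup (generate A {s2}) A"
    by (rule A.generate_is_subgroup; use s_aut in simp)+
  have stab: "subgroup {g \<in> automorphisms P. g (flag_elem \<Phi> 2) = flag_elem \<Phi> 2} A"
      "subgroup {g \<in> automorphisms P. g (flag_elem \<Phi> 0) = flag_elem \<Phi> 0} A"
    by (rule subgroup_stabilizer, rule flag_elem_rank(1)[OF base], simp)+
  show "generate A {s1} \<subseteq> {g \<in> automorphisms P. g (flag_elem \<Phi> 2) = flag_elem \<Phi> 2}"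
    by (rule A.generate_subgroup_incl[OF _ stab(1)]) (use s_aut s_fixes in blast)
  show "generate A {s2} \<subseteq> {g \<in> automorphisms P. g (flag_elem \<Phi> 0) = flag_elem \<Phi> 0}"
    by (rule A.generate_subgroup_incl[OF _ stab(2)]) (use s_aut s_fixes in blast)
qed

text \<open>The flags at the base face are reached from the base flag by 0- and 1-adjacencies, hence
  correspond to elements of <\<open>s1\<close>> with a class; counting the same flags by edges gives
  2 p. The base vertex is treated alike.\<close>

lemma ord_s:
  assumes "has_type P p q"
  shows "A.ord s1 = p" "A.ord s2 = q" "0 < p" "0 < q"
proof -
  obtain v e f where \<Phi>: "\<Phi> = (v, e, f)" by (cases \<Phi>)
  then have vef: "v \<in> vertices P" "e \<in> edges P" "f \<in> faces P" "incident P v e" "incident P e f"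
    using base by (auto simp: flags_iff)
  have pf: "finite {e \<in> edges P. incident P e f}" "card {e \<in> edges P. incident P e f} = p"
    and qf: "finite {e \<in> edges P. incident P v e}" "card {e \<in> edges P. incident P v e} = q"
    using assms vef by (auto simp: has_type_def)
  show "0 < p" "0 < q" using pf qf vef by (auto simp: card_gt_0_iff)
  let ?I = "\<lambda>D. (\<lambda>(g, b). \<psi> g b) ` (D \<times> UNIV)"
  have sub: "generate A {s1} \<subseteq> automorphisms P" "generate A {s2} \<subseteq> automorphisms P"
    using generate_s(3,4) by blast+
  have in1: "s1 \<in> generate A {s1}" and in2: "s2 \<in> generate A {s2}" by (auto intro: generate.incl)
  have "?I (generate A {s1}) = {\<Psi> \<in> flags P. flag_elem \<Psi> 2 = f}"
  proof (intro equalityI subsetI)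
    fix \<Psi> assume \<Psi>: "\<Psi> \<in> ?I (generate A {s1})"
    then obtain g b where g: "g \<in> generate A {s1}" "\<Psi> = \<psi> g b" by auto
    then have "flag_elem \<Psi> 2 = flag_elem \<Phi> 2" using generate_s(3) \<psi>_elem_fixed[of g 2 b] by auto
    then show "\<Psi> \<in> {\<Psi> \<in> flags P. flag_elem \<Psi> 2 = f}"
      using \<Psi> \<psi>_image(1)[OF generate_s(1)] \<Phi> by auto
  next
    fix \<Psi> assume \<Psi>: "\<Psi> \<in> {\<Psi> \<in> flags P. flag_elem \<Psi> 2 = f}"
    then obtain v' e' where v': "\<Psi> = (v', e', f)" by (cases \<Psi>) auto
    have start: "(v, e, f) \<in> ?I (generate A {s1})"
      unfolding \<Phi>[symmetric] by (rule \<psi>_image(2)[OF generate_s(1)])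
    show "\<Psi> \<in> ?I (generate A {s1})" unfolding v'
    proof (rule face_flags_induct[OF \<psi>_image(1)[OF generate_s(1)] start])
      show "(v', e', f) \<in> flags P" using \<Psi> v' by simp
    qed (use \<psi>_image_adj[OF generate_s(1)] in1 in blast)+
  qed
  then have "2 * card (generate A {s1}) = 2 * p"
    using card_\<psi>[OF sub(1)] card_face_flags[OF vef(3) pf(1)] pf(2) by simp
  then show "A.ord s1 = p" using s_aut A.generate_pow_card[of s1] by simp
  have "?I (generate A {s2}) = {\<Psi> \<in> flags P. flag_elem \<Psi> 0 = v}"
  proof (intro equalityI subsetI)
    fix \<Psi> assume \<Psi>: "\<Psi> \<in> ?I (generate A {s2})"
    then obtain g b where g: "g \<in> generate A {s2}" "\<Psi> = \<psi> g b" by auto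
    then have "flag_elem \<Psi> 0 = flag_elem \<Phi> 0" using generate_s(4) \<psi>_elem_fixed[of g 0 b] by auto
    then show "\<Psi> \<in> {\<Psi> \<in> flags P. flag_elem \<Psi> 0 = v}"
      using \<Psi> \<psi>_image(1)[OF generate_s(2)] \<Phi> by auto
  next
    fix \<Psi> assume \<Psi>: "\<Psi> \<in> {\<Psi> \<in> flags P. flag_elem \<Psi> 0 = v}"
    then obtain e' f' where v': "\<Psi> = (v, e', f')" by (cases \<Psi>) auto
    have start: "(v, e, f) \<in> ?I (generate A {s2})"
      unfolding \<Phi>[symmetric] by (rule \<psi>_image(2)[OF generate_s(2)])
    show "\<Psi> \<in> ?I (generate A {s2})" unfolding v'
    proof (rule vertex_flags_induct[OF \<psi>_image(1)[OF generate_s(2)] start])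
      show "(v, e', f') \<in> flags P" using \<Psi> v' by simp
    qed (use \<psi>_image_adj[OF generate_s(2)] in2 in blast)+
  qed
  then have "2 * card (generate A {s2}) = 2 * q"
    using card_\<psi>[OF sub(2)] card_vertex_flags[OF vef(1) qf(1)] qf(2) by simp
  then show "A.ord s2 = q" using s_aut A.generate_pow_card[of s2] by simp
qed

section \<open>The rotation group as an exact product of two cyclic groups\<close>

abbreviation "R \<equiv> rotation_group P \<Phi>"

lemma carrier_R: "carrier R = generate A {s1, s2}"
  using s_aut by (simp add: rotation_group_def carrier_subgroup_generated Int_absorb1)

lemma subgroup_R: "subgroup (carrier R) A"
  unfolding carrier_R using s_aut by (intro A.generate_is_subgroup) auto

lemma s_in_R: "s1 \<in> carrier R" "s2 \<in> carrier R"
  unfolding carrier_R by (auto intro: generate.incl)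

lemma R_simps:
  "\<one>\<^bsub>R\<^esub> = \<one>\<^bsub>A\<^esub>" "g \<otimes>\<^bsub>R\<^esub> h = g \<otimes>\<^bsub>A\<^esub> h" "g [^]\<^bsub>R\<^esub> (n::nat) = g [^]\<^bsub>A\<^esub> n"
  "g \<in> carrier R \<Longrightarrow> inv\<^bsub>R\<^esub> g = inv\<^bsub>A\<^esub> g" "g \<in> carrier R \<Longrightarrow> g [^]\<^bsub>R\<^esub> (i::int) = g [^]\<^bsub>A\<^esub> i"
  by (simp_all add: rotation_group_def pow_subgroup_generated A.int_pow_subgroup_generated del: aut_group_simps(2))

lemma flags_R: "flags P = (\<lambda>(g, b). \<psi> g b) ` (carrier R \<times> UNIV)"
proof (rule flags_induct)
  show "(\<lambda>(g, b). \<psi> g b) ` (carrier R \<times> UNIV) \<subseteq> flags P" "\<Phi> \<in> (\<lambda>(g, b). \<psi> g b) ` (carrier R \<times> UNIV)"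
    by (rule \<psi>_image[OF subgroup_R])+
  fix \<Psi> assume \<Psi>: "\<Psi> \<in> (\<lambda>(g, b). \<psi> g b) ` (carrier R \<times> UNIV)"
  show "flag_adj P 0 \<Psi> \<in> (\<lambda>(g, b). \<psi> g b) ` (carrier R \<times> UNIV)"
    by (rule \<psi>_image_adj(1)[OF subgroup_R \<Psi> s_in_R(1)])
  show "flag_adj P 1 \<Psi> \<in> (\<lambda>(g, b). \<psi> g b) ` (carrier R \<times> UNIV)"
    by (rule \<psi>_image_adj(2)[OF subgroup_R \<Psi>])
  show "flag_adj P 2 \<Psi> \<in> (\<lambda>(g, b). \<psi> g b) ` (carrier R \<times> UNIV)"
    by (rule \<psi>_image_adj(3)[OF subgroup_R \<Psi> s_in_R(2)])
qed

lemma s1_s2_invol: "s1 \<otimes>\<^bsub>A\<^esub> s2 \<otimes>\<^bsub>A\<^esub> (s1 \<otimes>\<^bsub>A\<^esub> s2) = \<one>\<^bsub>A\<^esub>"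
proof -
  let ?w = "s1 \<otimes>\<^bsub>A\<^esub> s2"
  have w: "?w \<in> automorphisms P" using s_aut by (intro aut_mult_closed)
  have fl: "flag_adj P 2 \<Phi> \<in> flags P" "flag_adj P 1 (flag_adj P 2 \<Phi>) \<in> flags P" "flag_adj P 0 \<Phi> \<in> flags P"
    using base flag_adj_closed by simp_all
  have "flag_map ?w \<Phi> = flag_map s2 (flag_adj P 0 \<Phi>1)" by (simp only: flag_map_mult[OF base] s_base)
  also have "\<dots> = flag_adj P 0 (flag_adj P 1 (flag_map s2 \<Phi>))"
    using base base1 s_aut by (simp only: flag_map_adj insertI1 insertI2)
  also have "\<dots> = flag_adj P 0 (flag_adj P 2 \<Phi>)" unfolding s_base using fl by (simp only: flag_adj_involution insertI1 insertI2)
  finally have wb: "flag_map ?w \<Phi> = flag_adj P 0 (flag_adj P 2 \<Phi>)" .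
  have "flag_map (?w \<otimes>\<^bsub>A\<^esub> ?w) \<Phi> = flag_map ?w (flag_adj P 0 (flag_adj P 2 \<Phi>))"
    unfolding flag_map_mult[OF base, of ?w ?w] wb ..
  also have "\<dots> = flag_adj P 0 (flag_adj P 2 (flag_map ?w \<Phi>))"
    using base fl w by (simp only: flag_map_adj insertI1 insertI2)
  also have "\<dots> = flag_adj P 0 (flag_adj P 2 (flag_adj P 2 (flag_adj P 0 \<Phi>)))"
    unfolding wb flag_adj_0_2_commute[OF base] ..
  also have "\<dots> = \<Phi>" using base fl by (simp only: flag_adj_involution insertI1 insertI2)
  finally have "flag_map (?w \<otimes>\<^bsub>A\<^esub> ?w) \<Phi> = flag_map \<one>\<^bsub>A\<^esub> \<Phi>" using base by (simp only: flag_map_one)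
  then show ?thesis using aut_eqI[OF aut_mult_closed[OF w w] _ base] A.one_closed by simp
qed

text \<open>Flags correspond to rotations together with a class, so tightness leaves exactly p q
  rotations. The products s1^i s2^j are p q distinct ones, because an element common to both factors
  fixes the base face and the base vertex.\<close>

lemma tight_pair_R:
  assumes type: "has_type P p q" and tight: "tight P"
  shows "tight_pair R s1 s2 p q"
proof -
  note ord = ord_s[OF type]
  have R_sub: "carrier R \<subseteq> automorphisms P" using subgroup.subset[OF subgroup_R] by simp
  have fin: "finite (flags P)" and card_flags: "card (flags P) = 2 * p * q"
  proof -
    \<comment> \<open>\<open>tight\<close> speaks of some type of P; the orders of the two rotations
      identify it with the given one.\<close>
    obtain p' q' where t: "has_type P p' q'" "finite (flags P)" "card (flags P) = 2 * p' * q'"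
      using tight by (auto simp: tight_def)
    have "p' = p" "q' = q"
      by (rule HOL.trans[OF HOL.sym[OF ord_s(1)[OF t(1)]] ord(1)], rule HOL.trans[OF HOL.sym[OF ord_s(2)[OF t(1)]] ord(2)])
    then show "finite (flags P)" "card (flags P) = 2 * p * q" using t by simp_all
  qed
  have card: "card (carrier R) = p * q"
    using card_\<psi>[OF R_sub] card_flags unfolding flags_R[symmetric] by simp
  interpret R: group R by (simp add: rotation_group_def)
  have s: "s1 \<in> carrier A" "s2 \<in> carrier A" using s_aut by simp_all
  let ?f = "\<lambda>(i::int, j::int). s1 [^]\<^bsub>R\<^esub> i \<otimes>\<^bsub>R\<^esub> s2 [^]\<^bsub>R\<^esub> j"
  let ?B = "{0..<int p} \<times> {0..<int q}"
  have inj: "inj_on ?f ?B"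
  proof (rule inj_onI, clarify)
    fix i j k l :: int
    assume b: "i \<in> {0..<int p}" "j \<in> {0..<int q}" "k \<in> {0..<int p}" "l \<in> {0..<int q}"
      and eq: "s1 [^]\<^bsub>R\<^esub> i \<otimes>\<^bsub>R\<^esub> s2 [^]\<^bsub>R\<^esub> j = s1 [^]\<^bsub>R\<^esub> k \<otimes>\<^bsub>R\<^esub> s2 [^]\<^bsub>R\<^esub> l"
    have "s1 [^]\<^bsub>A\<^esub> i \<otimes>\<^bsub>A\<^esub> s2 [^]\<^bsub>A\<^esub> j = s1 [^]\<^bsub>A\<^esub> k \<otimes>\<^bsub>A\<^esub> s2 [^]\<^bsub>A\<^esub> l"
      using eq unfolding R_simps(2) R_simps(5)[OF s_in_R(1)] R_simps(5)[OF s_in_R(2)] .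
    then have "s1 [^]\<^bsub>A\<^esub> (- k) \<otimes>\<^bsub>A\<^esub> (s1 [^]\<^bsub>A\<^esub> i \<otimes>\<^bsub>A\<^esub> s2 [^]\<^bsub>A\<^esub> j) \<otimes>\<^bsub>A\<^esub> s2 [^]\<^bsub>A\<^esub> (- j) =
        s1 [^]\<^bsub>A\<^esub> (- k) \<otimes>\<^bsub>A\<^esub> (s1 [^]\<^bsub>A\<^esub> k \<otimes>\<^bsub>A\<^esub> s2 [^]\<^bsub>A\<^esub> l) \<otimes>\<^bsub>A\<^esub> s2 [^]\<^bsub>A\<^esub> (- j)"
      by (simp only:)
    moreover have "s1 [^]\<^bsub>A\<^esub> (- k) \<otimes>\<^bsub>A\<^esub> (s1 [^]\<^bsub>A\<^esub> m \<otimes>\<^bsub>A\<^esub> s2 [^]\<^bsub>A\<^esub> n) \<otimes>\<^bsub>A\<^esub> s2 [^]\<^bsub>A\<^esub> (- j) =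
        s1 [^]\<^bsub>A\<^esub> (- k + m) \<otimes>\<^bsub>A\<^esub> s2 [^]\<^bsub>A\<^esub> (n + - j)" for m n :: int
      by (simp only: A.int_pow_mult s A.m_assoc A.int_pow_closed A.m_closed)
    ultimately have "s1 [^]\<^bsub>A\<^esub> (- k + i) \<otimes>\<^bsub>A\<^esub> s2 [^]\<^bsub>A\<^esub> (j + - j) = s1 [^]\<^bsub>A\<^esub> (- k + k) \<otimes>\<^bsub>A\<^esub> s2 [^]\<^bsub>A\<^esub> (l + - j)"
      by (simp only:)
    then have g: "s1 [^]\<^bsub>A\<^esub> (i - k) = s2 [^]\<^bsub>A\<^esub> (l - j)"
      using s by (simp del: aut_group_simps)
    let ?g = "s1 [^]\<^bsub>A\<^esub> (i - k)"
    have "?g \<in> generate A {s1}"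
      by (rule A.subgroup_int_pow_closed[OF generate_s(1)]) (rule generate.incl, simp)
    moreover have "?g \<in> generate A {s2}" unfolding g
      by (rule A.subgroup_int_pow_closed[OF generate_s(2)]) (rule generate.incl, simp)
    ultimately have one: "?g = \<one>\<^bsub>A\<^esub>" using generate_s(3,4) by (intro fixes_vertex_face) blast+
    then have one': "s2 [^]\<^bsub>A\<^esub> (l - j) = \<one>\<^bsub>A\<^esub>" unfolding g .
    have "int p dvd i - k" "int q dvd l - j"
      using A.int_pow_eq_id[OF s(1), of "i - k"] one A.int_pow_eq_id[OF s(2), of "l - j"] one' ord(1,2) by simp_all
    then show "i = k \<and> j = l" using b by (metis atLeastLessThan_iff mod_eq_dvd_iff mod_pos_pos_trivial)
  qed
  have sub: "?f ` ?B \<subseteq> carrier R" using s_in_R by (auto simp del: aut_group_simps)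
  have finR: "finite (carrier R)" using card ord(3,4) by (metis card_ge_0_finite nat_0_less_mult_iff)
  have "card (?f ` ?B) = card (carrier R)" using inj card by (simp add: card_image)
  then have img: "?f ` ?B = carrier R" using card_subset_eq[OF finR sub] by simp
  show ?thesis
  proof unfold_locales
    show "s1 \<in> carrier R" "s2 \<in> carrier R" by (fact s_in_R)+
    show "s1 \<otimes>\<^bsub>R\<^esub> s2 \<otimes>\<^bsub>R\<^esub> (s1 \<otimes>\<^bsub>R\<^esub> s2) = \<one>\<^bsub>R\<^esub>" unfolding R_simps by (rule s1_s2_invol)
    show "s1 [^]\<^bsub>R\<^esub> p = \<one>\<^bsub>R\<^esub>" "s2 [^]\<^bsub>R\<^esub> q = \<one>\<^bsub>R\<^esub>"
      unfolding R_simps using A.pow_ord_eq_1[OF s(1)] A.pow_ord_eq_1[OF s(2)] ord by simp_all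
    show "card (carrier R) = p * q" "0 < p" "0 < q" by (fact card, fact ord(3), fact ord(4))
    show "\<exists>(i::int) (j::int). g = s1 [^]\<^bsub>R\<^esub> i \<otimes>\<^bsub>R\<^esub> s2 [^]\<^bsub>R\<^esub> j" if "g \<in> carrier R" for g
      using that unfolding img[symmetric] by auto
  qed
qed

lemma flag_param_R:
  assumes "tight_pair R s1 s2 p q"
  shows "flag_param P R s1 s2 p q \<psi>"
proof -
  interpret T: tight_pair R s1 s2 p q by (fact assms)
  have aut: "g \<in> automorphisms P" if "g \<in> carrier R" for g using subgroup.subset[OF subgroup_R] that by auto
  show ?thesis
  proof unfold_locales
    show "flags P = (\<lambda>(g, b). \<psi> g b) ` (carrier R \<times> UNIV)" by (rule flags_R)
    show "g = h \<and> b = c" if "g \<in> carrier R" "h \<in> carrier R" "\<psi> g b = \<psi> h c" for g h b c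
      using \<psi>_inj[OF aut aut] that by blast
    fix g b assume g: "g \<in> carrier R"
    show "flag_adj P 0 (\<psi> g b) = \<psi> ((if b then s1 else inv\<^bsub>R\<^esub> s1) \<otimes>\<^bsub>R\<^esub> g) (\<not> b)"
      "flag_adj P 1 (\<psi> g b) = \<psi> g (\<not> b)"
      "flag_adj P 2 (\<psi> g b) = \<psi> ((if b then inv\<^bsub>R\<^esub> s2 else s2) \<otimes>\<^bsub>R\<^esub> g) (\<not> b)"
      unfolding R_simps(2) R_simps(4)[OF s_in_R(1)] R_simps(4)[OF s_in_R(2)] by (rule \<psi>_adj[OF aut[OF g]])+
  qed
qed

lemma nonreflexible_R:
  assumes "tight_pair R s1 s2 p q"
  shows "\<not> tight_pair.reflexible_mod R s1 s2 {\<one>\<^bsub>R\<^esub>}"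
proof
  interpret F: flag_param P R s1 s2 p q \<psi> by (rule flag_param_R[OF assms])
  assume "F.reflexible_mod {\<one>\<^bsub>R\<^esub>}"
  then obtain \<gamma> where "\<gamma> \<in> automorphisms P" "flag_map \<gamma> (\<psi> \<one>\<^bsub>R\<^esub> False) = \<psi> \<one>\<^bsub>R\<^esub> True"
    using F.reflexible_reflection by blast
  moreover have "\<psi> \<one>\<^bsub>R\<^esub> False = \<Phi>" "\<psi> \<one>\<^bsub>R\<^esub> True = \<Phi>1"
    unfolding R_simps(1) using \<psi>_one base1 by (simp_all only: \<psi>_def flag_map_one if_True)
  ultimately show False using no_reflection by simp
qed

end

section \<open>The coset polyhedron of a tight pair\<close>

lemma Min_class_eq_iff:
  fixes C :: "nat \<Rightarrow> nat set"
  assumes "\<And>g. g \<in> A \<Longrightarrow> g \<in> C g" "\<And>g. g \<in> A \<Longrightarrow> finite (C g)"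
    and "\<And>g h. g \<in> A \<Longrightarrow> h \<in> C g \<Longrightarrow> C h = C g" and "g \<in> A" "h \<in> A"
  shows "Min (C g) = Min (C h) \<longleftrightarrow> h \<in> C g"
proof
  assume eq: "Min (C g) = Min (C h)"
  have g: "Min (C g) \<in> C g"
    by (rule Min_in[OF assms(2)[OF assms(4)]]) (use assms(1)[OF assms(4)] in blast)
  have h: "Min (C h) \<in> C h"
    by (rule Min_in[OF assms(2)[OF assms(5)]]) (use assms(1)[OF assms(5)] in blast)
  have "C (Min (C g)) = C g" "C (Min (C h)) = C h"
    by (rule assms(3)[OF assms(4) g], rule assms(3)[OF assms(5) h])
  then have "C h = C g" unfolding eq by (rule HOL.trans[OF HOL.sym, rotated])
  then show "h \<in> C g" using assms(1)[OF assms(5)] by blast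
next
  assume "h \<in> C g"
  then have "C h = C g" by (rule assms(3)[OF assms(4)])
  then show "Min (C g) = Min (C h)" by (simp only:)
qed

text \<open>Vertices, edges and faces are the right cosets of \<open>\<langle>y\<rangle>\<close>, \<open>\<langle>x y\<rangle>\<close> and \<open>\<langle>x\<rangle>\<close>, each encoded by
  its least element; incidence is nonempty intersection, and every vertex meets every face.\<close>

locale coset_polyhedron = tight_pair H x y p q for H :: "nat monoid" (structure) and x y p q +
  assumes p2: "2 \<le> p" and q2: "2 \<le> q"
begin

text \<open>The residue modulo 3 is the rank, which keeps vertices, edges and faces apart within the
  natural numbers.\<close>

definition V :: "nat \<Rightarrow> nat" where "V g = 3 * Min (range (\<lambda>i::int. y [^] i \<otimes> g))"
definition E :: "nat \<Rightarrow> nat" where "E g = 3 * Min {g, x \<otimes> y \<otimes> g} + 1"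
definition F :: "nat \<Rightarrow> nat" where "F g = 3 * Min (range (\<lambda>i::int. x [^] i \<otimes> g)) + 2"

lemma V_eq_iff:
  assumes "g \<in> carrier H" "h \<in> carrier H"
  shows "V g = V h \<longleftrightarrow> (\<exists>i::int. h = y [^] i \<otimes> g)"
proof -
  let ?C = "\<lambda>g. range (\<lambda>i::int. y [^] i \<otimes> g)"
  have "Min (?C g) = Min (?C h) \<longleftrightarrow> h \<in> ?C g"
  proof (rule Min_class_eq_iff[of "carrier H"])
    show "g \<in> ?C g" if "g \<in> carrier H" for g using that by (intro range_eqI[of _ _ 0]) simp
    show "finite (?C g)" if "g \<in> carrier H" for g
      using that by (intro finite_subset[OF _ finite_carrier]) auto
    show "?C h = ?C g" if g: "g \<in> carrier H" and h: "h \<in> ?C g" for g h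
    proof -
      obtain i :: int where i: "h = y [^] i \<otimes> g" using h by blast
      have eq: "y [^] j \<otimes> h = y [^] (j + i) \<otimes> g" "y [^] j \<otimes> g = y [^] (j - i) \<otimes> h" for j :: int
        using g by (simp_all add: i int_pow_mult_left)
      show ?thesis
      proof (intro equalityI subsetI)
        fix a assume "a \<in> ?C h"
        then obtain j :: int where "a = y [^] j \<otimes> h" by (rule rangeE)
        then show "a \<in> ?C g" unfolding eq(1) by (rule range_eqI)
      next
        fix a assume "a \<in> ?C g"
        then obtain j :: int where "a = y [^] j \<otimes> g" by (rule rangeE)
        then show "a \<in> ?C h" unfolding eq(2)[of j] by (rule range_eqI)
      qed
    qed
  qed (use assms in auto)
  then show ?thesis by (auto simp: V_def)
qed

lemma F_eq_iff:
  assumes "g \<in> carrier H" "h \<in> carrier H"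
  shows "F g = F h \<longleftrightarrow> (\<exists>i::int. h = x [^] i \<otimes> g)"
proof -
  let ?C = "\<lambda>g. range (\<lambda>i::int. x [^] i \<otimes> g)"
  have "Min (?C g) = Min (?C h) \<longleftrightarrow> h \<in> ?C g"
  proof (rule Min_class_eq_iff[of "carrier H"])
    show "g \<in> ?C g" if "g \<in> carrier H" for g using that by (intro range_eqI[of _ _ 0]) simp
    show "finite (?C g)" if "g \<in> carrier H" for g
      using that by (intro finite_subset[OF _ finite_carrier]) auto
    show "?C h = ?C g" if g: "g \<in> carrier H" and h: "h \<in> ?C g" for g h
    proof -
      obtain i :: int where i: "h = x [^] i \<otimes> g" using h by blast
      have eq: "x [^] j \<otimes> h = x [^] (j + i) \<otimes> g" "x [^] j \<otimes> g = x [^] (j - i) \<otimes> h" for j :: int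
        using g by (simp_all add: i int_pow_mult_left)
      show ?thesis
      proof (intro equalityI subsetI)
        fix a assume "a \<in> ?C h"
        then obtain j :: int where "a = x [^] j \<otimes> h" by (rule rangeE)
        then show "a \<in> ?C g" unfolding eq(1) by (rule range_eqI)
      next
        fix a assume "a \<in> ?C g"
        then obtain j :: int where "a = x [^] j \<otimes> g" by (rule rangeE)
        then show "a \<in> ?C h" unfolding eq(2)[of j] by (rule range_eqI)
      qed
    qed
  qed (use assms in auto)
  then show ?thesis by (auto simp: F_def)
qed

lemma invol_left: "g \<in> carrier H \<Longrightarrow> x \<otimes> y \<otimes> (x \<otimes> y \<otimes> g) = g"
  using m_assoc[of "x \<otimes> y" "x \<otimes> y" g] invol by simp

lemma E_eq_iff:
  assumes "g \<in> carrier H" "h \<in> carrier H"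
  shows "E g = E h \<longleftrightarrow> h = g \<or> h = x \<otimes> y \<otimes> g"
proof -
  let ?C = "\<lambda>g. {g, x \<otimes> y \<otimes> g}"
  have "Min (?C g) = Min (?C h) \<longleftrightarrow> h \<in> ?C g"
    by (rule Min_class_eq_iff[of "carrier H"]) (use assms invol_left in auto)
  then show ?thesis by (simp add: E_def)
qed

lemma E_flip: "g \<in> carrier H \<Longrightarrow> E (x \<otimes> y \<otimes> g) = E g"
  using E_eq_iff[of g "x \<otimes> y \<otimes> g"] by simp

lemma V_pow: "g \<in> carrier H \<Longrightarrow> V (y [^] (i::int) \<otimes> g) = V g"
  using V_eq_iff[of g "y [^] i \<otimes> g"] by auto

lemma F_pow: "g \<in> carrier H \<Longrightarrow> F (x [^] (i::int) \<otimes> g) = F g"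
  using F_eq_iff[of g "x [^] i \<otimes> g"] by auto

lemma V_y: "g \<in> carrier H \<Longrightarrow> V (y \<otimes> g) = V g" "g \<in> carrier H \<Longrightarrow> V (inv y \<otimes> g) = V g"
  using V_pow[of g 1] V_pow[of g "-1"] by (simp_all add: int_pow_neg)

lemma F_x: "g \<in> carrier H \<Longrightarrow> F (x \<otimes> g) = F g" "g \<in> carrier H \<Longrightarrow> F (inv x \<otimes> g) = F g"
  using F_pow[of g 1] F_pow[of g "-1"] by (simp_all add: int_pow_neg)

lemma E_xy:
  assumes "g \<in> carrier H"
  shows "E (inv y \<otimes> (inv x \<otimes> g)) = E g" "E (x \<otimes> g) = E (inv y \<otimes> g)"
proof -
  have "x \<otimes> y \<otimes> g = inv y \<otimes> (inv x \<otimes> g)" using assms by (simp add: xy_eq m_assoc)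
  then show "E (inv y \<otimes> (inv x \<otimes> g)) = E g" using E_flip[OF assms] by simp
  have "x \<otimes> y \<otimes> (inv y \<otimes> g) = x \<otimes> g" using assms by (simp add: m_assoc)
  then show "E (x \<otimes> g) = E (inv y \<otimes> g)" using E_flip[of "inv y \<otimes> g"] assms by simp
qed

text \<open><x> and <y> meet trivially, so a vertex coset and a face coset have at most one element
  in common.\<close>

lemma VF_inj:
  assumes gh: "g \<in> carrier H" "h \<in> carrier H" and "V g = V h" "F g = F h"
  shows "g = h"
proof -
  obtain i :: int where i: "h = y [^] i \<otimes> g" using assms V_eq_iff by blast
  obtain j :: int where j: "h = x [^] j \<otimes> g" using assms F_eq_iff by blast
  have "x [^] j = y [^] i" using i j gh by (metis right_cancel int_pow_closed x_in y_in)
  then have "x [^] j \<otimes> y [^] (0::int) = x [^] (0::int) \<otimes> y [^] i" by simp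
  then have "int p dvd j" by (simp only: xy_pow_eq_iff) simp
  then have "x [^] j = \<one>" by (simp add: x_pow_eq_one_iff)
  then show ?thesis using j gh by simp
qed

lemma VF_common:
  assumes "g \<in> carrier H" "h \<in> carrier H"
  shows "\<exists>u \<in> carrier H. V u = V g \<and> F u = F h"
proof -
  obtain i j :: int where ij: "g \<otimes> inv h = y [^] i \<otimes> x [^] j"
    using tight_pair.factor[OF swap, of "g \<otimes> inv h"] assms by blast
  have "y [^] (- i) \<otimes> g = y [^] (- i) \<otimes> (g \<otimes> inv h) \<otimes> h" using assms by (simp add: m_assoc)
  also have "\<dots> = x [^] j \<otimes> h" unfolding ij using assms by (simp add: m_assoc int_pow_mult_left)
  finally have eq: "y [^] (- i) \<otimes> g = x [^] j \<otimes> h" .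
  show ?thesis
  proof (rule bexI[of _ "x [^] j \<otimes> h"])
    show "V (x [^] j \<otimes> h) = V g \<and> F (x [^] j \<otimes> h) = F h"
      using assms V_pow[of g "- i"] F_pow[of h j] eq by simp
  qed (use assms in simp)
qed

lemma x_ne_y_pow: "x [^] (i::int) \<otimes> y [^] (j::int) = \<one> \<Longrightarrow> i \<noteq> 1 \<and> i \<noteq> -1 \<and> j \<noteq> 1 \<and> j \<noteq> -1"
  using p2 q2 zdvd_imp_le[of "int p" 1] zdvd_imp_le[of "int q" 1] by (auto simp: xy_pow_eq_one_iff)

text \<open>This is where p, q \<ge> 2 enters: x or its inverse times a power of y is then never
  trivial, and likewise with x and y exchanged, so the two ends, faces and edges are really
  two.\<close>

lemma distinct:
  assumes g: "g \<in> carrier H"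
  shows "V (x \<otimes> g) \<noteq> V g" "V (inv x \<otimes> g) \<noteq> V g" "F (y \<otimes> g) \<noteq> F g" "F (inv y \<otimes> g) \<noteq> F g"
    "E (inv y \<otimes> g) \<noteq> E g"
proof -
  have ne: "x [^] (s::int) \<otimes> y [^] (i::int) \<noteq> \<one>" "x [^] (i::int) \<otimes> y [^] (s::int) \<noteq> \<one>"
    if "s = 1 \<or> s = -1" for s i :: int using x_ne_y_pow that by blast+
  have V: "V (x [^] (s::int) \<otimes> g) \<noteq> V g" if s: "s = 1 \<or> s = -1" for s
  proof
    assume "V (x [^] s \<otimes> g) = V g"
    then obtain i :: int where "g = y [^] i \<otimes> (x [^] s \<otimes> g)" using V_eq_iff[of "x [^] s \<otimes> g" g] g by auto
    then have "\<one> \<otimes> g = y [^] i \<otimes> x [^] s \<otimes> g" using g by (simp add: m_assoc)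
    then have "\<one> = y [^] i \<otimes> x [^] s" using g by (simp only: right_cancel one_closed int_pow_closed m_closed x_in y_in)
    then have "y [^] (- i) \<otimes> \<one> = y [^] (- i) \<otimes> (y [^] i \<otimes> x [^] s)" by simp
    then have "y [^] (- i) = x [^] s" by (simp add: int_pow_mult_left)
    then have "x [^] s \<otimes> y [^] i = y [^] (- i) \<otimes> y [^] i" by simp
    then have "x [^] s \<otimes> y [^] i = \<one>" by (simp add: int_pow_neg)
    then show False using ne[OF s] by blast
  qed
  have F: "F (y [^] (s::int) \<otimes> g) \<noteq> F g" if s: "s = 1 \<or> s = -1" for s
  proof
    assume "F (y [^] s \<otimes> g) = F g"
    then obtain i :: int where "g = x [^] i \<otimes> (y [^] s \<otimes> g)" using F_eq_iff[of "y [^] s \<otimes> g" g] g by auto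
    then have "\<one> \<otimes> g = x [^] i \<otimes> y [^] s \<otimes> g" using g by (simp add: m_assoc)
    then have "\<one> = x [^] i \<otimes> y [^] s" using g by (simp only: right_cancel one_closed int_pow_closed m_closed x_in y_in)
    then show False using ne[OF s] by metis
  qed
  show "V (x \<otimes> g) \<noteq> V g" "V (inv x \<otimes> g) \<noteq> V g" "F (y \<otimes> g) \<noteq> F g" "F (inv y \<otimes> g) \<noteq> F g"
    using V[of 1] V[of "-1"] F[of 1] F[of "-1"] by (simp_all add: int_pow_neg)
  show "E (inv y \<otimes> g) \<noteq> E g"
  proof
    assume "E (inv y \<otimes> g) = E g"
    then have "g = inv y \<otimes> g \<or> g = x \<otimes> y \<otimes> (inv y \<otimes> g)" using E_eq_iff g by simp
    then have "g = inv y \<otimes> g \<or> g = x \<otimes> g" using g by (simp add: m_assoc)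
    then have "V (x \<otimes> g) = V g \<or> F (inv y \<otimes> g) = F g" by metis
    then show False using \<open>V (x \<otimes> g) \<noteq> V g\<close> \<open>F (inv y \<otimes> g) \<noteq> F g\<close> by blast
  qed
qed

definition Q :: "nat ranked_poset" where
  "Q = \<lparr>elems = V ` carrier H \<union> E ` carrier H \<union> F ` carrier H,
    ple = (\<lambda>g. (V g, E g)) ` carrier H \<union> (\<lambda>g. (E g, F g)) ` carrier H \<union>
      V ` carrier H \<times> F ` carrier H \<union> Id_on (V ` carrier H \<union> E ` carrier H \<union> F ` carrier H),
    rank_of = (\<lambda>n. n mod 3)\<rparr>"

lemma rank [simp]: "V g mod 3 = 0" "E g mod 3 = Suc 0" "F g mod 3 = 2"
  unfolding V_def E_def F_def by presburger+

lemma three_dvd [simp]: "3 dvd V g" "\<not> 3 dvd E g" "\<not> 3 dvd F g"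
  unfolding V_def E_def F_def by presburger+

lemma ne [simp]: "V g \<noteq> E h" "V g \<noteq> F h" "E g \<noteq> F h" "E g \<noteq> V h" "F g \<noteq> V h" "F g \<noteq> E h"
  by (metis rank zero_neq_one One_nat_def numeral_2_eq_2 n_not_Suc_n nat.distinct(1))+

lemma Q_sets: "vertices Q = V ` carrier H" "edges Q = E ` carrier H" "faces Q = F ` carrier H"
  "elems Q = V ` carrier H \<union> E ` carrier H \<union> F ` carrier H"
  by (auto simp: of_rank_def Q_def)

lemma incident_VE:
  "g \<in> carrier H \<Longrightarrow> h \<in> carrier H \<Longrightarrow> incident Q (V g) (E h) \<longleftrightarrow> (\<exists>u \<in> carrier H. V u = V g \<and> E u = E h)"
proof (intro iffI)
  assume gh: "g \<in> carrier H" "h \<in> carrier H" and "\<exists>u \<in> carrier H. V u = V g \<and> E u = E h"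
  then obtain u where u: "u \<in> carrier H" "V u = V g" "E u = E h" by blast
  have "(V u, E u) \<in> ple Q" using u(1) by (simp add: Q_def)
  then show "incident Q (V g) (E h)" using u gh by (simp add: incident_def Q_sets)
qed (auto simp: incident_def Q_def)

lemma incident_EF:
  "g \<in> carrier H \<Longrightarrow> h \<in> carrier H \<Longrightarrow> incident Q (E g) (F h) \<longleftrightarrow> (\<exists>u \<in> carrier H. E u = E g \<and> F u = F h)"
proof (intro iffI)
  assume gh: "g \<in> carrier H" "h \<in> carrier H" and "\<exists>u \<in> carrier H. E u = E g \<and> F u = F h"
  then obtain u where u: "u \<in> carrier H" "E u = E g" "F u = F h" by blast
  have "(E u, F u) \<in> ple Q" using u(1) by (simp add: Q_def)
  then show "incident Q (E g) (F h)" using u gh by (simp add: incident_def Q_sets)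
qed (auto simp: incident_def Q_def)

lemma incident_VF: "g \<in> carrier H \<Longrightarrow> h \<in> carrier H \<Longrightarrow> incident Q (V g) (F h)"
  by (auto simp: incident_def Q_def)

lemma incident_sym': "incident Q a b \<longleftrightarrow> incident Q b a"
  by (auto simp: incident_def)

lemma incident_VE': "g \<in> carrier H \<Longrightarrow> h \<in> carrier H \<Longrightarrow>
    incident Q (V g) (E h) \<longleftrightarrow> V g = V h \<or> V g = V (x \<otimes> y \<otimes> h)"
  unfolding incident_VE using E_eq_iff E_flip by (metis m_closed x_in y_in)

lemma incident_EF': "g \<in> carrier H \<Longrightarrow> h \<in> carrier H \<Longrightarrow>
    incident Q (E g) (F h) \<longleftrightarrow> F h = F g \<or> F h = F (x \<otimes> y \<otimes> g)"
  unfolding incident_EF using E_eq_iff E_flip by (metis m_closed x_in y_in)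

lemma flip_vertex: "g \<in> carrier H \<Longrightarrow> V (x \<otimes> y \<otimes> g) = V (inv x \<otimes> g)"
  using V_y(2)[of "inv x \<otimes> g"] by (simp add: xy_eq m_assoc)

lemma flip_face: "g \<in> carrier H \<Longrightarrow> F (x \<otimes> y \<otimes> g) = F (y \<otimes> g)"
  using F_x(1)[of "y \<otimes> g"] by (simp add: m_assoc)

text \<open>Choosing one of the two vertices and one of the two faces of the edge gives four
  combinations; they make g equal to h, x y h, y h or x^-1 h.\<close>

lemma edge_common:
  assumes g: "g \<in> carrier H" and h: "h \<in> carrier H"
  shows "incident Q (V g) (E h) \<and> incident Q (E h) (F g) \<longleftrightarrow> E h = E g \<or> E h = E (inv y \<otimes> g)"
proof
  assume inc: "incident Q (V g) (E h) \<and> incident Q (E h) (F g)"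
  have yg: "inv y \<otimes> g \<in> carrier H" using g by simp
  consider "V g = V h" "F g = F h" | "V g = V (x \<otimes> y \<otimes> h)" "F g = F (x \<otimes> y \<otimes> h)"
    | "V g = V h" "F g = F (y \<otimes> h)" | "V g = V (inv x \<otimes> h)" "F g = F h"
    using inc incident_VE'[OF g h] incident_EF'[OF h g] flip_vertex[OF h] flip_face[OF h] by auto
  then show "E h = E g \<or> E h = E (inv y \<otimes> g)"
  proof cases
    case 1
    then show ?thesis using VF_inj[OF g h] by simp
  next
    case 2
    then show ?thesis using VF_inj[OF g, of "x \<otimes> y \<otimes> h"] h E_flip[OF h] by simp
  next
    case 3
    then have "g = y \<otimes> h" using VF_inj[OF g, of "y \<otimes> h"] h V_y by simp
    then show ?thesis using h by simp
  next
    case 4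
    then have "g = inv x \<otimes> h" using VF_inj[OF g, of "inv x \<otimes> h"] h F_x by simp
    then show ?thesis using h E_xy(1)[OF h] by simp
  qed
next
  assume "E h = E g \<or> E h = E (inv y \<otimes> g)"
  moreover have "incident Q (V g) (E g) \<and> incident Q (E g) (F g)"
    using g incident_VE'[OF g g] incident_EF'[OF g g] by simp
  moreover have "incident Q (V g) (E (inv y \<otimes> g)) \<and> incident Q (E (inv y \<otimes> g)) (F g)"
    using g incident_VE'[of g "inv y \<otimes> g"] incident_EF'[of "inv y \<otimes> g" g] V_y(2)[OF g]
      flip_face[of "inv y \<otimes> g"] by simp
  ultimately show "incident Q (V g) (E h) \<and> incident Q (E h) (F g)" by auto
qed

lemma inc_connectedI:
  assumes "c \<in> S" "\<And>a. a \<in> S \<Longrightarrow> (c, a) \<in> {(a, b). a \<in> S \<and> b \<in> S \<and> incident Q a b}\<^sup>*"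
  shows "inc_connected Q S"
proof -
  let ?R = "{(a, b). a \<in> S \<and> b \<in> S \<and> incident Q a b}"
  have "sym ?R" by (intro symI) (simp add: incident_sym')
  then have "sym (?R\<^sup>*)" by (rule sym_rtrancl)
  then have "(a, c) \<in> ?R\<^sup>*" if "a \<in> S" for a by (rule symD[OF _ assms(2)[OF that]])
  then have "(a, b) \<in> ?R\<^sup>*" if "a \<in> S" "b \<in> S" for a b
    by (rule rtrancl_trans[OF _ assms(2)[OF that(2)]]) (rule that(1))
  then show ?thesis using assms(1) unfolding inc_connected_def by blast
qed

lemma y_pow_nat: "\<exists>n::nat. y [^] (i::int) = y [^] n"
proof -
  have "y [^] nat (i mod int q) = y [^] i"
    using q_pos by (simp add: int_pow_int [symmetric] y_pow_mod)
  then show ?thesis by (intro exI) (rule HOL.sym)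
qed

lemma x_pow_nat: "\<exists>n::nat. x [^] (i::int) = x [^] n"
proof -
  have "x [^] nat (i mod int p) = x [^] i"
    using p_pos by (simp add: int_pow_int [symmetric] x_pow_mod)
  then show ?thesis by (intro exI) (rule HOL.sym)
qed

lemma vertex_edges:
  assumes g: "g \<in> carrier H" and h: "h \<in> carrier H" and inc: "incident Q (V g) (E h)"
  shows "\<exists>i::int. E h = E (y [^] i \<otimes> g)"
proof -
  obtain u where u: "u \<in> carrier H" "V u = V g" "E u = E h" using inc incident_VE[OF g h] by blast
  then obtain i :: int where "u = y [^] i \<otimes> g" using V_eq_iff[OF g u(1)] by auto
  then have "E h = E (y [^] i \<otimes> g)" using u(3) by simp
  then show ?thesis by blast
qed

lemma face_edges:
  assumes g: "g \<in> carrier H" and h: "h \<in> carrier H" and inc: "incident Q (E h) (F g)"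
  shows "\<exists>i::int. E h = E (x [^] i \<otimes> g)"
proof -
  obtain u where u: "u \<in> carrier H" "F u = F g" "E u = E h" using inc incident_EF[OF h g] by blast
  then obtain i :: int where "u = x [^] i \<otimes> g" using F_eq_iff[OF g u(1)] by auto
  then have "E h = E (x [^] i \<otimes> g)" using u(3) by simp
  then show ?thesis by blast
qed

text \<open>Around a vertex the elements F (y^n g) and E (y^n g) alternate in a cycle; every face is
  among them since every coset of <x> meets the coset of the vertex.\<close>

lemma nbrs_V:
  assumes g: "g \<in> carrier H"
  shows "inc_connected Q (nbrs Q (V g))"
proof -
  let ?S = "nbrs Q (V g)"
  let ?R = "{(a, b). a \<in> ?S \<and> b \<in> ?S \<and> incident Q a b}"
  have yg: "y [^] n \<otimes> g \<in> carrier H" for n :: nat using g by simp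
  have Vn: "V (y [^] n \<otimes> g) = V g" for n :: nat using V_pow[OF g, of "int n"] by (simp add: int_pow_int)
  have E_S: "E (y [^] n \<otimes> g) \<in> ?S" for n :: nat
    using incident_VE'[OF g yg[of n]] Vn[of n] by (simp add: nbrs_def)
  have F_S: "F h \<in> ?S" if "h \<in> carrier H" for h using incident_VF[OF g that] by (simp add: nbrs_def)
  have step: "(F (y [^] n \<otimes> g), E (y [^] n \<otimes> g)) \<in> ?R" "(E (y [^] n \<otimes> g), F (y [^] Suc n \<otimes> g)) \<in> ?R" for n :: nat
  proof -
    have "incident Q (E (y [^] n \<otimes> g)) (F (y [^] n \<otimes> g))" using incident_EF'[OF yg yg] by simp
    then have "incident Q (F (y [^] n \<otimes> g)) (E (y [^] n \<otimes> g))" by (simp only: incident_sym'[of "F (y [^] n \<otimes> g)"])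
    then show "(F (y [^] n \<otimes> g), E (y [^] n \<otimes> g)) \<in> ?R" using E_S F_S yg by blast
    have "y [^] Suc n \<otimes> g = y \<otimes> (y [^] n \<otimes> g)" using g by (simp only: nat_pow_Suc2 y_in m_assoc nat_pow_closed)
    then have "incident Q (E (y [^] n \<otimes> g)) (F (y [^] Suc n \<otimes> g))"
      using incident_EF'[OF yg[of n] yg[of "Suc n"]] flip_face[OF yg[of n]] by simp
    then show "(E (y [^] n \<otimes> g), F (y [^] Suc n \<otimes> g)) \<in> ?R" using E_S F_S yg by blast
  qed
  have F_reach: "(F g, F (y [^] n \<otimes> g)) \<in> ?R\<^sup>*" for n :: nat
  proof (induction n)
    case (Suc n)
    then show ?case using step(1)[of n] step(2)[of n] by (meson rtrancl.rtrancl_into_rtrancl)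
  qed (use g in simp)
  then have E_reach: "(F g, E (y [^] n \<otimes> g)) \<in> ?R\<^sup>*" for n :: nat
    using step(1)[of n] by (meson rtrancl.rtrancl_into_rtrancl)
  show ?thesis
  proof (rule inc_connectedI[OF F_S[OF g]])
    fix a assume a: "a \<in> ?S"
    then have inc: "incident Q (V g) a" "a \<noteq> V g" by (simp_all add: nbrs_def)
    then have "a \<in> elems Q" by (simp add: incident_def)
    then consider h where "h \<in> carrier H" "a = V h" | h where "h \<in> carrier H" "a = E h"
      | h where "h \<in> carrier H" "a = F h" unfolding Q_sets by blast
    then show "(F g, a) \<in> ?R\<^sup>*"
    proof cases
      case 1
      then have False using inc by (auto simp: incident_def Q_def)
      then show ?thesis ..
    next
      case 2
      then obtain i :: int where "a = E (y [^] i \<otimes> g)" using vertex_edges[OF g] inc by blast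
      moreover obtain n :: nat where "y [^] i = y [^] n" using y_pow_nat by blast
      ultimately have "a = E (y [^] n \<otimes> g)" by simp
      then show ?thesis using E_reach[of n] by (simp only:)
    next
      case 3
      then obtain u where u: "u \<in> carrier H" "V u = V g" "F u = F h" using VF_common[OF g] by blast
      then obtain i :: int where "u = y [^] i \<otimes> g" using V_eq_iff[OF g u(1)] by auto
      moreover obtain n :: nat where "y [^] i = y [^] n" using y_pow_nat by blast
      ultimately have "a = F (y [^] n \<otimes> g)" using u 3 by simp
      then show ?thesis using F_reach[of n] by (simp only:)
    qed
  qed
qed

lemma nbrs_F:
  assumes g: "g \<in> carrier H"
  shows "inc_connected Q (nbrs Q (F g))"
proof -
  let ?S = "nbrs Q (F g)"
  let ?R = "{(a, b). a \<in> ?S \<and> b \<in> ?S \<and> incident Q a b}"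
  have xg: "x [^] n \<otimes> g \<in> carrier H" for n :: nat using g by simp
  have Fn: "F (x [^] n \<otimes> g) = F g" for n :: nat using F_pow[OF g, of "int n"] by (simp add: int_pow_int)
  have E_S: "E (x [^] n \<otimes> g) \<in> ?S" for n :: nat
    using incident_EF'[OF xg[of n] g] Fn[of n] by (simp add: nbrs_def incident_sym'[of "F g"])
  have V_S: "V h \<in> ?S" if "h \<in> carrier H" for h using incident_VF[OF that g] by (simp add: nbrs_def incident_sym'[of "F g"])
  have step: "(V (x [^] n \<otimes> g), E (x [^] n \<otimes> g)) \<in> ?R" "(V (x [^] n \<otimes> g), E (x [^] Suc n \<otimes> g)) \<in> ?R" for n :: nat
  proof -
    have "incident Q (V (x [^] n \<otimes> g)) (E (x [^] n \<otimes> g))" using incident_VE'[OF xg xg] by simp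
    then show "(V (x [^] n \<otimes> g), E (x [^] n \<otimes> g)) \<in> ?R" using E_S V_S xg by blast
    have "inv x \<otimes> (x [^] Suc n \<otimes> g) = x [^] n \<otimes> g"
    proof -
      have "x [^] Suc n \<otimes> g = x \<otimes> (x [^] n \<otimes> g)" using g by (simp only: nat_pow_Suc2 x_in m_assoc nat_pow_closed)
      then show ?thesis using xg[of n] by simp
    qed
    then have "incident Q (V (x [^] n \<otimes> g)) (E (x [^] Suc n \<otimes> g))"
      using incident_VE'[OF xg[of n] xg[of "Suc n"]] flip_vertex[OF xg[of "Suc n"]] by simp
    then show "(V (x [^] n \<otimes> g), E (x [^] Suc n \<otimes> g)) \<in> ?R" using E_S V_S xg by blast
  qed
  have step': "(E (x [^] n \<otimes> g), V (x [^] n \<otimes> g)) \<in> ?R" for n :: nat using step(1)[of n] incident_sym' by blast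
  have V_reach: "(V g, V (x [^] n \<otimes> g)) \<in> ?R\<^sup>*" for n :: nat
  proof (induction n)
    case (Suc n)
    then show ?case using step(2)[of n] step'[of "Suc n"] by (meson rtrancl.rtrancl_into_rtrancl)
  qed (use g in simp)
  then have E_reach: "(V g, E (x [^] n \<otimes> g)) \<in> ?R\<^sup>*" for n :: nat
    using step(1)[of n] by (meson rtrancl.rtrancl_into_rtrancl)
  show ?thesis
  proof (rule inc_connectedI[OF V_S[OF g]])
    fix a assume a: "a \<in> ?S"
    then have inc: "incident Q a (F g)" "a \<noteq> F g" by (simp_all add: nbrs_def incident_sym'[of "F g"])
    then have "a \<in> elems Q" by (simp add: incident_def)
    then consider h where "h \<in> carrier H" "a = F h" | h where "h \<in> carrier H" "a = E h"
      | h where "h \<in> carrier H" "a = V h" unfolding Q_sets by blast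
    then show "(V g, a) \<in> ?R\<^sup>*"
    proof cases
      case 1
      then have False using inc by (auto simp: incident_def Q_def)
      then show ?thesis ..
    next
      case 2
      then obtain i :: int where "a = E (x [^] i \<otimes> g)" using face_edges[OF g] inc by blast
      moreover obtain n :: nat where "x [^] i = x [^] n" using x_pow_nat by blast
      ultimately have "a = E (x [^] n \<otimes> g)" by simp
      then show ?thesis using E_reach[of n] by (simp only:)
    next
      case 3
      then obtain u where u: "u \<in> carrier H" "V u = V h" "F u = F g" using VF_common[OF 3(1) g] by blast
      then obtain i :: int where "u = x [^] i \<otimes> g" using F_eq_iff[OF g u(1)] by auto
      moreover obtain n :: nat where "x [^] i = x [^] n" using x_pow_nat by blast
      ultimately have "a = V (x [^] n \<otimes> g)" using u 3 by simp
      then show ?thesis using V_reach[of n] by (simp only:)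
    qed
  qed
qed

end

section \<open>Axioms, flags and type of the coset polyhedron\<close>

context coset_polyhedron
begin

lemmas Q_simps = Q_sets Q_sets(2)[unfolded One_nat_def]

lemma card_pair: "a \<noteq> b \<Longrightarrow> card {a, b} = 2"
  by simp

lemma polyhedron_Q: "polyhedron Q"
proof -
  have "partial_order_on (elems Q) (ple Q)"
    unfolding partial_order_on_def preorder_on_def
  proof (intro conjI)
    show "refl_on (elems Q) (ple Q)" by (auto simp: refl_on_def Q_def)
    show "trans (ple Q)" by (auto simp: trans_def Q_def)
    show "antisym (ple Q)" by (auto simp: antisym_def Q_def)
  qed (auto simp: Q_def)
  moreover have "rank_of Q z \<in> {0, 1, 2}" if "z \<in> elems Q" for z by (auto simp: Q_def)
  moreover have "rank_of Q a < rank_of Q b" if "(a, b) \<in> ple Q" "a \<noteq> b" for a b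
    using that by (auto simp: Q_def)
  moreover have "card {v \<in> vertices Q. incident Q v e} = 2 \<and> card {f \<in> faces Q. incident Q e f} = 2"
    if e: "e \<in> edges Q" for e
  proof -
    obtain g where g: "g \<in> carrier H" "e = E g" using e by (auto simp: Q_simps)
    have "{v \<in> vertices Q. incident Q v e} = {V (inv x \<otimes> g), V g}"
    proof (intro equalityI subsetI)
      fix v assume "v \<in> {v \<in> vertices Q. incident Q v e}"
      then obtain h where h: "h \<in> carrier H" "v = V h" "incident Q v e" by (auto simp: Q_simps)
      then show "v \<in> {V (inv x \<otimes> g), V g}"
        using incident_VE'[OF h(1) g(1)] flip_vertex[OF g(1)] g by auto
    next
      fix v assume v: "v \<in> {V (inv x \<otimes> g), V g}"
      then obtain h where h: "h \<in> carrier H" "v = V h" "h = inv x \<otimes> g \<or> h = g"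
        using g(1) m_closed[OF inv_closed[OF x_in] g(1)] by blast
      then have "incident Q v e"
        using incident_VE'[OF h(1) g(1)] flip_vertex[OF g(1)] g by auto
      then show "v \<in> {v \<in> vertices Q. incident Q v e}" using h by (simp add: Q_simps)
    qed
    moreover have "{f \<in> faces Q. incident Q e f} = {F (y \<otimes> g), F g}"
    proof (intro equalityI subsetI)
      fix f assume "f \<in> {f \<in> faces Q. incident Q e f}"
      then obtain h where h: "h \<in> carrier H" "f = F h" "incident Q e f" by (auto simp: Q_simps)
      then show "f \<in> {F (y \<otimes> g), F g}"
        using incident_EF'[OF g(1) h(1)] flip_face[OF g(1)] g by auto
    next
      fix f assume f: "f \<in> {F (y \<otimes> g), F g}"
      then obtain h where h: "h \<in> carrier H" "f = F h" "h = y \<otimes> g \<or> h = g"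
        using g(1) m_closed[OF y_in g(1)] by blast
      then have "incident Q e f"
        using incident_EF'[OF g(1) h(1)] flip_face[OF g(1)] g by auto
      then show "f \<in> {f \<in> faces Q. incident Q e f}" using h by (simp add: Q_simps)
    qed
    ultimately show ?thesis using distinct(2,3)[OF g(1)] card_pair by simp
  qed
  moreover have "card {e \<in> edges Q. incident Q v e \<and> incident Q e f} = 2"
    if vf: "v \<in> vertices Q" "f \<in> faces Q" for v f
  proof -
    obtain g h where gh: "g \<in> carrier H" "v = V g" "h \<in> carrier H" "f = F h" using vf by (auto simp: Q_simps)
    obtain u where u: "u \<in> carrier H" "v = V u" "f = F u" using VF_common[OF gh(1,3)] gh by auto
    have "{e \<in> edges Q. incident Q v e \<and> incident Q e f} = {E (inv y \<otimes> u), E u}"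
    proof (intro equalityI subsetI)
      fix e assume "e \<in> {e \<in> edges Q. incident Q v e \<and> incident Q e f}"
      then obtain w where w: "w \<in> carrier H" "e = E w" "incident Q v e \<and> incident Q e f" by (auto simp: Q_simps)
      then show "e \<in> {E (inv y \<otimes> u), E u}" using edge_common[OF u(1) w(1)] u by auto
    next
      fix e assume "e \<in> {E (inv y \<otimes> u), E u}"
      then obtain w where w: "w \<in> carrier H" "e = E w" "w = inv y \<otimes> u \<or> w = u"
        using u(1) m_closed[OF inv_closed[OF y_in] u(1)] by blast
      then have "incident Q v e \<and> incident Q e f" using edge_common[OF u(1) w(1)] u by auto
      then show "e \<in> {e \<in> edges Q. incident Q v e \<and> incident Q e f}" using w by (simp add: Q_simps)
    qed
    then show ?thesis using distinct(5)[OF u(1)] card_pair by simp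
  qed
  moreover have "inc_connected Q (elems Q)"
  proof (rule inc_connectedI)
    let ?R = "{(a, b). a \<in> elems Q \<and> b \<in> elems Q \<and> incident Q a b}"
    show "V \<one> \<in> elems Q" by (simp add: Q_simps)
    have VF: "(V g, F h) \<in> ?R" "(F h, V g) \<in> ?R" if "g \<in> carrier H" "h \<in> carrier H" for g h
      using incident_VF[OF that] incident_sym'[of "F h" "V g"] that by (auto simp: Q_simps)
    have VE: "(V g, E g) \<in> ?R" if "g \<in> carrier H" for g
      using incident_VE'[OF that that] that by (auto simp: Q_simps)
    have F: "(V \<one>, F h) \<in> ?R\<^sup>*" if "h \<in> carrier H" for h
      by (rule r_into_rtrancl, rule VF) (use that in auto)
    have V: "(V \<one>, V g) \<in> ?R\<^sup>*" if "g \<in> carrier H" for g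
      by (rule rtrancl_into_rtrancl[OF F[OF one_closed] VF(2)[OF that one_closed]])
    fix a assume "a \<in> elems Q"
    then consider g where "g \<in> carrier H" "a = V g" | g where "g \<in> carrier H" "a = E g"
      | g where "g \<in> carrier H" "a = F g" unfolding Q_sets by blast
    then show "(V \<one>, a) \<in> ?R\<^sup>*"
    proof cases
      case (2 g)
      then show ?thesis using rtrancl_into_rtrancl[OF V VE] by blast
    qed (use V F in blast)+
  qed
  moreover have "inc_connected Q (nbrs Q z)" if "z \<in> vertices Q \<union> faces Q" for z
    using that nbrs_V nbrs_F by (auto simp: Q_simps)
  ultimately show ?thesis unfolding polyhedron_def by blast
qed

sublocale Q: polyh Q by unfold_locales (rule polyhedron_Q)

text \<open>Vertex and face together determine g; the Boolean chooses between the two edges incident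
  to both.\<close>

definition \<phi> :: "nat \<Rightarrow> bool \<Rightarrow> nat flag" where
  "\<phi> g b = (V g, E (if b then inv y \<otimes> g else g), F g)"

lemma \<phi>_in_flags: "g \<in> carrier H \<Longrightarrow> \<phi> g b \<in> flags Q"
proof -
  assume g: "g \<in> carrier H"
  define h where "h = (if b then inv y \<otimes> g else g)"
  have h: "h \<in> carrier H" using g by (simp add: h_def)
  have "incident Q (V g) (E h) \<and> incident Q (E h) (F g)"
    unfolding edge_common[OF g h] by (simp add: h_def)
  then show ?thesis using g h unfolding \<phi>_def h_def[symmetric] Q.flags_iff by (simp add: Q_simps)
qed

lemma flag_param_Q: "flag_param Q H x y p q \<phi>"
proof unfold_locales
  show "flags Q = (\<lambda>(g, b). \<phi> g b) ` (carrier H \<times> UNIV)"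
  proof
    show "flags Q \<subseteq> (\<lambda>(g, b). \<phi> g b) ` (carrier H \<times> UNIV)"
    proof
      fix \<Phi> assume \<Phi>: "\<Phi> \<in> flags Q"
      obtain v e f where vef: "\<Phi> = (v, e, f)" by (cases \<Phi>)
      have fl: "(v, e, f) \<in> flags Q" using \<Phi> vef by simp
      then have "v \<in> V ` carrier H" "e \<in> E ` carrier H" "f \<in> F ` carrier H"
        unfolding Q.flags_iff Q_sets by blast+
      then obtain g w h where gh: "g \<in> carrier H" "v = V g" "h \<in> carrier H" "f = F h" "w \<in> carrier H" "e = E w"
        by (elim imageE)
      have inc: "incident Q v e \<and> incident Q e f" using fl unfolding Q.flags_iff by blast
      obtain u where u: "u \<in> carrier H" "v = V u" "f = F u" using VF_common[OF gh(1,3)] gh by auto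
      then have "E w = E u \<or> E w = E (inv y \<otimes> u)"
        using edge_common[OF u(1) gh(5)] inc gh by auto
      then have "\<Phi> = \<phi> u False \<or> \<Phi> = \<phi> u True" using vef u gh by (auto simp: \<phi>_def)
      then show "\<Phi> \<in> (\<lambda>(g, b). \<phi> g b) ` (carrier H \<times> UNIV)"
      proof
        assume "\<Phi> = \<phi> u False"
        then show ?thesis using u(1) by (intro image_eqI[of _ _ "(u, False)"]) simp_all
      next
        assume "\<Phi> = \<phi> u True"
        then show ?thesis using u(1) by (intro image_eqI[of _ _ "(u, True)"]) simp_all
      qed
    qed
  qed (use \<phi>_in_flags in auto)
  show "g = h \<and> b = c" if gh: "g \<in> carrier H" "h \<in> carrier H" and eq: "\<phi> g b = \<phi> h c" for g h b c
  proof -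
    have "g = h" using VF_inj[OF gh] eq by (simp add: \<phi>_def)
    then show ?thesis using eq distinct(5)[OF gh(1)] distinct(5)[OF gh(1), symmetric]
      by (cases b; cases c) (simp_all add: \<phi>_def)
  qed
  fix g b assume g: "g \<in> carrier H"
  have fl: "(V g, E (if b then inv y \<otimes> g else g), F g) \<in> flags Q" for b
    using \<phi>_in_flags[OF g, of b] by (simp add: \<phi>_def)
  show "flag_adj Q 0 (\<phi> g b) = \<phi> ((if b then x else inv x) \<otimes> g) (\<not> b)"
  proof (cases b)
    case True
    have eq: "\<phi> (x \<otimes> g) False = (V (x \<otimes> g), E (inv y \<otimes> g), F g)"
      using E_xy(2)[OF g] F_x(1)[OF g] by (simp add: \<phi>_def)
    then have "(V (x \<otimes> g), E (inv y \<otimes> g), F g) \<in> flags Q" using \<phi>_in_flags[of "x \<otimes> g" False] g by simp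
    then show ?thesis
      using Q.flag_adj_0[OF fl[of True, simplified] _ distinct(1)[OF g]] True eq by (simp add: \<phi>_def[of g])
  next
    case False
    have eq: "\<phi> (inv x \<otimes> g) True = (V (inv x \<otimes> g), E g, F g)"
      using E_xy(1)[OF g] F_x(2)[OF g] by (simp add: \<phi>_def)
    then have "(V (inv x \<otimes> g), E g, F g) \<in> flags Q" using \<phi>_in_flags[of "inv x \<otimes> g" True] g by simp
    then show ?thesis
      using Q.flag_adj_0[OF fl[of False, simplified] _ distinct(2)[OF g]] False eq by (simp add: \<phi>_def[of g])
  qed
  show "flag_adj Q 1 (\<phi> g b) = \<phi> g (\<not> b)"
    unfolding \<phi>_def
    by (rule Q.flag_adj_1[OF fl fl]) (use distinct(5)[OF g] distinct(5)[OF g, symmetric] in auto)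
  show "flag_adj Q 2 (\<phi> g b) = \<phi> ((if b then inv y else y) \<otimes> g) (\<not> b)"
  proof (cases b)
    case True
    have eq: "\<phi> (inv y \<otimes> g) False = (V g, E (inv y \<otimes> g), F (inv y \<otimes> g))"
      using V_y(2)[OF g] by (simp add: \<phi>_def)
    then have "(V g, E (inv y \<otimes> g), F (inv y \<otimes> g)) \<in> flags Q" using \<phi>_in_flags[of "inv y \<otimes> g" False] g by simp
    then show ?thesis
      using Q.flag_adj_2[OF fl[of True, simplified] _ distinct(4)[OF g]] True eq by (simp add: \<phi>_def[of g])
  next
    case False
    have eq: "\<phi> (y \<otimes> g) True = (V g, E g, F (y \<otimes> g))"
      using V_y(1)[OF g] g by (simp add: \<phi>_def)
    then have "(V g, E g, F (y \<otimes> g)) \<in> flags Q" using \<phi>_in_flags[of "y \<otimes> g" True] g by simp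
    then show ?thesis
      using Q.flag_adj_2[OF fl[of False, simplified] _ distinct(3)[OF g]] False eq by (simp add: \<phi>_def[of g])
  qed
qed

sublocale Q: flag_param Q H x y p q \<phi> by (rule flag_param_Q)

lemma has_type_Q: "has_type Q p q"
proof -
  have "finite {e \<in> edges Q. incident Q e f} \<and> card {e \<in> edges Q. incident Q e f} = p" if f: "f \<in> faces Q" for f
  proof -
    obtain g where g: "g \<in> carrier H" "f = F g" using f by (auto simp: Q_simps)
    have xg: "x [^] i \<otimes> g \<in> carrier H" for i :: int using g by simp
    have "{e \<in> edges Q. incident Q e f} = (\<lambda>i. E (x [^] i \<otimes> g)) ` {0..<int p}"
    proof (intro equalityI subsetI)
      fix e assume "e \<in> {e \<in> edges Q. incident Q e f}"
      then obtain w where w: "w \<in> carrier H" "e = E w" "incident Q (E w) (F g)" using g by (auto simp: Q_simps)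
      then obtain i :: int where "e = E (x [^] i \<otimes> g)" using face_edges[OF g(1) w(1,3)] by auto
      then have "e = E (x [^] (i mod int p) \<otimes> g)" by (simp add: x_pow_mod)
      then show "e \<in> (\<lambda>i. E (x [^] i \<otimes> g)) ` {0..<int p}"
        using p_pos by (intro image_eqI[of _ _ "i mod int p"]) simp_all
    next
      fix e assume "e \<in> (\<lambda>i. E (x [^] i \<otimes> g)) ` {0..<int p}"
      then obtain i :: int where "e = E (x [^] i \<otimes> g)" by blast
      then show "e \<in> {e \<in> edges Q. incident Q e f}"
        using incident_EF'[OF xg[of i] g(1)] F_pow[OF g(1), of i] xg g by (simp add: Q_simps)
    qed
    moreover have "inj_on (\<lambda>i. E (x [^] i \<otimes> g)) {0..<int p}"
    proof (rule inj_onI)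
      fix i j assume ij: "i \<in> {0..<int p}" "j \<in> {0..<int p}" "E (x [^] i \<otimes> g) = E (x [^] j \<otimes> g)"
      then have "x [^] j \<otimes> g = x [^] i \<otimes> g \<or> x [^] j \<otimes> g = x \<otimes> y \<otimes> (x [^] i \<otimes> g)"
        using E_eq_iff[OF xg xg] by blast
      \<comment> \<open>The other element of an edge lies on the adjacent face, so it cannot be
        another point of the same coset of <x>.\<close>
      moreover have False if "x [^] j \<otimes> g = x \<otimes> y \<otimes> (x [^] i \<otimes> g)"
      proof -
        have "F (y \<otimes> (x [^] i \<otimes> g)) = F (x [^] j \<otimes> g)" unfolding that using flip_face[OF xg] by simp
        also have "\<dots> = F (x [^] i \<otimes> g)" using F_pow[OF g(1)] by simp
        finally show False using distinct(3)[OF xg] by blast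
      qed
      ultimately have "x [^] j \<otimes> g = x [^] i \<otimes> g" by blast
      then have "x [^] j = x [^] i" using g(1) by simp
      then have "int p dvd j - i" by (simp add: x_pow_eq_iff)
      then show "i = j" using ij by (metis atLeastLessThan_iff mod_eq_dvd_iff mod_pos_pos_trivial)
    qed
    ultimately show ?thesis by (simp add: card_image)
  qed
  moreover have "finite {e \<in> edges Q. incident Q v e} \<and> card {e \<in> edges Q. incident Q v e} = q" if v: "v \<in> vertices Q" for v
  proof -
    obtain g where g: "g \<in> carrier H" "v = V g" using v by (auto simp: Q_simps)
    have yg: "y [^] i \<otimes> g \<in> carrier H" for i :: int using g by simp
    have "{e \<in> edges Q. incident Q v e} = (\<lambda>i. E (y [^] i \<otimes> g)) ` {0..<int q}"
    proof (intro equalityI subsetI)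
      fix e assume "e \<in> {e \<in> edges Q. incident Q v e}"
      then obtain w where w: "w \<in> carrier H" "e = E w" "incident Q (V g) (E w)" using g by (auto simp: Q_simps)
      then obtain i :: int where "e = E (y [^] i \<otimes> g)" using vertex_edges[OF g(1) w(1,3)] by auto
      then have "e = E (y [^] (i mod int q) \<otimes> g)" by (simp add: y_pow_mod)
      then show "e \<in> (\<lambda>i. E (y [^] i \<otimes> g)) ` {0..<int q}"
        using q_pos by (intro image_eqI[of _ _ "i mod int q"]) simp_all
    next
      fix e assume "e \<in> (\<lambda>i. E (y [^] i \<otimes> g)) ` {0..<int q}"
      then obtain i :: int where "e = E (y [^] i \<otimes> g)" by blast
      then show "e \<in> {e \<in> edges Q. incident Q v e}"
        using incident_VE'[OF g(1) yg[of i]] V_pow[OF g(1), of i] yg g by (simp add: Q_simps)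
    qed
    moreover have "inj_on (\<lambda>i. E (y [^] i \<otimes> g)) {0..<int q}"
    proof (rule inj_onI)
      fix i j assume ij: "i \<in> {0..<int q}" "j \<in> {0..<int q}" "E (y [^] i \<otimes> g) = E (y [^] j \<otimes> g)"
      then have "y [^] j \<otimes> g = y [^] i \<otimes> g \<or> y [^] j \<otimes> g = x \<otimes> y \<otimes> (y [^] i \<otimes> g)"
        using E_eq_iff[OF yg yg] by blast
      moreover have False if "y [^] j \<otimes> g = x \<otimes> y \<otimes> (y [^] i \<otimes> g)"
      proof -
        have "V (x \<otimes> (y \<otimes> (y [^] i \<otimes> g))) = V (y [^] j \<otimes> g)" unfolding that using g(1) by (simp add: m_assoc)
        also have "\<dots> = V (y \<otimes> (y [^] i \<otimes> g))" using V_pow[OF g(1)] V_y(1)[OF yg] by simp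
        finally show False using distinct(1)[of "y \<otimes> (y [^] i \<otimes> g)"] yg by simp
      qed
      ultimately have "y [^] j \<otimes> g = y [^] i \<otimes> g" by blast
      then have "y [^] j = y [^] i" using g(1) by simp
      then have "int q dvd j - i" by (simp add: y_pow_eq_iff)
      then show "i = j" using ij by (metis atLeastLessThan_iff mod_eq_dvd_iff mod_pos_pos_trivial)
    qed
    ultimately show ?thesis by (simp add: card_image)
  qed
  ultimately show ?thesis by (simp add: has_type_def)
qed

lemma tight_Q: "tight Q"
proof -
  have "inj_on (\<lambda>(g, b). \<phi> g b) (carrier H \<times> UNIV)"
    by (rule inj_onI) (use Q.\<phi>_inj in force)
  then have "card (flags Q) = card (carrier H \<times> (UNIV :: bool set))"
    unfolding Q.flags_eq by (rule card_image)
  then have "card (flags Q) = 2 * p * q" by (simp add: card_cartesian_product card_carrier)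
  moreover have "finite (flags Q)" unfolding Q.flags_eq using finite_carrier by simp
  ultimately show ?thesis using has_type_Q by (auto simp: tight_def)
qed

end

section \<open>Atomic chiral polyhedra\<close>

context tight_pair
begin

lemma mirror_hom:
  assumes hom: "\<phi> \<in> hom G H" and H: "tight_pair H (\<phi> x) (\<phi> y) p' q'" and "mirror g h"
  shows "tight_pair.mirror H (\<phi> x) (\<phi> y) (\<phi> g) (\<phi> h)"
proof -
  interpret H: tight_pair H "\<phi> x" "\<phi> y" p' q' by (fact H)
  interpret \<phi>: group_hom G H \<phi> by unfold_locales (rule hom)
  show ?thesis using assms(3)
  proof (induction rule: mirror.induct)
    case mirror_one
    show ?case using H.mirror_one by simp
  next
    case (mirror_x g h)
    then show ?case using H.mirror_x[OF mirror_x.IH] mirror_closed[OF mirror_x.hyps] by simp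
  next
    case (mirror_y g h)
    then show ?case using H.mirror_y[OF mirror_y.IH] mirror_closed[OF mirror_y.hyps] by simp
  qed
qed

text \<open>A mirror image of \<one> outside N has a nontrivial image in H, so H is not reflexible
  and its coset polyhedron is chiral. The covering is the quotient map followed by the map into the
  rotation group.\<close>

lemma ex_chiral_quotient:
  fixes H :: "nat monoid"
  assumes hom: "\<phi> \<in> hom G H" and H: "tight_pair H (\<phi> x) (\<phi> y) p' q'"
    and p': "2 \<le> p'" and q': "2 \<le> q'"
    and ker: "\<And>g. g \<in> carrier G \<Longrightarrow> \<phi> g = \<one>\<^bsub>H\<^esub> \<Longrightarrow> g \<in> N"
    and N: "\<not> reflexible_mod N"
  shows "\<exists>(Q :: nat ranked_poset) \<Psi>. chiral Q \<and> \<Psi> \<in> flags Q \<and> has_type Q p' q' \<and> tight Q \<and>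
    (\<exists>h \<in> hom G (rotation_group Q \<Psi>). h x = sigma1 Q \<Psi> \<and> h y = sigma2 Q \<Psi>)"
proof -
  interpret H: tight_pair H "\<phi> x" "\<phi> y" p' q' by (fact H)
  interpret \<phi>: group_hom G H \<phi> by unfold_locales (rule hom)
  interpret C: coset_polyhedron H "\<phi> x" "\<phi> y" p' q' by unfold_locales (fact p', fact q')
  obtain h where h: "mirror \<one> h" "h \<notin> N" using N by (auto simp: reflexible_mod_def)
  have "\<not> H.reflexible_mod {\<one>\<^bsub>H\<^esub>}"
  proof
    assume "H.reflexible_mod {\<one>\<^bsub>H\<^esub>}"
    moreover have "H.mirror \<one>\<^bsub>H\<^esub> (\<phi> h)" using mirror_hom[OF hom H h(1)] by simp
    ultimately have "\<phi> h = \<one>\<^bsub>H\<^esub>" by (simp add: H.reflexible_mod_def)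
    then show False using ker h mirror_closed by blast
  qed
  then have "chiral C.Q" by (rule C.Q.chiralI)
  moreover have "C.\<phi> \<one>\<^bsub>H\<^esub> False \<in> flags C.Q" by (rule C.\<phi>_in_flags) simp
  moreover obtain \<theta> where \<theta>: "\<theta> \<in> hom H (rotation_group C.Q (C.\<phi> \<one>\<^bsub>H\<^esub> False))"
      "\<theta> (\<phi> x) = sigma1 C.Q (C.\<phi> \<one>\<^bsub>H\<^esub> False)" "\<theta> (\<phi> y) = sigma2 C.Q (C.\<phi> \<one>\<^bsub>H\<^esub> False)"
    using C.Q.hom_rotation_group by blast
  have "\<theta> \<circ> \<phi> \<in> hom G (rotation_group C.Q (C.\<phi> \<one>\<^bsub>H\<^esub> False))" by (rule Group.hom_compose[OF hom \<theta>(1)])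
  then have "\<exists>h \<in> hom G (rotation_group C.Q (C.\<phi> \<one>\<^bsub>H\<^esub> False)).
      h x = sigma1 C.Q (C.\<phi> \<one>\<^bsub>H\<^esub> False) \<and> h y = sigma2 C.Q (C.\<phi> \<one>\<^bsub>H\<^esub> False)"
    using \<theta>(2,3) by (intro bexI[of _ "\<theta> \<circ> \<phi>"]) simp_all
  ultimately show ?thesis using C.has_type_Q C.tight_Q by blast
qed

end

section \<open>Normalized subgroups of <y> forced by the relations of the two families\<close>

lemma (in invol_pair) conjg_normal_8:
  fixes j :: int
  assumes "x [^] (8::nat) = \<one>"
    and rel: "x [^] (3::int) \<otimes> y [^] (1 + j - 1) \<otimes> x [^] (-3::int) = y [^] (- (-1 + j) - 1)"
  shows "\<exists>k c. k dvd - 1 + j + 1 \<and> conjg x (y [^] k) = y [^] (c * k)"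
proof -
  \<comment> \<open>Here j is the signed power of 2 from the presentation; the relation says that
    x^3 inverts y^j.\<close>
  have "conjg (x [^] (3::int)) (y [^] j) = y [^] (-1 * j)"
    using rel by (simp add: conjg_def int_pow_neg)
  then have "\<exists>c. conjg x (y [^] j) = y [^] (c * j)"
    using assms(1) by (intro conjg_odd_power[of 3 j "-1" 3]) simp_all
  moreover have "j dvd - 1 + j + 1" by simp
  ultimately show ?thesis by blast
qed

text \<open>Modulo 2^a the exponent 1 + 2^(a - 1) is the negative of i = -1 + 2^(a - 1), so the
  relation is a conjugation by x^i. It sends y^(4 w) to y^(4 w') with w odd, and y^4 is a power of
  y^(4 w).\<close>

lemma (in invol_pair) conjg_normal_4:
  fixes s :: int and a :: nat
  assumes a: "4 \<le> a" and x_pow: "x [^] ((2::nat) ^ a) = \<one>" and y_pow: "y [^] ((2::nat) ^ (a + 1)) = \<one>"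
    and rel: "x [^] (-1 + 2 ^ (a - 1) :: int) \<otimes> y [^] (-3 + s * 2 ^ (a - 1) - 1) \<otimes> x [^] (1 + 2 ^ (a - 1) :: int) =
      y [^] (- (3 + s * 2 ^ (a - 1)) - 1)"
  shows "\<exists>k c. k dvd 3 + s * 2 ^ (a - 1) + 1 \<and> conjg x (y [^] k) = y [^] (c * k)"
proof -
  obtain n where "a = 4 + n" using a le_Suc_ex by blast
  then have n: "a = Suc (Suc (Suc (Suc n)))" by simp
  define i :: int where "i = -1 + 2 ^ (a - 1)"
  define w :: int where "w = -1 + s * 2 ^ (a - 3)"
  define w' :: int where "w' = -1 - s * 2 ^ (a - 3)"
  have xp: "x [^] (int (2 ^ a) * l) = \<one>" for l
    using x_pow by (simp only: int_pow_pow [symmetric] x_in int_pow_int) simp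
  have yp: "y [^] (int (2 ^ (a + 1)) * l) = \<one>" for l
    using y_pow by (simp only: int_pow_pow [symmetric] y_in int_pow_int) simp
  have "1 + 2 ^ (a - 1) = - i + int (2 ^ a) * 1" by (simp add: i_def n)
  then have "x [^] (1 + 2 ^ (a - 1) :: int) = inv (x [^] i)"
    using int_pow_mult[of x "- i" "int (2 ^ a) * 1"] xp[of 1] by (simp only: x_in int_pow_neg) simp
  moreover have e: "-3 + s * 2 ^ (a - 1) - 1 = 4 * w" "- (3 + s * 2 ^ (a - 1)) - 1 = 4 * w'"
    by (simp_all add: w_def w'_def n)
  ultimately have rel': "conjg (x [^] i) (y [^] (4 * w)) = y [^] (4 * w')"
    using rel unfolding conjg_def i_def[symmetric] e by simp
  have "odd w" by (simp add: w_def n)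
  then have "coprime w ((2::int) ^ (a - 1))" by simp
  \<comment> \<open>r inverts w modulo 2^(a - 1), the order bound for y^4.\<close>
  then obtain r l where r: "r * w + l * 2 ^ (a - 1) = 1" using bezout_int[of w "2 ^ (a - 1)"] by auto
  have "4 = 4 * w * r + int (2 ^ (a + 1)) * l"
  proof -
    have "int (2 ^ (a + 1)) = 4 * 2 ^ (a - 1)" by (simp add: n)
    then have "4 * w * r + int (2 ^ (a + 1)) * l = 4 * w * r + 4 * 2 ^ (a - 1) * l" by (simp only:)
    also have "\<dots> = 4 * (r * w + l * 2 ^ (a - 1))" by (simp only: distrib_left mult_ac)
    finally show ?thesis by (simp only: r)
  qed
  then have "y [^] (4::int) = y [^] (4 * w * r) \<otimes> y [^] (int (2 ^ (a + 1)) * l)"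
    using int_pow_mult[of y "4 * w * r" "int (2 ^ (a + 1)) * l"] by simp
  then have y4: "y [^] (4::int) = (y [^] (4 * w)) [^] r" unfolding yp by (simp add: int_pow_pow)
  have "conjg (x [^] i) (y [^] (4::int)) = (y [^] (4 * w')) [^] r"
    unfolding y4 by (simp only: conjg_int_pow int_pow_closed x_in y_in rel')
  then have "conjg (x [^] i) (y [^] (4::int)) = y [^] (w' * r * 4)" by (simp add: int_pow_pow ac_simps)
  moreover have "odd i" by (simp add: i_def n)
  ultimately have "\<exists>c::int. conjg x (y [^] (4::int)) = y [^] (c * 4)"
    using conjg_odd_power[OF _ _ x_pow] by blast
  moreover have "4 dvd 3 + s * 2 ^ (a - 1) + 1" by (simp add: n)
  ultimately show ?thesis by blast
qed

text \<open>Atomicity acts through two quotients of the rotation group, by the subgroup of order 2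
  in <\<open>s2\<close>> and, when it is central, by the one in <\<open>s1\<close>>. Were such a
  quotient not reflexible, its coset polyhedron would be a smaller tight chiral polyhedron covered
  by P. The relations found in the rotation group are complete because the group they present is no
  larger.\<close>

theorem theorem4p14:
  fixes P :: "'a ranked_poset" and \<Phi> :: "'a flag" and \<alpha> \<beta> :: nat
  assumes "0 < \<alpha>" and "0 < \<beta>" and "\<alpha> < \<beta>"
    and "atomic_chiral P \<Phi> (2 ^ \<alpha>) (2 ^ \<beta>)"
  shows "(has_type P 8 (2 ^ \<beta>) \<and> 5 \<le> \<beta> \<and>
          (\<exists>s \<in> {1, -1 :: int}.
             rotation_group_is_Gamma P \<Phi> 8 (2 ^ \<beta>)
               3 (1 + s * 2 ^ (\<beta> - 2)) (-3) (-1 + s * 2 ^ (\<beta> - 2))))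
       \<or> (has_type P (2 ^ \<alpha>) (2 ^ (\<alpha> + 1)) \<and> 4 \<le> \<alpha> \<and>
          (\<exists>s \<in> {1, -1 :: int}.
             rotation_group_is_Gamma P \<Phi> (2 ^ \<alpha>) (2 ^ (\<alpha> + 1))
               (-1 + 2 ^ (\<alpha> - 1)) (-3 + s * 2 ^ (\<alpha> - 1))
               (1 + 2 ^ (\<alpha> - 1)) (3 + s * 2 ^ (\<alpha> - 1))))"
proof -
  have P: "chiral P" "\<Phi> \<in> flags P" "has_type P (2 ^ \<alpha>) (2 ^ \<beta>)" "tight P"
    using assms(4) by (simp_all add: atomic_chiral_def)
  have atomic: "\<not> (p' < 2 ^ \<alpha> \<and> q' = 2 ^ \<beta> \<or> p' = 2 ^ \<alpha> \<and> q' < 2 ^ \<beta>)"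
    if "chiral Q" "\<Psi> \<in> flags Q" "has_type Q p' q'" "tight Q" "covers P \<Phi> Q \<Psi>"
    for Q :: "nat ranked_poset" and \<Psi> p' q'
    using assms(4) that unfolding atomic_chiral_def by blast
  interpret chiral_flag P \<Phi> by unfold_locales (use P in \<open>auto simp: chiral_def\<close>)
  have tp: "tight_pair R s1 s2 (2 ^ \<alpha>) (2 ^ \<beta>)" by (rule tight_pair_R[OF P(3,4)])
  interpret T: tight_pair R s1 s2 "2 ^ \<alpha>" "2 ^ \<beta>" by (fact tp)
  interpret S: tight_pair R s2 s1 "2 ^ \<beta>" "2 ^ \<alpha>" by (rule T.swap)
  have \<alpha>1: "1 \<le> \<alpha>" and \<beta>2: "2 \<le> \<beta>" using assms by simp_all
  have y_quotient: "T.reflexible_mod (range (\<lambda>j::int. s2 [^]\<^bsub>R\<^esub> (2 ^ (\<beta> - 1) * j)))" (is "T.reflexible_mod ?N")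
  proof (rule ccontr)
    assume N: "\<not> T.reflexible_mod ?N"
    have "(2::nat) ^ (\<beta> - 1) dvd 2 ^ \<beta>" by (simp add: le_imp_power_dvd)
    moreover have "T.conjg s1 (s2 [^]\<^bsub>R\<^esub> int (2 ^ (\<beta> - 1))) = s2 [^]\<^bsub>R\<^esub> int (2 ^ (\<beta> - 1))"
      using T.y_half_central[of \<beta>] assms by simp
    ultimately obtain H :: "nat monoid" and \<phi> where H: "\<phi> \<in> hom R H"
      "tight_pair H (\<phi> s1) (\<phi> s2) (2 ^ \<alpha>) (2 ^ (\<beta> - 1))"
      "\<forall>g \<in> carrier R. \<phi> g = \<one>\<^bsub>H\<^esub> \<longleftrightarrow> (\<exists>j::int. g = s2 [^]\<^bsub>R\<^esub> (int (2 ^ (\<beta> - 1)) * j))"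
      using T.ex_y_quotient by blast
    have "g \<in> ?N" if "g \<in> carrier R" "\<phi> g = \<one>\<^bsub>H\<^esub>" for g using H(3) that by auto
    moreover have "2 \<le> (2::nat) ^ \<alpha>" "2 \<le> (2::nat) ^ (\<beta> - 1)"
      using \<alpha>1 \<beta>2 power_increasing[of 1 \<alpha> "2::nat"] power_increasing[of 1 "\<beta> - 1" "2::nat"] by simp_all
    ultimately obtain Q :: "nat ranked_poset" and \<Psi> where Q: "chiral Q" "\<Psi> \<in> flags Q"
        "has_type Q (2 ^ \<alpha>) (2 ^ (\<beta> - 1))" "tight Q"
      and h: "\<exists>h \<in> hom R (rotation_group Q \<Psi>). h s1 = sigma1 Q \<Psi> \<and> h s2 = sigma2 Q \<Psi>"
      using T.ex_chiral_quotient[OF H(1,2) _ _ _ N] by blast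
    have "(2::nat) ^ (\<beta> - 1) < 2 ^ \<beta>" using assms by (intro power_strict_increasing) simp_all
    then show False using atomic[OF Q] h by (simp add: covers_def)
  qed
  have x_quotient: "T.reflexible_mod (range (\<lambda>j::int. s1 [^]\<^bsub>R\<^esub> (2 ^ (\<alpha> - 1) * j)))" (is "T.reflexible_mod ?N")
    if \<alpha>2: "2 \<le> \<alpha>" and central: "T.conjg s2 (s1 [^]\<^bsub>R\<^esub> (2 ^ (\<alpha> - 1) :: int)) = s1 [^]\<^bsub>R\<^esub> (2 ^ (\<alpha> - 1) :: int)"
  proof (rule ccontr)
    assume N: "\<not> T.reflexible_mod ?N"
    have "(2::nat) ^ (\<alpha> - 1) dvd 2 ^ \<alpha>" by (simp add: le_imp_power_dvd)
    moreover have "T.conjg s2 (s1 [^]\<^bsub>R\<^esub> int (2 ^ (\<alpha> - 1))) = s1 [^]\<^bsub>R\<^esub> int (2 ^ (\<alpha> - 1))"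
      using central by simp
    ultimately obtain H :: "nat monoid" and \<phi> where H: "\<phi> \<in> hom R H"
      "tight_pair H (\<phi> s2) (\<phi> s1) (2 ^ \<beta>) (2 ^ (\<alpha> - 1))"
      "\<forall>g \<in> carrier R. \<phi> g = \<one>\<^bsub>H\<^esub> \<longleftrightarrow> (\<exists>j::int. g = s1 [^]\<^bsub>R\<^esub> (int (2 ^ (\<alpha> - 1)) * j))"
      using S.ex_y_quotient by blast
    have "g \<in> ?N" if "g \<in> carrier R" "\<phi> g = \<one>\<^bsub>H\<^esub>" for g using H(3) that by auto
    moreover have "2 \<le> (2::nat) ^ \<beta>" "2 \<le> (2::nat) ^ (\<alpha> - 1)"
      using \<alpha>2 \<beta>2 power_increasing[of 1 \<beta> "2::nat"] power_increasing[of 1 "\<alpha> - 1" "2::nat"] by simp_all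
    ultimately obtain Q :: "nat ranked_poset" and \<Psi> where Q: "chiral Q" "\<Psi> \<in> flags Q"
        "has_type Q (2 ^ (\<alpha> - 1)) (2 ^ \<beta>)" "tight Q"
      and h: "\<exists>h \<in> hom R (rotation_group Q \<Psi>). h s1 = sigma1 Q \<Psi> \<and> h s2 = sigma2 Q \<Psi>"
      using T.ex_chiral_quotient[OF H(1) tight_pair.swap[OF H(2)] _ _ _ N] by blast
    have "(2::nat) ^ (\<alpha> - 1) < 2 ^ \<alpha>" using assms by (intro power_strict_increasing) simp_all
    then show False using atomic[OF Q] h by (simp add: covers_def)
  qed
  note minimal = T.minimal_nonreflexible[OF HOL.refl HOL.refl \<alpha>1 assms(3) nonreflexible_R[OF tp] y_quotient]
  have case_8: ?thesis
    if \<alpha>: "\<alpha> = 3" and \<beta>: "5 \<le> \<beta>" and s: "s \<in> {1, -1}"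
      and rel: "inv\<^bsub>R\<^esub> s2 \<otimes>\<^bsub>R\<^esub> s1 = s1 [^]\<^bsub>R\<^esub> (3::int) \<otimes>\<^bsub>R\<^esub> s2 [^]\<^bsub>R\<^esub> (1 + s * 2 ^ (\<beta> - 2))"
        "s2 \<otimes>\<^bsub>R\<^esub> inv\<^bsub>R\<^esub> s1 = s1 [^]\<^bsub>R\<^esub> (-3::int) \<otimes>\<^bsub>R\<^esub> s2 [^]\<^bsub>R\<^esub> (-1 + s * 2 ^ (\<beta> - 2))"
    for s :: int
  proof -
    have "rotation_group_is_Gamma P \<Phi> (int (2 ^ \<alpha>)) (int (2 ^ \<beta>))
        3 (1 + s * 2 ^ (\<beta> - 2)) (-3) (-1 + s * 2 ^ (\<beta> - 2))"
      unfolding rotation_group_is_Gamma_def Let_def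
      by (rule T.Gamma_iso[OF rel]) (use \<alpha> invol_pair.conjg_normal_8 in auto)
    then show ?thesis using \<alpha> \<beta> s P(3) by auto
  qed
  have case_double: ?thesis
    if \<beta>: "\<beta> = \<alpha> + 1" and \<alpha>: "4 \<le> \<alpha>" and s: "s \<in> {1, -1}"
      and rel: "inv\<^bsub>R\<^esub> s2 \<otimes>\<^bsub>R\<^esub> s1 =
          s1 [^]\<^bsub>R\<^esub> (-1 + 2 ^ (\<alpha> - 1) :: int) \<otimes>\<^bsub>R\<^esub> s2 [^]\<^bsub>R\<^esub> (-3 + s * 2 ^ (\<alpha> - 1))"
        "s2 \<otimes>\<^bsub>R\<^esub> inv\<^bsub>R\<^esub> s1 =
          s1 [^]\<^bsub>R\<^esub> (1 + 2 ^ (\<alpha> - 1) :: int) \<otimes>\<^bsub>R\<^esub> s2 [^]\<^bsub>R\<^esub> (3 + s * 2 ^ (\<alpha> - 1))"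
    for s :: int
  proof -
    have "rotation_group_is_Gamma P \<Phi> (int (2 ^ \<alpha>)) (int (2 ^ \<beta>))
        (-1 + 2 ^ (\<alpha> - 1)) (-3 + s * 2 ^ (\<alpha> - 1)) (1 + 2 ^ (\<alpha> - 1)) (3 + s * 2 ^ (\<alpha> - 1))"
      unfolding rotation_group_is_Gamma_def Let_def
    proof (rule T.Gamma_iso[OF rel])
      show "odd (1 + 2 ^ (\<alpha> - 1) :: int)" using \<alpha> by simp
      show "\<exists>k c. k dvd 3 + s * 2 ^ (\<alpha> - 1) + 1 \<and> group.conjg H u (v [^]\<^bsub>H\<^esub> k) = v [^]\<^bsub>H\<^esub> (c * k)"
        if "invol_pair H u v" "u [^]\<^bsub>H\<^esub> (2 ^ \<alpha> :: nat) = \<one>\<^bsub>H\<^esub>" "v [^]\<^bsub>H\<^esub> (2 ^ \<beta> :: nat) = \<one>\<^bsub>H\<^esub>"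
          "u [^]\<^bsub>H\<^esub> (-1 + 2 ^ (\<alpha> - 1) :: int) \<otimes>\<^bsub>H\<^esub> v [^]\<^bsub>H\<^esub> (-3 + s * 2 ^ (\<alpha> - 1) - 1) \<otimes>\<^bsub>H\<^esub>
            u [^]\<^bsub>H\<^esub> (1 + 2 ^ (\<alpha> - 1) :: int) = v [^]\<^bsub>H\<^esub> (- (3 + s * 2 ^ (\<alpha> - 1)) - 1)"
        for H :: "gen word set monoid" and u v
        by (rule invol_pair.conjg_normal_4[OF that(1) \<alpha> that(2) that(3)[unfolded \<beta>] that(4)])
    qed
    then show ?thesis using \<alpha> \<beta> s P(3) by auto
  qed
  show ?thesis
    by (rule minimal[THEN disjE], rule x_quotient, assumption, assumption,
        elim conjE bexE, rule case_8, assumption+, elim conjE bexE, rule case_double, assumption+)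
qed

end
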